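(* Let $T>0$, let $B^H$ be a fractional Brownian motion with Hurst parameter $H\in\left(\frac12,1\right)$, let $S(t)=e^{B^H(t)}$, and let $f:\mathbb{R}\to\mathbb{R}$ be a convex function with left derivative $f'_-$. Then it holds almost surely that $$f\left(\frac1T\int_0^T S(s)\,ds\right)=f(S(0))+\int_0^T f'_-\left(\frac{T-s}{T}S(s)+\frac1T\int_0^s S(u)\,du\right)\frac{T-s}{T}S(s)\,dB^H(s),$$ where the stochastic integral is understood in the sense of the generalized Lebesgue-Stieltjes integral.
   Context: Setting: $(\Omega,\mathcal{F},(\mathcal{F}_t)_{t\ge0},\mathbb{P})$ is a complete filtered probability space. Fractional Brownian motion $(B^H(t))_{t\ge0}$ is a Gaussian process with $\mathbb{E}B^H(t)=B^H(0)$ (a constant) and $\mathrm{Cov}(B^H(t),B^H(s))=\frac12\left(t^{2H}+s^{2H}-|t-s|^{2H}\right)$; its trajectories on $[0,T]$ belong almost surely to the space $W_1^\beta([0,T])$ defined below for every $0<\beta<H$ (in particular they are continuous). Fractional Besov spaces: for $\beta\in(0,1)$ and measurable $f:[0,T]\to\mathbb{R}$, $f\in W_1^\beta([0,T])$ iff $\|f\|_{1,\beta}=\sup_{0\le s<t\le T}\left(\frac{|f(t)-f(s)|}{(t-s)^\beta}+\int_s^t\frac{|f(u)-f(s)|}{(u-s)^{\beta+1}}du\right)<\infty$, and $f\in W_2^\beta([0,T])$ iff $\|f\|_{2,\beta}=\int_0^T\frac{|f(t)|}{t^\beta}dt+\int_0^T\int_0^t\frac{|f(t)-f(s)|}{(t-s)^{\beta+1}}ds\,dt<\infty$.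 Fractional derivatives on $[0,t]$: for $\alpha\in(0,1)$, $(D^\alpha_{0+}f)(x)=\frac{1}{\Gamma(1-\alpha)}\frac{d}{dx}\int_0^x f(s)(x-s)^{-\alpha}ds$ and $(D^\alpha_{t-}f)(x)=\frac{-1}{\Gamma(1-\alpha)}\frac{d}{dx}\int_x^t f(s)(s-x)^{-\alpha}ds$. Generalized Lebesgue-Stieltjes integral: if for some $\beta\in(0,1)$ one has $f\in W_2^\beta([0,T])$ and $g\in W_1^{1-\beta}([0,T])$, then for $t\in(0,T]$ the Lebesgue integral $\int_0^t f\,dg:=\int_0^t (D^\beta_{0+}f)(x)\,(D^{1-\beta}_{t-}g_{t-})(x)\,dx$, with $g_{t-}(x)=g(t-)-g(x)$, exists and is called the generalized Lebesgue-Stieltjes integral of $f$ with respect to $g$; its value is the same for all admissible $\beta$. Stochastic integrals with respect to $B^H$ are taken pathwise in this sense. *)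

theory Defs
  imports "HOL-Probability.Probability"
begin

section \<open>Fractional Brownian motion\<close>

locale complete_filtered_prob_space = prob_space M + complete_measure M
  for M :: "'a measure" and F :: "real \<Rightarrow> 'a measure" +
  assumes subalgebra_F: "\<And>t. 0 \<le> t \<Longrightarrow> subalgebra M (F t)"
    and sets_F_mono: "\<And>s t. 0 \<le> s \<Longrightarrow> s \<le> t \<Longrightarrow> sets (F s) \<subseteq> sets (F t)"
    and null_sets_F: "null_sets M \<subseteq> sets (F 0)"

text \<open>
  Degenerate (almost surely constant) Gaussian variables are allowed: every increment of a
  process over an interval of length zero, and the initial value of a fractional Brownian
  motion, are of this kind.
\<close>

definition gaussian_rv :: "'a measure \<Rightarrow> ('a \<Rightarrow> real) \<Rightarrow> bool" where
  "gaussian_rv M X \<longleftrightarrow> X \<in> borel_measurable M \<and>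
     ((\<exists>m. AE \<omega> in M. X \<omega> = m) \<or>
      (\<exists>m \<sigma>. \<sigma> > 0 \<and> distributed M lborel X (\<lambda>x. ennreal (normal_density m \<sigma> x))))"

text \<open>Processes are indexed by \<^typ>\<open>real\<close>; only times \<open>t \<ge> 0\<close> are meaningful.\<close>

definition gaussian_process :: "'a measure \<Rightarrow> (real \<Rightarrow> 'a \<Rightarrow> real) \<Rightarrow> bool" where
  "gaussian_process M X \<longleftrightarrow>
     (\<forall>I c. finite I \<longrightarrow> I \<subseteq> {0..} \<longrightarrow> gaussian_rv M (\<lambda>\<omega>. \<Sum>t\<in>I. c t * X t \<omega>))"

definition covariance :: "'a measure \<Rightarrow> ('a \<Rightarrow> real) \<Rightarrow> ('a \<Rightarrow> real) \<Rightarrow> real" where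
  "covariance M X Y =
     (LINT \<omega>|M. (X \<omega> - (LINT \<omega>'|M. X \<omega>')) * (Y \<omega> - (LINT \<omega>'|M. Y \<omega>')))"

text \<open>
  The fractional Besov spaces on \<open>[0,T]\<close>. The norms take values in \<^typ>\<open>ennreal\<close>, so that
  membership is finiteness of the norm. In each inner integral the singular endpoint
  contributes the value \<open>x / 0 = 0\<close> on a null set.
\<close>

definition besov1_norm :: "real \<Rightarrow> real \<Rightarrow> (real \<Rightarrow> real) \<Rightarrow> ennreal" where
  "besov1_norm T \<beta> f =
     (SUP (s, t) \<in> {(s, t). 0 \<le> s \<and> s < t \<and> t \<le> T}.
        ennreal (\<bar>f t - f s\<bar> / (t - s) powr \<beta>) +
        (\<integral>\<^sup>+u\<in>{s..t}. ennreal (\<bar>f u - f s\<bar> / (u - s) powr (\<beta> + 1)) \<partial>lebesgue))"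

definition besov1 :: "real \<Rightarrow> real \<Rightarrow> (real \<Rightarrow> real) set" where
  "besov1 T \<beta> = {f \<in> borel_measurable (lebesgue_on {0..T}). besov1_norm T \<beta> f < \<infinity>}"

definition besov2_norm :: "real \<Rightarrow> real \<Rightarrow> (real \<Rightarrow> real) \<Rightarrow> ennreal" where
  "besov2_norm T \<beta> f =
     (\<integral>\<^sup>+t\<in>{0..T}. ennreal (\<bar>f t\<bar> / t powr \<beta>) \<partial>lebesgue) +
     (\<integral>\<^sup>+t\<in>{0..T}. (\<integral>\<^sup>+s\<in>{0..t}. ennreal (\<bar>f t - f s\<bar> / (t - s) powr (\<beta> + 1)) \<partial>lebesgue) \<partial>lebesgue)"

definition besov2 :: "real \<Rightarrow> real \<Rightarrow> (real \<Rightarrow> real) set" where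
  "besov2 T \<beta> = {f \<in> borel_measurable (lebesgue_on {0..T}). besov2_norm T \<beta> f < \<infinity>}"

text \<open>
  The Besov regularity of the trajectories is part of the definition: mean and covariance
  alone determine the process only up to modification.
\<close>

definition fractional_brownian_motion ::
    "'a measure \<Rightarrow> real \<Rightarrow> (real \<Rightarrow> 'a \<Rightarrow> real) \<Rightarrow> bool" where
  "fractional_brownian_motion M H B \<longleftrightarrow>
     gaussian_process M B \<and>
     (\<exists>b. (AE \<omega> in M. B 0 \<omega> = b) \<and> (\<forall>t\<ge>0. (LINT \<omega>|M. B t \<omega>) = b)) \<and>
     (\<forall>s\<ge>0. \<forall>t\<ge>0. covariance M (B t) (B s) =
        (t powr (2 * H) + s powr (2 * H) - \<bar>t - s\<bar> powr (2 * H)) / 2) \<and>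
     (\<forall>T>0. \<forall>\<beta>. 0 < \<beta> \<longrightarrow> \<beta> < H \<longrightarrow> (AE \<omega> in M. (\<lambda>t. B t \<omega>) \<in> besov1 T \<beta>))"

section \<open>The generalized Lebesgue--Stieltjes integral\<close>

definition frac_deriv_0 :: "real \<Rightarrow> (real \<Rightarrow> real) \<Rightarrow> real \<Rightarrow> real" where
  "frac_deriv_0 \<alpha> f x =
     1 / Gamma (1 - \<alpha>) * deriv (\<lambda>y. LINT s:{0..y}|lebesgue. f s * (y - s) powr (- \<alpha>)) x"

definition frac_deriv_end :: "real \<Rightarrow> real \<Rightarrow> (real \<Rightarrow> real) \<Rightarrow> real \<Rightarrow> real" where
  "frac_deriv_end t \<alpha> f x =
     - 1 / Gamma (1 - \<alpha>) * deriv (\<lambda>y. LINT s:{y..t}|lebesgue. f s * (s - y) powr (- \<alpha>)) x"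

definition gls_admissible :: "real \<Rightarrow> (real \<Rightarrow> real) \<Rightarrow> (real \<Rightarrow> real) \<Rightarrow> real \<Rightarrow> bool" where
  "gls_admissible T f g \<beta> \<longleftrightarrow>
     0 < \<beta> \<and> \<beta> < 1 \<and> f \<in> besov2 T \<beta> \<and> g \<in> besov1 T (1 - \<beta>)"

definition gls_integrand ::
    "(real \<Rightarrow> real) \<Rightarrow> (real \<Rightarrow> real) \<Rightarrow> real \<Rightarrow> real \<Rightarrow> real \<Rightarrow> real" where
  "gls_integrand f g t \<beta> x =
     frac_deriv_0 \<beta> f x * frac_deriv_end t (1 - \<beta>) (\<lambda>y. Lim (at_left t) g - g y) x"

text \<open>
  \<open>has_gls_integral T f g t I\<close> says that, for \<open>f\<close>, \<open>g\<close> on \<open>[0,T]\<close>, the integral of \<open>f\<close> with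
  respect to \<open>g\<close> over \<open>[0,t]\<close> is defined and equal to \<open>I\<close>. Some exponent must be admissible, and
  since the value does not depend on the choice, every admissible exponent has to give \<open>I\<close>;
  thus \<open>I\<close> is unique by definition.
\<close>

definition has_gls_integral ::
    "real \<Rightarrow> (real \<Rightarrow> real) \<Rightarrow> (real \<Rightarrow> real) \<Rightarrow> real \<Rightarrow> real \<Rightarrow> bool" where
  "has_gls_integral T f g t I \<longleftrightarrow>
     (\<exists>\<beta>. gls_admissible T f g \<beta>) \<and>
     (\<forall>\<beta>. gls_admissible T f g \<beta> \<longrightarrow>
        set_integrable lebesgue {0..t} (gls_integrand f g t \<beta>) \<and>
        (LINT x:{0..t}|lebesgue. gls_integrand f g t \<beta> x) = I)"

end

(*
The generalized Lebesgue-Stieltjes integral is a forward integral: for bounded phi and any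
admissible exponent,
  int phi dg = lim (e -> 0) of int_0^T phi(s) (g(min (s + e) T) - g(s)) / e ds.
Indeed the Riemann-Liouville integrals of phi and of g are indefinite integrals of the
Marchaud derivatives, the difference quotients of the second one are bounded, and Fubini together with
Abel inversion returns phi. This makes the value independent of the exponent.

Let X_s = (T-s)/T S_s + 1/T int_0^s S and w_s = (T-s)/T S_s, so that X_t - X_s = w_s (B_t - B_s) up to
O(|t-s|^(2 gamma)) for a Hoelder exponent gamma > 1/2 of the path. Convexity bounds the error of the first order
expansion of f by |f'(X_t) - f'(X_s)| |X_t - X_s|. If f'(X) w lies in the space W_2 of exponent 1 - gamma,
these errors vanish in the forward integral along a suitable sequence e_n -> 0, and what
remains telescopes to f(X_T) - f(X_0).

The regularity of f'(X) w for discontinuous f' is probabilistic. Regression writes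
B_t = rho_t B_s + R_t with rho_t >= 0 and R independent of B_s. For fixed R, X_s is an increasing
function of z = B_s with derivative at least w_s, so the substitution x = X_s(z) gives
E[(h(X_s + eta) - h(X_s - eta)) w_s] <= C eta s^(-H) for bounded monotone h; by Tonelli and
the Hoelder continuity of X, this is integrable against r^(gamma - 2) with eta = K r^gamma.
*)
theory Submission
  imports Defs
begin

section \<open>Differentiation of indefinite integrals\<close>

text \<open>The fractional derivatives in the integral are classical derivatives of
  Riemann-Liouville integrals, hence identified only almost everywhere; this is why the development
  starts from Lebesgue differentiation. The main obstacle is that \<open>f'\<close> may jump, so
  membership of the integrand in \<open>besov2\<close> cannot be read off from the Hoelder
  continuity of \<open>X\<close>. The weight \<open>w\<close> helps twice: it bounds from below the
  derivative of \<open>X s\<close> in the direction \<open>B s\<close>, and it turns increments of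
  \<open>f'\<close> into increments of the integrand without a division, although
  \<open>w T = 0\<close>. The expectation estimate needs deterministic data, whereas the Hoelder
  constant and the range of \<open>X\<close> are random; integer bounds \<open>k\<close> and
  \<open>N\<close> together with a truncated \<open>f'\<close> reduce this to countably many null
  sets. Regression involves finitely many times, so the running average is first replaced by Riemann
  sums. The factor \<open>s powr (-H)\<close> is the reciprocal standard deviation of
  \<open>B s\<close>, and \<open>1 / 2 < \<gamma>\<close> enters through
  \<open>r powr (2 * \<gamma> - 2)\<close>, integrable at 0, and
  \<open>e n powr (2 * \<gamma> - 1)\<close>, which tends to 0.\<close>

text \<open>
  Vitali's covering theorem selects disjoint intervals on which the difference quotient is far
  from \<open>f x\<close>; tagged by \<open>x\<close> they form a partial division, whose total length Henstock's lemma
  makes small.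
\<close>

lemma negligible_not_differentiable_indefinite_integral:
  fixes f :: "real \<Rightarrow> real"
  assumes f: "f integrable_on {a..b}"
  shows "negligible {x \<in> {a<..<b}. \<not> ((\<lambda>y. integral {a..y} f) has_real_derivative f x) (at x)}"
proof -
  define F where "F = (\<lambda>y. integral {a..y} f)"
  define bad where "bad c x y \<longleftrightarrow> c * \<bar>y - x\<bar> \<le> \<bar>F y - F x - f x * (y - x)\<bar>" for c x y
  \<comment> \<open>A failure to have derivative \<open>f x\<close> shows up as points
    \<open>y\<close> arbitrarily close to \<open>x\<close> whose relative error is at least some
    \<open>c > 0\<close>; the sets with \<open>c = 1 / Suc n\<close> exhaust all failures.\<close>
  define E where "E c = {x \<in> {a<..<b}. \<forall>d>0. \<exists>y\<in>{a<..<b}. y \<noteq> x \<and> \<bar>y - x\<bar> < d \<and> bad c x y}" for c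
  have F_diff: "integral {x..y} f = F y - F x" if "a \<le> x" "x \<le> y" "y \<le> b" for x y
  proof -
    have "f integrable_on {a..y}"
      using f integrable_on_subinterval that by fastforce
    from Henstock_Kurzweil_Integration.integral_combine[OF that(1,2) this] show ?thesis
      by (simp add: F_def)
  qed
  have negl_E: "negligible (E c)" if "c > 0" for c
    unfolding negligible_outer_le
  proof (intro allI impI)
    fix e :: real assume "e > 0"
    have f': "f integrable_on cbox a b" using f by simp
    \<comment> \<open>The tolerance is \<open>c * e\<close> because a bad interval carries an error
      of at least \<open>c\<close> times its length; division by \<open>c\<close> leaves total
      length at most \<open>e\<close>.\<close>
    obtain \<gamma> where \<gamma>: "gauge \<gamma>"
      "\<And>p. p tagged_partial_division_of (cbox a b) \<Longrightarrow> \<gamma> fine p \<Longrightarrow>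
        (\<Sum>(x,k)\<in>p. norm (measure lborel k *\<^sub>R f x - integral k f)) < c * e"
      using Henstock_lemma[OF f', of "c * e"] \<open>c > 0\<close> \<open>e > 0\<close> by auto
    \<comment> \<open>The interval between \<open>x\<close> and \<open>y\<close>, written as a ball
      since the covering theorem is about balls. The tag \<open>x\<close> is one of its
      endpoints.\<close>
    define I where "I = (\<lambda>(x::real,y). cball ((x+y)/2) (\<bar>y-x\<bar>/2))"
    have I: "I (x,y) = {min x y..max x y}" for x y
      unfolding I_def by (auto simp: cball_eq_atLeastAtMost field_simps split: abs_split)
    define K where "K = {(x,y). x \<in> E c \<and> y \<in> {a<..<b} \<and> y \<noteq> x \<and> bad c x y \<and> I (x,y) \<subseteq> \<gamma> x}"
    have K_small: "\<exists>i. i \<in> K \<and> x \<in> cball ((fst i + snd i)/2) (\<bar>snd i - fst i\<bar>/2) \<and> \<bar>snd i - fst i\<bar>/2 < d"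
      if x: "x \<in> E c" and d: "d > 0" for x d
    proof -
      have "open (\<gamma> x)" "x \<in> \<gamma> x" using \<gamma>(1) by (auto simp: gauge_def)
      then obtain \<delta> where \<delta>: "\<delta> > 0" "ball x \<delta> \<subseteq> \<gamma> x"
        by (meson openE)
      obtain y where y: "y\<in>{a<..<b}" "y \<noteq> x" "\<bar>y - x\<bar> < min \<delta> d" "bad c x y"
        using x \<delta>(1) d unfolding E_def by (auto dest!: spec[of _ "min \<delta> d"])
      have "I (x,y) \<subseteq> ball x \<delta>"
        unfolding I using y(3) by (auto simp: dist_real_def)
      then have "(x,y) \<in> K" unfolding K_def using y x \<delta> by auto
      moreover have "x \<in> I (x,y)" unfolding I by auto
      ultimately show ?thesis
        using y(3) d by (intro exI[of _ "(x,y)"]) (auto simp: I_def)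
    qed
    obtain C where C: "countable C" "C \<subseteq> K"
      "pairwise (\<lambda>i j. disjnt (I i) (I j)) C" "negligible (E c - (\<Union>i\<in>C. I i))"
    proof (rule Vitali_covering_theorem_cballs[of K "\<lambda>i. \<bar>snd i - fst i\<bar>/2" "E c" "\<lambda>i. (fst i + snd i)/2"])
      show "0 < \<bar>snd i - fst i\<bar> / 2" if "i \<in> K" for i
        using that by (auto simp: K_def)
    qed (use K_small in \<open>auto simp: I_def case_prod_unfold\<close>)
    \<comment> \<open>Henstock's lemma speaks of finite partial divisions, so finite subfamilies are
      bounded first and \<open>measure_UN_bound\<close> passes to the countable union.\<close>
    have bound: "measure lebesgue (\<Union>(I ` C')) \<le> e" if C': "C' \<subseteq> C" "finite C'" for C'
    proof -
      define p where "p = (\<lambda>i. (fst i, I i)) ` C'"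
      have inj: "inj_on (\<lambda>i. (fst i, I i)) C'"
      proof (rule inj_onI)
        fix i j assume ij: "i \<in> C'" "j \<in> C'" "(fst i, I i) = (fst j, I j)"
        show "i = j"
        proof (rule ccontr)
          assume "i \<noteq> j"
          then have "disjnt (I i) (I j)" using C(3) ij(1,2) C'(1) by (meson pairwiseD subsetD)
          moreover have "fst i \<in> I i" using I[of "fst i" "snd i"] by simp
          ultimately show False using ij(3) by (auto simp: disjnt_iff)
        qed
      qed
      have CK: "i \<in> K" if "i \<in> C'" for i using that C' C(2) by auto
      have tag: "p tagged_partial_division_of (cbox a b)"
        unfolding tagged_partial_division_of_def
      proof (intro conjI allI impI)
        show "finite p" using C' by (simp add: p_def)
      next
        fix x k assume "(x,k) \<in> p"
        then obtain y where y: "(x,y) \<in> C'" "k = I (x,y)" by (auto simp: p_def)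
        show "x \<in> k" using y(2) by (simp add: I)
        show "k \<subseteq> cbox a b" using CK[OF y(1)] by (auto simp: y(2) I K_def E_def)
        show "\<exists>a b. k = cbox a b" using y(2) by (auto simp: I)
      next
        fix x k x' k' assume "(x,k) \<in> p \<and> (x',k') \<in> p \<and> (x,k) \<noteq> (x',k')"
        then obtain i j where "i \<in> C'" "j \<in> C'" "k = I i" "k' = I j" "i \<noteq> j"
          by (auto simp: p_def)
        then have "disjnt k k'" using C(3) C'(1) by (metis pairwiseD subsetD)
        then show "interior k \<inter> interior k' = {}"
          using interior_subset unfolding disjnt_def by blast
      qed
      have fine: "\<gamma> fine p"
        unfolding fine_def
      proof (intro allI impI ballI, clarify)
        fix x k z assume "(x,k) \<in> p" "z \<in> k"
        then obtain y where "(x,y) \<in> C'" "k = I (x,y)" by (auto simp: p_def)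
        with CK[of "(x,y)"] \<open>z \<in> k\<close> show "z \<in> \<gamma> x" by (auto simp: K_def)
      qed
      have "c * measure lebesgue (\<Union>(I ` C')) \<le> c * (\<Sum>i\<in>C'. measure lebesgue (I i))"
        using \<open>c > 0\<close> C' by (intro mult_left_mono measure_UNION_le) (auto simp: I_def)
      also have "\<dots> = (\<Sum>i\<in>C'. c * \<bar>snd i - fst i\<bar>)"
        unfolding sum_distrib_left
        by (intro sum.cong refl) (auto simp: I split: abs_split)
      also have "\<dots> \<le> (\<Sum>i\<in>C'. norm (measure lborel (I i) *\<^sub>R f (fst i) - integral (I i) f))"
      proof (rule sum_mono)
        fix i assume "i \<in> C'"
        then have i: "(fst i, snd i) \<in> K" using CK by simp
        then have ab: "a < fst i" "fst i < b" "a < snd i" "snd i < b" and bad: "bad c (fst i) (snd i)"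
          by (auto simp: K_def E_def)
        have "norm (measure lborel (I i) *\<^sub>R f (fst i) - integral (I i) f)
            = \<bar>F (snd i) - F (fst i) - f (fst i) * (snd i - fst i)\<bar>"
        proof (cases "fst i \<le> snd i")
          case True
          then show ?thesis
            using I[of "fst i" "snd i"] ab F_diff[of "fst i" "snd i"]
            by (simp add: algebra_simps min_def max_def)
        next
          case False
          then show ?thesis
            using I[of "fst i" "snd i"] ab F_diff[of "snd i" "fst i"]
            by (simp add: algebra_simps min_def max_def)
        qed
        then show "c * \<bar>snd i - fst i\<bar> \<le> norm (measure lborel (I i) *\<^sub>R f (fst i) - integral (I i) f)"
          using bad by (simp add: bad_def)
      qed
      also have "\<dots> = (\<Sum>(x,k)\<in>p. norm (measure lborel k *\<^sub>R f x - integral k f))"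
        unfolding p_def by (subst sum.reindex[OF inj]) simp
      also have "\<dots> < c * e" by (rule \<gamma>(2)[OF tag fine])
      finally show ?thesis using \<open>c > 0\<close> by simp
    qed
    have U: "(\<Union>i\<in>C. I i) \<in> lmeasurable" "measure lebesgue (\<Union>i\<in>C. I i) \<le> e"
      by (rule fmeasurable_UN_bound measure_UN_bound, rule C(1), simp add: I_def case_prod_unfold, rule bound; simp)+
    have N: "E c - (\<Union>i\<in>C. I i) \<in> lmeasurable" "measure lebesgue (E c - (\<Union>i\<in>C. I i)) = 0"
      using C(4) negligible_imp_measurable negligible_imp_measure0 by auto
    show "\<exists>T. E c \<subseteq> T \<and> T \<in> lmeasurable \<and> measure lebesgue T \<le> e"
    proof (intro exI[of _ "(E c - (\<Union>i\<in>C. I i)) \<union> (\<Union>i\<in>C. I i)"] conjI)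
      show "measure lebesgue ((E c - (\<Union>i\<in>C. I i)) \<union> (\<Union>i\<in>C. I i)) \<le> e"
        using measure_Un_le[of "E c - (\<Union>i\<in>C. I i)" lebesgue "\<Union>i\<in>C. I i"] U N by auto
      show "(E c - (\<Union>i\<in>C. I i)) \<union> (\<Union>i\<in>C. I i) \<in> lmeasurable"
        using U(1) N(1) by (intro fmeasurable.Un)
    qed blast
  qed
  have sub: "{x \<in> {a<..<b}. \<not> (F has_real_derivative f x) (at x)} \<subseteq> (\<Union>n. E (1 / real (Suc n)))"
  proof
    fix x assume "x \<in> {x \<in> {a<..<b}. \<not> (F has_real_derivative f x) (at x)}"
    then have x: "a < x" "x < b" and nd: "\<not> (F has_real_derivative f x) (at x)" by auto
    from nd have "\<not> (F has_derivative (\<lambda>h. f x * h)) (at x)"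
      by (simp add: has_field_derivative_def)
    then obtain e where e: "e > 0" "\<And>d. d > 0 \<Longrightarrow> \<exists>y. \<bar>y - x\<bar> < d \<and> \<bar>F y - F x - f x * (y - x)\<bar> > e * \<bar>y - x\<bar>"
      unfolding has_derivative_at_alt by (auto simp: bounded_linear_mult_right not_le)
    obtain n where n: "1 / real (Suc n) < e" using e(1) nat_approx_posE by metis
    have "x \<in> E (1 / real (Suc n))"
      unfolding E_def mem_Collect_eq
    proof (intro conjI allI impI)
      show "x \<in> {a<..<b}" using x by simp
      fix d :: real assume "d > 0"
      \<comment> \<open>Shrinking \<open>d\<close> keeps the witness \<open>y\<close> inside the
        open interval, as membership in \<open>E\<close> demands.\<close>
      define d' where "d' = min d (min (x - a) (b - x))"
      have "d' > 0" using x \<open>d > 0\<close> by (simp add: d'_def)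
      then obtain y where y: "\<bar>y - x\<bar> < d'" "\<bar>F y - F x - f x * (y - x)\<bar> > e * \<bar>y - x\<bar>"
        using e(2) by blast
      have "1 / real (Suc n) * \<bar>y - x\<bar> \<le> e * \<bar>y - x\<bar>" using n by (intro mult_right_mono) auto
      then have "bad (1 / real (Suc n)) x y" using y by (simp add: bad_def)
      moreover have "y \<noteq> x" using y(2) by auto
      ultimately show "\<exists>y\<in>{a<..<b}. y \<noteq> x \<and> \<bar>y - x\<bar> < d \<and> bad (1 / real (Suc n)) x y"
        using y(1) by (intro bexI[of _ y]) (auto simp: d'_def)
    qed
    then show "x \<in> (\<Union>n. E (1 / real (Suc n)))" by blast
  qed
  have "negligible (\<Union>n. E (1 / real (Suc n)))"
    by (intro negligible_countable_Union countable_image) (auto intro: negl_E)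
  then show ?thesis
    using negligible_subset[OF _ sub] by (simp add: F_def)
qed

text \<open>The exceptional set is negligible for the completed measure;
  \<open>AE_completion_iff\<close> brings the statement back to \<open>lborel\<close>, where the
  Fubini arguments take place.\<close>

lemma AE_derivative_indefinite_integral:
  fixes G :: "real \<Rightarrow> real"
  assumes G: "set_integrable lborel {a..b} G"
  shows "AE x in lborel. x \<in> {a<..<b} \<longrightarrow>
    ((\<lambda>y. LINT s:{a..y}|lborel. G s) has_real_derivative G x) (at x)"
proof -
  have int: "G integrable_on {a..b}"
    using set_borel_integral_eq_integral(1)[OF G] .
  have eq: "(LINT s:{a..y}|lborel. G s) = integral {a..y} G" if "y < b" for y
    using that by (intro set_borel_integral_eq_integral(2) set_integrable_subset[OF G]) auto
  have "AE x in lebesgue. x \<notin> {x \<in> {a<..<b}. \<not> ((\<lambda>y. integral {a..y} G) has_real_derivative G x) (at x)}"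
    using negligible_not_differentiable_indefinite_integral[OF int]
    by (intro AE_not_in) (simp add: negligible_iff_null_sets)
  then have "AE x in lborel. x \<notin> {x \<in> {a<..<b}. \<not> ((\<lambda>y. integral {a..y} G) has_real_derivative G x) (at x)}"
    by (simp add: AE_completion_iff)
  then show ?thesis
  proof (eventually_elim, intro impI)
    fix x assume "x \<notin> {x \<in> {a<..<b}. \<not> ((\<lambda>y. integral {a..y} G) has_real_derivative G x) (at x)}"
      and x: "x \<in> {a<..<b}"
    then have "((\<lambda>y. integral {a..y} G) has_real_derivative G x) (at x)" by auto
    then show "((\<lambda>y. LINT s:{a..y}|lborel. G s) has_real_derivative G x) (at x)"
      by (rule has_field_derivative_transform_within_open[of _ _ _ "{a<..<b}"]) (use x eq in auto)
  qed
qed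

text \<open>Both functions are almost everywhere the derivative of one and the same primitive. This
  is how the Abel inversion, proved in integrated form, becomes a pointwise identity.\<close>

lemma AE_eq_if_indefinite_integrals_eq:
  fixes G1 G2 :: "real \<Rightarrow> real"
  assumes "set_integrable lborel {a..b} G1" "set_integrable lborel {a..b} G2"
    and eq: "\<And>y. a < y \<Longrightarrow> y < b \<Longrightarrow> (LINT s:{a..y}|lborel. G1 s) = (LINT s:{a..y}|lborel. G2 s)"
  shows "AE x in lborel. x \<in> {a<..<b} \<longrightarrow> G1 x = G2 x"
  using AE_derivative_indefinite_integral[OF assms(1)] AE_derivative_indefinite_integral[OF assms(2)]
proof (eventually_elim, intro impI)
  fix x
  assume x: "x \<in> {a<..<b}"
    and d: "x \<in> {a<..<b} \<longrightarrow> ((\<lambda>y. LINT s:{a..y}|lborel. G1 s) has_real_derivative G1 x) (at x)"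
           "x \<in> {a<..<b} \<longrightarrow> ((\<lambda>y. LINT s:{a..y}|lborel. G2 s) has_real_derivative G2 x) (at x)"
  have "((\<lambda>y. LINT s:{a..y}|lborel. G2 s) has_real_derivative G1 x) (at x)"
    by (rule has_field_derivative_transform_within_open[OF d(1)[rule_format, OF x], of "{a<..<b}"])
      (use x eq in auto)
  then show "G1 x = G2 x" using d(2) x DERIV_unique by blast
qed

section \<open>Fractional integrals and Marchaud derivatives\<close>

text \<open>A nonnegative gauge integrable function is absolutely integrable, so values found by the
  fundamental theorem of calculus become Lebesgue integrals, also for powers that are singular at an
  endpoint.\<close>

lemma has_bochner_integral_lborel_nonneg:
  fixes f :: "real \<Rightarrow> real"
  assumes [measurable]: "f \<in> borel_measurable borel" "A \<in> sets borel"
    and nonneg: "\<And>x. x \<in> A \<Longrightarrow> 0 \<le> f x" and I: "(f has_integral I) A"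
  shows "has_bochner_integral lborel (\<lambda>x. indicator A x * f x) I"
proof (rule has_bochner_integral_nn_integral)
  have "((\<lambda>x. if x \<in> A then f x else 0) has_integral I) UNIV"
    using I has_integral_restrict_UNIV by blast
  also have "(\<lambda>x. if x \<in> A then f x else 0) = (\<lambda>x. indicator A x * f x)"
    by (auto simp: indicator_def)
  finally have "((\<lambda>x. indicator A x * f x) has_integral I) UNIV" .
  then show "(\<integral>\<^sup>+x. ennreal (indicator A x * f x) \<partial>lborel) = ennreal I"
    by (intro nn_integral_has_integral_lborel) (auto simp: indicator_def nonneg)
  show "0 \<le> I" using I nonneg has_integral_nonneg by blast
  show "AE x in lborel. 0 \<le> indicator A x * f x" by (auto simp: indicator_def nonneg)
qed simp

lemma has_bochner_integral_powr:
  fixes a :: real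
  assumes "-1 < a" "s \<le> t"
  shows "has_bochner_integral lborel (\<lambda>x. indicator {s..t} x * (x - s) powr a) ((t - s) powr (a + 1) / (a + 1))"
proof -
  have "has_bochner_integral lborel (\<lambda>x. indicator {0..t-s} x * x powr a) ((t - s) powr (a + 1) / (a + 1))"
    using assms by (intro has_bochner_integral_lborel_nonneg has_integral_powr_from_0) auto
  then have "has_bochner_integral lborel (\<lambda>x. indicator {0..t-s} (-s + 1 * x) * (-s + 1 * x) powr a) ((t - s) powr (a + 1) / (a + 1))"
    by (subst (asm) lborel_has_bochner_integral_real_affine_iff[of 1 _ _ "-s"]) auto
  moreover have "indicator {0..t-s} (-s + 1 * x) = (indicator {s..t} x :: real)" for x
    by (auto simp: indicator_def)
  ultimately show ?thesis by (simp add: algebra_simps)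
qed

lemma has_bochner_integral_powr':
  fixes a :: real
  assumes "-1 < a" "s \<le> t"
  shows "has_bochner_integral lborel (\<lambda>x. indicator {s..t} x * (t - x) powr a) ((t - s) powr (a + 1) / (a + 1))"
proof -
  have "has_bochner_integral lborel (\<lambda>x. indicator {0..t-s} x * (x - 0) powr a) ((t - s - 0) powr (a + 1) / (a + 1))"
    using assms by (intro has_bochner_integral_powr) auto
  then have "has_bochner_integral lborel (\<lambda>x. indicator {0..t-s} (t + (-1) * x) * (t + (-1) * x) powr a) ((t - s) powr (a + 1) / (a + 1))"
    by (subst (asm) lborel_has_bochner_integral_real_affine_iff[of "-1" _ _ t]) auto
  moreover have "indicator {0..t-s} (t + (-1) * x) = (indicator {s..t} x :: real)" for x
    by (auto simp: indicator_def)
  ultimately show ?thesis by simp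
qed

lemma has_bochner_integral_powr_away_from_0:
  fixes b :: real
  assumes "0 < b" "0 < p" "p \<le> q"
  shows "has_bochner_integral lborel (\<lambda>x. indicator {p..q} x * x powr (-b - 1)) ((p powr (-b) - q powr (-b)) / b)"
proof (rule has_bochner_integral_lborel_nonneg)
  have "((\<lambda>x. x powr (-b-1)) has_integral (- (q powr (-b)) / b - (- (p powr (-b)) / b))) {p..q}"
  proof (rule fundamental_theorem_of_calculus)
    fix x assume "x \<in> {p..q}"
    then have "x > 0" using assms by auto
    then show "((\<lambda>x. - (x powr (-b)) / b) has_vector_derivative x powr (-b-1)) (at x within {p..q})"
      using assms unfolding has_real_derivative_iff_has_vector_derivative[symmetric]
      by (auto intro!: derivative_eq_intros)
  qed fact
  then show "((\<lambda>x. x powr (-b-1)) has_integral ((p powr (-b) - q powr (-b)) / b)) {p..q}"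
    by (simp add: diff_divide_distrib)
qed auto

text \<open>An affine substitution maps \<open>{s..t}\<close> onto the unit interval. For
  \<open>a + b = 1\<close> the value is independent of \<open>s\<close> and \<open>t\<close>, which
  is what allows the Abel inversion to pull out a constant.\<close>

lemma has_bochner_integral_Beta:
  fixes a b :: real
  assumes "0 < a" "0 < b" "s < t"
  shows "has_bochner_integral lborel (\<lambda>x. indicator {s..t} x * ((t - x) powr (a - 1) * (x - s) powr (b - 1)))
    ((t - s) powr (a + b - 1) * Beta a b)"
proof -
  have "((\<lambda>x. x powr (b - 1) * (1 - x) powr (a - 1)) has_integral Beta b a) {0..1}"
    using has_integral_Beta_real[of b a] assms by auto
  then have "has_bochner_integral lborel (\<lambda>x. indicator {0..1} x * (x powr (b - 1) * (1 - x) powr (a - 1))) (Beta b a)"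
    by (intro has_bochner_integral_lborel_nonneg) auto
  then have "has_bochner_integral lborel (\<lambda>x. indicator {0..1} (-s/(t-s) + 1/(t-s) * x) *
      ((-s/(t-s) + 1/(t-s) * x) powr (b - 1) * (1 - (-s/(t-s) + 1/(t-s) * x)) powr (a - 1))) (Beta b a / (1/(t-s)))"
    using assms
    by (subst (asm) lborel_has_bochner_integral_real_affine_iff[of "1/(t-s)" _ _ "-s/(t-s)"])
      (auto simp: divide_simps mult.commute)
  \<comment> \<open>The factor \<open>(t-s) powr (a+b-2)\<close> undoes the scaling of the two
    powers; the remaining factor \<open>t - s\<close> is the Jacobian.\<close>
  then have "has_bochner_integral lborel (\<lambda>x. (t-s) powr (a+b-2) * (indicator {0..1} (-s/(t-s) + 1/(t-s) * x) *
      ((-s/(t-s) + 1/(t-s) * x) powr (b - 1) * (1 - (-s/(t-s) + 1/(t-s) * x)) powr (a - 1))))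
       ((t-s) powr (a+b-2) * (Beta b a / (1/(t-s))))"
    by (rule has_bochner_integral_mult_right)
  moreover have "(t-s) powr (a+b-2) * (indicator {0..1} (-s/(t-s) + 1/(t-s) * x) *
      ((-s/(t-s) + 1/(t-s) * x) powr (b - 1) * (1 - (-s/(t-s) + 1/(t-s) * x)) powr (a - 1)))
      = indicator {s..t} x * ((t - x) powr (a - 1) * (x - s) powr (b - 1))" for x
  proof -
    have 0: "-s/(t-s) + 1/(t-s) * x = (x - s)/(t-s)"
      by (simp add: diff_divide_distrib)
    have 1: "-s/(t-s) + 1/(t-s) * x = (x - s)/(t-s)" "1 - (-s/(t-s) + 1/(t-s) * x) = (t - x)/(t-s)"
      unfolding 0 using assms by (auto simp: divide_simps)
    have 2: "(t-s) powr (a+b-2) = (t-s) powr (a-1) * (t-s) powr (b-1)"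
      by (simp flip: powr_add)
    have 3: "(x - s)/(t-s) \<in> {0..1} \<longleftrightarrow> x \<in> {s..t}" using assms by (auto simp: zero_le_divide_iff)
    show ?thesis
    proof (cases "x \<in> {s..t}")
      case True
      then show ?thesis unfolding 1(2) unfolding 1(1) 2 using assms 3 by (simp add: powr_divide)
    next
      case False
      then show ?thesis unfolding 1(2) unfolding 1(1) using 3 by (simp add: indicator_def)
    qed
  qed
  moreover have "(t-s) powr (a+b-2) * (Beta b a / (1/(t-s))) = (t - s) powr (a + b - 1) * Beta a b"
  proof -
    have "(t-s) powr (a+b-1) = (t-s) powr (a+b-2) * (t-s) powr 1"
      unfolding powr_add[symmetric] by (simp add: algebra_simps)
    then show ?thesis using assms by (simp add: Beta_commute mult_ac)
  qed
  ultimately show ?thesis by simp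
qed

lemma has_bochner_integral_lborel_isometry:
  fixes f :: "real \<Rightarrow> real"
  assumes "has_bochner_integral lborel f I" "\<bar>c\<bar> = 1"
  shows "has_bochner_integral lborel (\<lambda>x. f (t + c * x)) I"
  using assms lborel_has_bochner_integral_real_affine_iff[of c f I t] by auto

lemma lborel_pair_integrable:
  fixes f :: "real \<times> real \<Rightarrow> real"
  assumes [measurable]: "f \<in> borel_measurable borel"
    and fin: "(\<integral>\<^sup>+x. (\<integral>\<^sup>+y. ennreal \<bar>f (x,y)\<bar> \<partial>lborel) \<partial>lborel) < \<infinity>"
  shows "integrable (lborel \<Otimes>\<^sub>M lborel) f"
proof (rule integrableI_bounded)
  have [measurable]: "f \<in> borel_measurable (lborel \<Otimes>\<^sub>M lborel)"
    using assms(1) by (simp add: lborel_prod)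
  then show "f \<in> borel_measurable (lborel \<Otimes>\<^sub>M lborel)" .
  show "(\<integral>\<^sup>+z. ennreal (norm (f z)) \<partial>(lborel \<Otimes>\<^sub>M lborel)) < \<infinity>"
    using fin by (subst lborel.nn_integral_fst[symmetric]) auto
qed

text \<open>
  The kernel of the Marchaud derivative is cut off at \<open>t - s \<ge> e\<close>, where both terms of the
  difference are integrable separately; the boundary terms are \<open>O(e powr (1 - b))\<close>.
\<close>

lemma riemann_liouville_eq_integral_marchaud:
  fixes u :: "real \<Rightarrow> real"
  assumes [measurable]: "u \<in> borel_measurable borel" and L: "\<And>x. \<bar>u x\<bar> \<le> L"
    and b: "0 < b" "b < 1" and \<tau>: "0 < \<tau>"
    and fin: "(\<integral>\<^sup>+t\<in>{0..\<tau>}. (\<integral>\<^sup>+s\<in>{0..t}. ennreal (\<bar>u t - u s\<bar> / (t - s) powr (b + 1)) \<partial>lborel) \<partial>lborel) < \<infinity>"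
  defines "G \<equiv> \<lambda>t. u t * t powr (-b) + b * (LINT s:{0..t}|lborel. (u t - u s) / (t - s) powr (b + 1))"
  shows "set_integrable lborel {0..\<tau>} G"
    and "(LINT s:{0..\<tau>}|lborel. u s * (\<tau> - s) powr (-b)) = (LINT x:{0..\<tau>}|lborel. G x)"
proof -
  \<comment> \<open>\<open>G\<close> is \<open>Gamma (1 - b)\<close> times the Marchaud derivative
    of \<open>u\<close> of order \<open>b\<close>; the Gamma factors are restored only when the
    integrand is identified.\<close>
  define \<Delta> where "\<Delta> = {(t,s). 0 \<le> s \<and> s \<le> t \<and> t \<le> \<tau>}"
  have [measurable]: "\<Delta> \<in> sets borel" unfolding \<Delta>_def
    by (intro borel_closed closed_Collect_conj closed_Collect_le continuous_intros) (auto simp: case_prod_unfold intro!: closed_Collect_conj closed_Collect_le continuous_intros)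
  define D where "D = (\<lambda>(t,s). indicator \<Delta> (t,s) * ((u t - u s) / (t - s) powr (b + 1)))"
  have [measurable]: "D \<in> borel_measurable borel"
    unfolding D_def by (simp flip: borel_prod)
  have intD: "integrable (lborel \<Otimes>\<^sub>M lborel) D"
  proof (rule lborel_pair_integrable)
    have "(\<integral>\<^sup>+t. (\<integral>\<^sup>+s. ennreal \<bar>D (t,s)\<bar> \<partial>lborel) \<partial>lborel)
      = (\<integral>\<^sup>+t\<in>{0..\<tau>}. (\<integral>\<^sup>+s\<in>{0..t}. ennreal (\<bar>u t - u s\<bar> / (t - s) powr (b + 1)) \<partial>lborel) \<partial>lborel)"
    proof (rule nn_integral_cong)
      fix t :: real
      have "(\<integral>\<^sup>+s. ennreal \<bar>D (t,s)\<bar> \<partial>lborel)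
         = (\<integral>\<^sup>+s. (ennreal (\<bar>u t - u s\<bar> / (t - s) powr (b + 1)) * indicator {0..t} s) * indicator {0..\<tau>} t \<partial>lborel)"
        by (intro nn_integral_cong) (auto simp: D_def \<Delta>_def indicator_def abs_mult)
      also have "\<dots> = (\<integral>\<^sup>+s\<in>{0..t}. ennreal (\<bar>u t - u s\<bar> / (t - s) powr (b + 1)) \<partial>lborel) * indicator {0..\<tau>} t"
        by (rule nn_integral_multc) auto
      finally show "(\<integral>\<^sup>+s. ennreal \<bar>D (t,s)\<bar> \<partial>lborel) = \<dots>" .
    qed
    then show "(\<integral>\<^sup>+t. (\<integral>\<^sup>+s. ennreal \<bar>D (t,s)\<bar> \<partial>lborel) \<partial>lborel) < \<infinity>" using fin by simp
  qed simp
  have innerD: "(LINT s|lborel. D (t,s)) = indicator {0..\<tau>} t * (LINT s:{0..t}|lborel. (u t - u s) / (t - s) powr (b + 1))" for t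
    unfolding set_lebesgue_integral_def Bochner_Integration.integral_mult_right_zero[symmetric]
    by (intro Bochner_Integration.integral_cong refl) (auto simp: D_def \<Delta>_def indicator_def)
  have int1: "integrable lborel (\<lambda>t. indicator {0..\<tau>} t * (LINT s:{0..t}|lborel. (u t - u s) / (t - s) powr (b + 1)))"
    using lborel_pair.integrable_fst'[OF intD] by (simp add: innerD)
  have int1_eq: "(LINT t|lborel. indicator {0..\<tau>} t * (LINT s:{0..t}|lborel. (u t - u s) / (t - s) powr (b + 1))) = integral\<^sup>L (lborel \<Otimes>\<^sub>M lborel) D"
    using lborel_pair.integral_fst'[OF intD] by (simp add: innerD)
  have L0: "0 \<le> L" using L[of 0] by linarith
  have int_mult_u: "integrable lborel (\<lambda>x. u x * f x)" if f: "integrable lborel f" for f :: "real \<Rightarrow> real"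
  proof (rule Bochner_Integration.integrable_bound[of _ "\<lambda>x. L * f x"])
    show "AE x in lborel. norm (u x * f x) \<le> norm (L * f x)"
      using L0 L by (auto simp: abs_mult intro!: mult_right_mono)
    show "(\<lambda>x. u x * f x) \<in> borel_measurable lborel"
      using borel_measurable_integrable[OF f] by simp
  qed (use f in simp)
  have intP: "integrable lborel (\<lambda>x. u x * (indicator {0..t} x * (x - 0) powr (-b)))"
    and intQ: "integrable lborel (\<lambda>x. u x * (indicator {t..\<tau>} x * (\<tau> - x) powr (-b)))"
    if "0 \<le> t" "t \<le> \<tau>" for t
    using b that has_bochner_integral_powr[of "-b" 0 t] has_bochner_integral_powr'[of "-b" t \<tau>]
    by (auto intro!: int_mult_u simp: has_bochner_integral_iff)
  define P where "P = (LINT x|lborel. u x * (indicator {0..\<tau>} x * (x - 0) powr (-b)))"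
  define Q where "Q = (LINT x|lborel. u x * (indicator {0..\<tau>} x * (\<tau> - x) powr (-b)))"
  have Q_eq: "(LINT s:{0..\<tau>}|lborel. u s * (\<tau> - s) powr (-b)) = Q"
    unfolding set_lebesgue_integral_def Q_def
    by (intro Bochner_Integration.integral_cong refl) auto
  define De where "De e = (\<lambda>z. D z * indicator {(t,s). s + e \<le> t} z)" for e
  have [measurable]: "{(t::real,s). s + e \<le> t} \<in> sets borel" for e
    by (auto simp: case_prod_unfold intro!: borel_closed closed_Collect_le continuous_intros)
  \<comment> \<open>After integrating out one variable, the two terms of the truncated kernel carry
    \<open>e powr (-b) - t powr (-b)\<close> on \<open>{e..\<tau>}\<close> and
    \<open>e powr (-b) - (\<tau> - s) powr (-b)\<close> on \<open>{0..\<tau>-e}\<close>. Adding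
    \<open>P - Q\<close> cancels everything except strips of length \<open>e\<close> at the two
    ends. The first error term comes from the constant \<open>e powr (-b)\<close> there, the second
    from the two singular powers.\<close>
  have bound: "\<bar>b * integral\<^sup>L (lborel \<Otimes>\<^sub>M lborel) (De e) + P - Q\<bar> \<le> 2 * L * e powr (1 - b) + 2 * L * (e powr (1 - b) / (1 - b))"
    if e: "0 < e" "e \<le> \<tau>" for e
  proof -
    define \<Delta>' where "\<Delta>' = {(t,s). 0 \<le> s \<and> s + e \<le> t \<and> t \<le> \<tau>}"
    have [measurable]: "\<Delta>' \<in> sets borel" unfolding \<Delta>'_def
      by (auto simp: case_prod_unfold intro!: borel_closed closed_Collect_conj closed_Collect_le continuous_intros)
    have De: "De e = (\<lambda>(t,s). indicator \<Delta>' (t,s) * (u t * (t - s) powr (-b-1)) - indicator \<Delta>' (t,s) * (u s * (t - s) powr (-b-1)))"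
      using e by (auto simp: fun_eq_iff De_def D_def \<Delta>_def \<Delta>'_def indicator_def left_diff_distrib powr_minus_divide[symmetric] divide_powr_uminus)
    have int_tri: "integrable (lborel \<Otimes>\<^sub>M lborel) (\<lambda>(t,s). indicator \<Delta>' (t,s) * (v t s * (t - s) powr (-b-1)))"
      if [measurable]: "case_prod v \<in> borel_measurable (borel \<Otimes>\<^sub>M borel)" and v: "\<And>t s. \<bar>v t s\<bar> \<le> L" for v
    proof (rule integrableI_bounded_set[where A="{0..\<tau>} \<times> {0..\<tau>}" and B="L * e powr (-b-1)"])
      show "{0..\<tau>} \<times> {0..\<tau>} \<in> sets (lborel \<Otimes>\<^sub>M lborel)" by simp
      show "(\<lambda>(t,s). indicator \<Delta>' (t,s) * (v t s * (t - s) powr (-b-1))) \<in> borel_measurable (lborel \<Otimes>\<^sub>M lborel)"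
      proof -
        have "\<Delta>' \<in> sets (borel \<Otimes>\<^sub>M borel)" unfolding borel_prod by measurable
        then have "(\<lambda>(t,s). indicator \<Delta>' (t,s) * (v t s * (t - s) powr (-b-1))) \<in> borel_measurable (borel \<Otimes>\<^sub>M borel)"
          using that(1) by measurable
        then show ?thesis by (simp add: lborel_prod borel_prod)
      qed
      show "emeasure (lborel \<Otimes>\<^sub>M lborel) ({0..\<tau>} \<times> {0..\<tau>}) < \<infinity>"
        by (subst lborel.emeasure_pair_measure_Times) (use \<tau> in \<open>auto simp: ennreal_mult_less_top\<close>)
      have "\<bar>v t s\<bar> * (t - s) powr (-b-1) \<le> L * e powr (-b-1)" if "(t,s) \<in> \<Delta>'" for t s
        using that b e v by (intro mult_mono powr_mono2') (auto simp: \<Delta>'_def L0)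
      then show "AE x in lborel \<Otimes>\<^sub>M lborel. x \<in> {0..\<tau>} \<times> {0..\<tau>} \<longrightarrow> norm (case x of (t, s) \<Rightarrow> indicator \<Delta>' (t,s) * (v t s * (t - s) powr (-b-1))) \<le> L * e powr (-b-1)"
        using L0 by (auto simp: indicator_def abs_mult)
      show "AE x in lborel \<Otimes>\<^sub>M lborel. x \<notin> {0..\<tau>} \<times> {0..\<tau>} \<longrightarrow> (case x of (t, s) \<Rightarrow> indicator \<Delta>' (t,s) * (v t s * (t - s) powr (-b-1))) = 0"
        using e by (auto simp: \<Delta>'_def indicator_def)
    qed
    have inta: "integrable (lborel \<Otimes>\<^sub>M lborel) (\<lambda>(t,s). indicator \<Delta>' (t,s) * (u t * (t - s) powr (-b-1)))"
      by (rule int_tri) (auto simp: L)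
    have intb: "integrable (lborel \<Otimes>\<^sub>M lborel) (\<lambda>(t,s). indicator \<Delta>' (t,s) * (u s * (t - s) powr (-b-1)))"
      by (rule int_tri) (auto simp: L)
    have ina: "(LINT s|lborel. indicator \<Delta>' (t,s) * (u t * (t - s) powr (-b-1)))
       = indicator {e..\<tau>} t * (u t * ((e powr (-b) - t powr (-b)) / b))" for t
    proof (cases "t \<in> {e..\<tau>}")
      case True
      have "has_bochner_integral lborel (\<lambda>x. indicator {e..t} (t + (-1) * x) * (t + (-1) * x) powr (-b-1)) ((e powr (-b) - t powr (-b)) / b)"
        by (rule has_bochner_integral_lborel_isometry[OF has_bochner_integral_powr_away_from_0])
          (use b e True in auto)
      then have I: "(LINT x|lborel. u t * (indicator {e..t} (t + (-1) * x) * (t + (-1) * x) powr (-b-1))) = u t * ((e powr (-b) - t powr (-b)) / b)"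
        by (simp add: has_bochner_integral_iff)
      have eq: "u t * (indicator {e..t} (t + (-1) * s) * (t + (-1) * s) powr (-b-1)) = indicator \<Delta>' (t,s) * (u t * (t - s) powr (-b-1))" for s
        using True e by (auto simp: indicator_def \<Delta>'_def)
      from I[unfolded eq] True show ?thesis by simp
    next
      case False
      then have "indicator \<Delta>' (t,s) = (0::real)" for s using e by (auto simp: \<Delta>'_def indicator_def)
      then show ?thesis using False by simp
    qed
    have inb: "(LINT t|lborel. indicator \<Delta>' (t,s) * (u s * (t - s) powr (-b-1)))
       = indicator {0..\<tau>-e} s * (u s * ((e powr (-b) - (\<tau> - s) powr (-b)) / b))" for s
    proof (cases "s \<in> {0..\<tau>-e}")
      case True
      have "has_bochner_integral lborel (\<lambda>x. indicator {e..\<tau>-s} (-s + 1 * x) * (-s + 1 * x) powr (-b-1)) ((e powr (-b) - (\<tau>-s) powr (-b)) / b)"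
        by (rule has_bochner_integral_lborel_isometry[OF has_bochner_integral_powr_away_from_0])
          (use b e True in auto)
      then have I: "(LINT x|lborel. u s * (indicator {e..\<tau>-s} (-s + 1 * x) * (-s + 1 * x) powr (-b-1))) = u s * ((e powr (-b) - (\<tau>-s) powr (-b)) / b)"
        by (simp add: has_bochner_integral_iff)
      have eq: "u s * (indicator {e..\<tau>-s} (-s + 1 * t) * (-s + 1 * t) powr (-b-1)) = indicator \<Delta>' (t,s) * (u s * (t - s) powr (-b-1))" for t
        using True e by (auto simp: indicator_def \<Delta>'_def)
      from I[unfolded eq] True show ?thesis by simp
    next
      case False
      then have "indicator \<Delta>' (t,s) = (0::real)" for t using e by (auto simp: \<Delta>'_def indicator_def)
      then show ?thesis using False by simp
    qed
    have A: "integral\<^sup>L (lborel \<Otimes>\<^sub>M lborel) (De e)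
        = (LINT t|lborel. indicator {e..\<tau>} t * (u t * ((e powr (-b) - t powr (-b)) / b)))
        - (LINT s|lborel. indicator {0..\<tau>-e} s * (u s * ((e powr (-b) - (\<tau> - s) powr (-b)) / b)))"
    proof -
      have "integral\<^sup>L (lborel \<Otimes>\<^sub>M lborel) (De e) =
         integral\<^sup>L (lborel \<Otimes>\<^sub>M lborel) (\<lambda>(t,s). indicator \<Delta>' (t,s) * (u t * (t - s) powr (-b-1)))
         - integral\<^sup>L (lborel \<Otimes>\<^sub>M lborel) (\<lambda>(t,s). indicator \<Delta>' (t,s) * (u s * (t - s) powr (-b-1)))"
        unfolding De using Bochner_Integration.integral_diff[OF inta intb] by (simp add: case_prod_unfold)
      then show ?thesis
        using lborel_pair.integral_fst[OF inta] lborel_pair.integral_snd[OF intb] by (simp add: ina inb)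
    qed
    have int_a': "integrable lborel (\<lambda>t. indicator {e..\<tau>} t * (u t * ((e powr (-b) - t powr (-b)) / b)))"
      using lborel_pair.integrable_fst[OF inta] by (simp add: ina)
    have int_b': "integrable lborel (\<lambda>s. indicator {0..\<tau>-e} s * (u s * ((e powr (-b) - (\<tau> - s) powr (-b)) / b)))"
      using lborel_pair.integrable_snd[OF intb] by (simp add: inb)
    \<comment> \<open>The four one-dimensional integrals are merged into one so that the
      cancellation can be carried out pointwise; \<open>?k\<close> is what survives on the end
      strips.\<close>
    let ?h = "\<lambda>x. b * (indicator {e..\<tau>} x * (u x * ((e powr (-b) - x powr (-b)) / b)))
       - b * (indicator {0..\<tau>-e} x * (u x * ((e powr (-b) - (\<tau> - x) powr (-b)) / b)))
       + u x * (indicator {0..\<tau>} x * (x - 0) powr (-b)) - u x * (indicator {0..\<tau>} x * (\<tau> - x) powr (-b))"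
    have int_h: "integrable lborel ?h"
      using int_a' int_b' intP[of \<tau>] intQ[of 0] \<tau>
      by (intro Bochner_Integration.integrable_diff Bochner_Integration.integrable_add integrable_mult_right) auto
    have h: "integral\<^sup>L lborel ?h = b * integral\<^sup>L (lborel \<Otimes>\<^sub>M lborel) (De e) + P - Q"
    proof -
      have "integral\<^sup>L lborel (\<lambda>x. b * f1 x - b * f2 x + f3 x - f4 x)
          = b * (integral\<^sup>L lborel f1 - integral\<^sup>L lborel f2) + integral\<^sup>L lborel f3 - integral\<^sup>L lborel f4"
        if "integrable lborel f1" "integrable lborel f2" "integrable lborel f3" "integrable lborel f4"
        for f1 f2 f3 f4 :: "real \<Rightarrow> real"
        using that by (simp add: right_diff_distrib)
      from this[OF int_a' int_b' intP[of \<tau>] intQ[of 0]] show ?thesis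
        unfolding A P_def Q_def using \<tau> by simp
    qed
    let ?k = "\<lambda>x. L * e powr (-b) * indicator {0..e} x + L * e powr (-b) * indicator {\<tau>-e..\<tau>} x
       + L * (indicator {0..e} x * (x - 0) powr (-b)) + L * (indicator {\<tau>-e..\<tau>} x * (\<tau> - x) powr (-b))"
    have k1: "has_bochner_integral lborel (\<lambda>x. indicator {0..e} x * (x - 0) powr (-b)) (e powr (1-b)/(1-b))"
      using has_bochner_integral_powr[of "-b" 0 e] b e by simp
    have k2: "has_bochner_integral lborel (\<lambda>x. indicator {\<tau>-e..\<tau>} x * (\<tau> - x) powr (-b)) (e powr (1-b)/(1-b))"
      using has_bochner_integral_powr'[of "-b" "\<tau>-e" \<tau>] b e by simp
    have k3: "has_bochner_integral lborel (indicator {0..e} :: real \<Rightarrow> real) e" "has_bochner_integral lborel (indicator {\<tau>-e..\<tau>} :: real \<Rightarrow> real) e"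
      using e by (auto simp: has_bochner_integral_iff)
    have int_k: "has_bochner_integral lborel ?k (L * e powr (-b) * e + L * e powr (-b) * e + L * (e powr (1-b)/(1-b)) + L * (e powr (1-b)/(1-b)))"
      by (intro has_bochner_integral_add has_bochner_integral_mult_right k1 k2 k3)
    have hk: "\<bar>?h x\<bar> \<le> ?k x" for x
    proof -
      have n: "0 \<le> L * x powr (-b)" "0 \<le> L * (\<tau> - x) powr (-b)" "0 \<le> L * e powr (-b)"
        using L0 by auto
      have m: "\<bar>u x * y\<bar> \<le> L * y" if "y \<ge> 0" for y
        using mult_right_mono[OF L[of x] that] that by (simp add: abs_mult)
      note m1 = m[of "x powr (-b)"] m[of "(\<tau>-x) powr (-b)"] m[of "e powr (-b)"]
      define p1 p2 p3 q1 q2 q3 where "p1 = u x * x powr (-b)" and "p2 = u x * (\<tau>-x) powr (-b)" and "p3 = u x * e powr (-b)"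
        and "q1 = L * x powr (-b)" and "q2 = L * (\<tau>-x) powr (-b)" and "q3 = L * e powr (-b)"
      note pq = p1_def p2_def p3_def q1_def q2_def q3_def
      have h': "?h x = p3 * (indicator {e..\<tau>} x - indicator {0..\<tau>-e} x)
        + p1 * (indicator {0..\<tau>} x - indicator {e..\<tau>} x) - p2 * (indicator {0..\<tau>} x - indicator {0..\<tau>-e} x)"
      proof -
        have c: "b * (i * (v * (y / b))) = i * (v * y)" for i v y :: real using b by simp
        show ?thesis unfolding c pq by (simp add: algebra_simps)
      qed
      have k': "?k x = q3 * indicator {0..e} x + q3 * indicator {\<tau>-e..\<tau>} x + q1 * indicator {0..e} x + q2 * indicator {\<tau>-e..\<tau>} x"
        unfolding pq by simp
      show ?thesis
        using n m1 e unfolding h' k' unfolding pq[symmetric]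
        by (auto simp: indicator_def abs_le_iff split: if_splits)
    qed
    have "\<bar>integral\<^sup>L lborel ?h\<bar> \<le> integral\<^sup>L lborel ?k"
      using Bochner_Integration.integral_norm_bound_integral[OF int_h integrable.intros[OF int_k]] hk by (simp only: real_norm_def)
    also have "\<dots> = L * e powr (-b) * e + L * e powr (-b) * e + L * (e powr (1-b)/(1-b)) + L * (e powr (1-b)/(1-b))"
      using int_k by (rule has_bochner_integral_integral_eq)
    also have "e powr (1 - b) = e powr (-b) * e powr 1" unfolding powr_add[symmetric] by (simp add: algebra_simps)
    then have "L * e powr (-b) * e + L * e powr (-b) * e + L * (e powr (1-b)/(1-b)) + L * (e powr (1-b)/(1-b)) = 2 * L * e powr (1 - b) + 2 * L * (e powr (1 - b) / (1 - b))"
      using e by simp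
    finally show ?thesis unfolding h .
  qed
  define en where "en n = \<tau> / real (Suc n)" for n
  have en: "0 < en n" "en n \<le> \<tau>" for n using \<tau> by (auto simp: en_def field_simps)
  have en0: "en \<longlonglongrightarrow> 0"
    unfolding en_def by (rule LIMSEQ_Suc[OF tendsto_divide_0[OF tendsto_const]]) (simp add: filterlim_real_sequentially filterlim_at_top_imp_at_infinity)
  have "(\<lambda>n. 2 * L * en n powr (1 - b) + 2 * L * (en n powr (1 - b) / (1 - b))) \<longlonglongrightarrow> 2 * L * 0 + 2 * L * (0 / (1-b))"
  proof -
    have "(\<lambda>n. en n powr (1 - b)) \<longlonglongrightarrow> 0 powr (1 - b)"
      using en0 b by (intro tendsto_powr2 tendsto_const) (auto intro!: always_eventually less_imp_le en)
    then have "(\<lambda>n. en n powr (1 - b)) \<longlonglongrightarrow> 0" by simp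
    then show ?thesis using b by (intro tendsto_intros) auto
  qed
  then have "(\<lambda>n. 2 * L * en n powr (1 - b) + 2 * L * (en n powr (1 - b) / (1 - b))) \<longlonglongrightarrow> 0" by simp
  then have "(\<lambda>n. b * integral\<^sup>L (lborel \<Otimes>\<^sub>M lborel) (De (en n)) + P - Q) \<longlonglongrightarrow> 0"
    by (rule Lim_null_comparison[rotated]) (use bound en in \<open>auto intro!: always_eventually\<close>)
  moreover have "(\<lambda>n. b * integral\<^sup>L (lborel \<Otimes>\<^sub>M lborel) (De (en n)) + P - Q) \<longlonglongrightarrow> b * integral\<^sup>L (lborel \<Otimes>\<^sub>M lborel) D + P - Q"
  proof (intro tendsto_intros integral_dominated_convergence[where w="\<lambda>z. \<bar>D z\<bar>"])
    show "D \<in> borel_measurable (lborel \<Otimes>\<^sub>M lborel)" by (simp add: lborel_prod)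
    show "De (en i) \<in> borel_measurable (lborel \<Otimes>\<^sub>M lborel)" for i by (simp add: lborel_prod De_def)
    show "integrable (lborel \<Otimes>\<^sub>M lborel) (\<lambda>z. \<bar>D z\<bar>)" using intD by simp
    show "AE z in lborel \<Otimes>\<^sub>M lborel. norm (De (en i) z) \<le> \<bar>D z\<bar>" for i
      by (auto simp: De_def abs_mult indicator_def)
    show "AE z in lborel \<Otimes>\<^sub>M lborel. (\<lambda>i. De (en i) z) \<longlonglongrightarrow> D z"
    proof (rule AE_I2, clarify)
      fix t s :: real
      show "(\<lambda>i. De (en i) (t,s)) \<longlonglongrightarrow> D (t,s)"
      proof (cases "s < t")
        case True
        then have "eventually (\<lambda>i. en i < t - s) sequentially"
          using order_tendstoD(2)[OF en0, of "t - s"] by simp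
        then have "eventually (\<lambda>i. De (en i) (t,s) = D (t,s)) sequentially"
          by eventually_elim (auto simp: De_def indicator_def)
        then show ?thesis by (rule tendsto_eventually)
      next
        case False
        \<comment> \<open>On the diagonal the quotient is \<open>0 / 0 = 0\<close>, so it agrees
          with its truncations.\<close>
        then have "D (t,s) = 0" by (auto simp: D_def \<Delta>_def indicator_def)
        then show ?thesis by (simp add: De_def)
      qed
    qed
  qed
  ultimately have key: "b * integral\<^sup>L (lborel \<Otimes>\<^sub>M lborel) D + P - Q = 0"
    using LIMSEQ_unique by blast
  have G: "indicator {0..\<tau>} x *\<^sub>R G x = u x * (indicator {0..\<tau>} x * (x - 0) powr (-b))
     + b * (indicator {0..\<tau>} x * (LINT s:{0..x}|lborel. (u x - u s) / (x - s) powr (b + 1)))" for x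
    by (simp add: G_def algebra_simps)
  show "set_integrable lborel {0..\<tau>} G"
    unfolding set_integrable_def G
    using intP[of \<tau>] \<tau> int1 by (intro Bochner_Integration.integrable_add integrable_mult_right) auto
  show "(LINT s:{0..\<tau>}|lborel. u s * (\<tau> - s) powr (-b)) = (LINT x:{0..\<tau>}|lborel. G x)"
  proof -
    have "(LINT x:{0..\<tau>}|lborel. G x) = P + b * integral\<^sup>L (lborel \<Otimes>\<^sub>M lborel) D"
      unfolding set_lebesgue_integral_def[of _ _ G] G P_def int1_eq[symmetric] Bochner_Integration.integral_mult_right[OF int1, symmetric]
      by (rule Bochner_Integration.integral_add) (use intP[of \<tau>] \<tau> int1 in auto)
    then show ?thesis using Q_eq key by simp
  qed
qed

text \<open>Integrability on the triangle comes from a bound on the mass of the kernel over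
  \<open>{x..t}\<close> that is uniform in \<open>x\<close>, multiplied by the L1 norm of
  \<open>A\<close>. Singular kernels such as \<open>(y - x) powr (b - 1)\<close> are thereby covered
  without any bound on \<open>A\<close>.\<close>

lemma triangle_Fubini:
  fixes A :: "real \<Rightarrow> real" and \<kappa> :: "real \<Rightarrow> real \<Rightarrow> real"
  assumes A: "integrable lborel A"
    and [measurable]: "case_prod \<kappa> \<in> borel_measurable (borel \<Otimes>\<^sub>M borel)"
    and C: "\<And>x. 0 \<le> x \<Longrightarrow> x \<le> t \<Longrightarrow> (\<integral>\<^sup>+y. ennreal (indicator {x..t} y * \<bar>\<kappa> x y\<bar>) \<partial>lborel) \<le> ennreal C"
  shows "(LINT x|lborel. indicator {0..t} x * (A x * (LINT y|lborel. indicator {x..t} y * \<kappa> x y)))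
       = (LINT y|lborel. indicator {0..t} y * (LINT x|lborel. indicator {0..y} x * (A x * \<kappa> x y)))"
    and "integrable lborel (\<lambda>y. indicator {0..t} y * (LINT x|lborel. indicator {0..y} x * (A x * \<kappa> x y)))"
    and "integrable lborel (\<lambda>x. indicator {0..t} x * (A x * (LINT y|lborel. indicator {x..t} y * \<kappa> x y)))"
proof -
  have [measurable]: "A \<in> borel_measurable borel"
    using borel_measurable_integrable[OF A] by simp
  define \<Delta> where "\<Delta> = {(x::real,y). 0 \<le> x \<and> x \<le> y \<and> y \<le> t}"
  define f where "f x y = indicator \<Delta> (x,y) * (A x * \<kappa> x y)" for x y
  have "closed \<Delta>"
    by (auto simp: \<Delta>_def case_prod_unfold intro!: closed_Collect_conj closed_Collect_le continuous_intros)
  then have "\<Delta> \<in> sets borel" by simp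
  then have [measurable]: "\<Delta> \<in> sets (borel \<Otimes>\<^sub>M borel)" unfolding borel_prod .
  have "case_prod f \<in> borel_measurable (borel \<Otimes>\<^sub>M borel)"
    unfolding f_def by measurable
  then have meas: "case_prod f \<in> borel_measurable borel" unfolding borel_prod .
  have int: "integrable (lborel \<Otimes>\<^sub>M lborel) (case_prod f)"
  proof (rule lborel_pair_integrable[OF meas])
    have "(\<integral>\<^sup>+x. (\<integral>\<^sup>+y. ennreal \<bar>case_prod f (x,y)\<bar> \<partial>lborel) \<partial>lborel) \<le> (\<integral>\<^sup>+x. ennreal \<bar>A x\<bar> * ennreal C \<partial>lborel)"
    proof (rule nn_integral_mono)
      fix x
      show "(\<integral>\<^sup>+y. ennreal \<bar>case_prod f (x,y)\<bar> \<partial>lborel) \<le> ennreal \<bar>A x\<bar> * ennreal C"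
      proof (cases "0 \<le> x \<and> x \<le> t")
        case True
        have "(\<integral>\<^sup>+y. ennreal \<bar>case_prod f (x,y)\<bar> \<partial>lborel) = (\<integral>\<^sup>+y. ennreal \<bar>A x\<bar> * ennreal (indicator {x..t} y * \<bar>\<kappa> x y\<bar>) \<partial>lborel)"
          using True by (intro nn_integral_cong)
            (auto simp: f_def \<Delta>_def indicator_def abs_mult ennreal_mult)
        also have "\<dots> = ennreal \<bar>A x\<bar> * (\<integral>\<^sup>+y. ennreal (indicator {x..t} y * \<bar>\<kappa> x y\<bar>) \<partial>lborel)"
          by (rule nn_integral_cmult) simp
        also have "\<dots> \<le> ennreal \<bar>A x\<bar> * ennreal C"
          using C True by (intro mult_left_mono) auto
        finally show ?thesis .
      next
        case False
        then have "f x y = 0" for y by (auto simp: f_def \<Delta>_def indicator_def)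
        then show ?thesis by simp
      qed
    qed
    also have "\<dots> = (\<integral>\<^sup>+x. ennreal \<bar>A x\<bar> \<partial>lborel) * ennreal C"
      by (rule nn_integral_multc) simp
    also have "\<dots> < \<infinity>"
      using A by (auto simp: integrable_iff_bounded ennreal_mult_less_top)
    finally show "(\<integral>\<^sup>+x. (\<integral>\<^sup>+y. ennreal \<bar>case_prod f (x,y)\<bar> \<partial>lborel) \<partial>lborel) < \<infinity>" .
  qed
  have 1: "(LINT y|lborel. f x y) = indicator {0..t} x * (A x * (LINT y|lborel. indicator {x..t} y * \<kappa> x y))" for x
    unfolding Bochner_Integration.integral_mult_right_zero[symmetric]
    by (intro Bochner_Integration.integral_cong refl) (auto simp: f_def \<Delta>_def indicator_def)
  have 2: "(LINT x|lborel. f x y) = indicator {0..t} y * (LINT x|lborel. indicator {0..y} x * (A x * \<kappa> x y))" for y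
    unfolding Bochner_Integration.integral_mult_right_zero[symmetric]
    by (intro Bochner_Integration.integral_cong refl) (auto simp: f_def \<Delta>_def indicator_def)
  show "(LINT x|lborel. indicator {0..t} x * (A x * (LINT y|lborel. indicator {x..t} y * \<kappa> x y)))
       = (LINT y|lborel. indicator {0..t} y * (LINT x|lborel. indicator {0..y} x * (A x * \<kappa> x y)))"
    using lborel_pair.Fubini_integral[OF int] by (simp add: 1 2)
  show "integrable lborel (\<lambda>y. indicator {0..t} y * (LINT x|lborel. indicator {0..y} x * (A x * \<kappa> x y)))"
    using lborel_pair.integrable_snd[OF int] by (simp add: 2)
  show "integrable lborel (\<lambda>x. indicator {0..t} x * (A x * (LINT y|lborel. indicator {x..t} y * \<kappa> x y)))"
    using lborel_pair.integrable_fst[OF int] by (simp add: 1)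
qed

lemma nn_integral_eq_has_bochner:
  fixes f :: "real \<Rightarrow> real"
  assumes "has_bochner_integral lborel f I" "\<And>x. 0 \<le> f x"
  shows "(\<integral>\<^sup>+x. ennreal (f x) \<partial>lborel) = ennreal I"
  using assms nn_integral_eq_integral[of lborel f] by (simp add: has_bochner_integral_iff)

text \<open>\<open>G\<close> is the density of the fractional integral of \<open>u\<close>, and the
  opposite kernel recovers \<open>u\<close>. The two sides are compared after integration over
  \<open>{0..t}\<close>, where Fubini applies and the product of the two kernels integrates to
  \<open>Beta b (1 - b)\<close>; differentiation in \<open>t\<close> then gives the pointwise
  claim.\<close>

lemma abel_inversion:
  fixes u G :: "real \<Rightarrow> real"
  assumes [measurable]: "u \<in> borel_measurable borel" and L: "\<And>x. \<bar>u x\<bar> \<le> L"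
    and b: "0 < b" "b < 1" and T: "0 < T"
    and G: "integrable lborel (\<lambda>x. indicator {0..T} x * G x)"
    and U: "\<And>t. 0 < t \<Longrightarrow> t \<le> T \<Longrightarrow>
      (LINT s|lborel. indicator {0..t} s * (u s * (t - s) powr (-b))) = (LINT x|lborel. indicator {0..t} x * G x)"
  shows "AE y in lborel. y \<in> {0<..<T} \<longrightarrow>
     (LINT x|lborel. indicator {0..y} x * (G x * (y - x) powr (b - 1))) = Beta b (1 - b) * u y"
proof -
  \<comment> \<open>The cutoff makes \<open>A\<close> integrable on the whole line, as the triangle
    lemma requires.\<close>
  define A where "A = (\<lambda>x. indicator {0..T} x * G x)"
  have A: "integrable lborel A" using G by (simp add: A_def)
  define \<psi> where "\<psi> y = (LINT x|lborel. indicator {0..y} x * (A x * (y - x) powr (b - 1)))" for y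
  have pow: "has_bochner_integral lborel (\<lambda>y. indicator {x..t} y * (y - x) powr (b - 1)) ((t - x) powr b / b)"
       "has_bochner_integral lborel (\<lambda>y. indicator {x..t} y * (t - y) powr (b - 1)) ((t - x) powr b / b)"
       if "x \<le> t" for x t
    using has_bochner_integral_powr[of "b - 1" x t] has_bochner_integral_powr'[of "b - 1" x t] b that by simp_all
  have bd: "(\<integral>\<^sup>+y. ennreal (indicator {x..t} y * \<bar>(y - x) powr (b - 1)\<bar>) \<partial>lborel) \<le> ennreal (t powr b / b)"
       "(\<integral>\<^sup>+y. ennreal (indicator {x..t} y * \<bar>(t - y) powr (b - 1)\<bar>) \<partial>lborel) \<le> ennreal (t powr b / b)"
       if "0 \<le> x" "x \<le> t" for x t
  proof -
    have "(t - x) powr b / b \<le> t powr b / b"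
      using that b by (intro divide_right_mono powr_mono2) auto
    then show "(\<integral>\<^sup>+y. ennreal (indicator {x..t} y * \<bar>(y - x) powr (b - 1)\<bar>) \<partial>lborel) \<le> ennreal (t powr b / b)"
       "(\<integral>\<^sup>+y. ennreal (indicator {x..t} y * \<bar>(t - y) powr (b - 1)\<bar>) \<partial>lborel) \<le> ennreal (t powr b / b)"
      using nn_integral_eq_has_bochner[OF pow(1)[OF that(2)]] nn_integral_eq_has_bochner[OF pow(2)[OF that(2)]]
      by (simp_all add: ennreal_leI)
  qed
  have int_\<psi>: "integrable lborel (\<lambda>y. indicator {0..t} y * \<psi> y)"
    and \<psi>_eq: "(LINT y|lborel. indicator {0..t} y * \<psi> y) = (LINT x|lborel. indicator {0..t} x * (A x * ((t - x) powr b / b)))" for t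
  proof -
    show "integrable lborel (\<lambda>y. indicator {0..t} y * \<psi> y)"
      unfolding \<psi>_def by (rule triangle_Fubini(2)[OF A _ bd(1)]) auto
    have "(LINT y|lborel. indicator {0..t} y * \<psi> y)
       = (LINT x|lborel. indicator {0..t} x * (A x * (LINT y|lborel. indicator {x..t} y * (y - x) powr (b - 1))))"
      unfolding \<psi>_def by (rule triangle_Fubini(1)[OF A _ bd(1), symmetric]) auto
    also have "\<dots> = (LINT x|lborel. indicator {0..t} x * (A x * ((t - x) powr b / b)))"
      by (intro Bochner_Integration.integral_cong refl)
        (simp add: has_bochner_integral_integral_eq[OF pow(1)] split: split_indicator)
    finally show "(LINT y|lborel. indicator {0..t} y * \<psi> y) = (LINT x|lborel. indicator {0..t} x * (A x * ((t - x) powr b / b)))" .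
  qed
  have int_u: "integrable lborel (\<lambda>x. indicator {0..t} x * u x)" for t :: real
    by (rule integrableI_bounded_set[where A="{0..t}" and B=L])
      (use L in \<open>auto simp: indicator_def emeasure_lborel_Icc_eq\<close>)
  have main: "(LINT y|lborel. indicator {0..t} y * \<psi> y) = Beta b (1 - b) * (LINT x|lborel. indicator {0..t} x * u x)"
    if t: "0 < t" "t \<le> T" for t
  proof -
    have Bt: "has_bochner_integral lborel (\<lambda>z. indicator {s..t} z * ((t - z) powr (b - 1) * (z - s) powr (-b))) (Beta b (1 - b))" if "s < t" for s
      using has_bochner_integral_Beta[of b "1 - b" s t] b that by simp
    have bdB: "(\<integral>\<^sup>+y. ennreal (indicator {x..t} y * \<bar>(t - y) powr (b - 1) * (y - x) powr (-b)\<bar>) \<partial>lborel) \<le> ennreal (Beta b (1-b))"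
      if "0 \<le> x" "x \<le> t" for x
    proof (cases "x = t")
      case True
      then show ?thesis by (auto intro!: order.trans[OF eq_refl[OF nn_integral_0_iff_AE[THEN iffD2]]] simp: indicator_def)
    next
      case False
      then show ?thesis using nn_integral_eq_has_bochner[OF Bt[of x]] \<open>x \<le> t\<close> by simp
    qed
    \<comment> \<open>The weight \<open>(t - x) powr b / b\<close> is also the integral of the
      reversed kernel \<open>(t - y) powr (b - 1)\<close>. With this reading the inner integral
      after the swap is the plain primitive of \<open>A\<close>, to which the hypothesis
      \<open>U\<close> applies.\<close>
    have "(LINT x|lborel. indicator {0..t} x * (A x * ((t - x) powr b / b)))
       = (LINT x|lborel. indicator {0..t} x * (A x * (LINT y|lborel. indicator {x..t} y * (t - y) powr (b - 1))))"
      by (intro Bochner_Integration.integral_cong refl)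
        (simp add: has_bochner_integral_integral_eq[OF pow(2)] split: split_indicator)
    also have "\<dots> = (LINT z|lborel. indicator {0..t} z * (LINT x|lborel. indicator {0..z} x * (A x * (t - z) powr (b - 1))))"
      by (rule triangle_Fubini(1)[OF A _ bd(2)]) auto
    also have "\<dots> = (LINT z|lborel. indicator {0..t} z * (LINT s|lborel. indicator {0..z} s * (indicator {0..t} s * u s * ((t - z) powr (b - 1) * (z - s) powr (-b)))))"
    proof (rule Bochner_Integration.integral_cong_AE)
      have [measurable]: "A \<in> borel_measurable borel"
        using borel_measurable_integrable[OF A] by simp
      show "(\<lambda>z. indicator {0..t} z * (LINT x|lborel. indicator {0..z} x * (A x * (t - z) powr (b - 1)))) \<in> borel_measurable lborel"
        using triangle_Fubini(2)[OF A _ bd(2)] by (rule borel_measurable_integrable) auto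
      show "(\<lambda>z. indicator {0..t} z * (LINT s|lborel. indicator {0..z} s * (indicator {0..t} s * u s * ((t - z) powr (b - 1) * (z - s) powr (-b))))) \<in> borel_measurable lborel"
      proof (rule borel_measurable_integrable[OF triangle_Fubini(2)[OF int_u, where C = "Beta b (1-b)"]])
        fix x assume "0 \<le> x" "x \<le> t"
        then show "(\<integral>\<^sup>+y. ennreal (indicator {x..t} y * \<bar>(t - y) powr (b - 1) * (y - x) powr (-b)\<bar>) \<partial>lborel) \<le> ennreal (Beta b (1-b))" by (rule bdB)
      qed simp
      \<comment> \<open>\<open>U\<close> is assumed for positive times only, so the single point 0
        is discarded.\<close>
      have "AE z::real in lborel. z \<noteq> 0" by (rule AE_lborel_singleton)
      then show "AE z in lborel. indicator {0..t} z * (LINT x|lborel. indicator {0..z} x * (A x * (t - z) powr (b - 1)))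
        = indicator {0..t} z * (LINT s|lborel. indicator {0..z} s * (indicator {0..t} s * u s * ((t - z) powr (b - 1) * (z - s) powr (-b))))"
      proof eventually_elim
        fix z :: real assume "z \<noteq> 0"
        show "indicator {0..t} z * (LINT x|lborel. indicator {0..z} x * (A x * (t - z) powr (b - 1)))
        = indicator {0..t} z * (LINT s|lborel. indicator {0..z} s * (indicator {0..t} s * u s * ((t - z) powr (b - 1) * (z - s) powr (-b))))"
        proof (cases "z \<in> {0..t}")
          case True
          then have z: "0 < z" "z \<le> t" using \<open>z \<noteq> 0\<close> by auto
          have "(LINT x|lborel. indicator {0..z} x * (A x * (t - z) powr (b - 1))) = (LINT x|lborel. (t - z) powr (b - 1) * (indicator {0..z} x * G x))"
            using z t by (intro Bochner_Integration.integral_cong refl) (auto simp: A_def indicator_def)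
          also have "\<dots> = (t - z) powr (b - 1) * (LINT s|lborel. indicator {0..z} s * (u s * (z - s) powr (-b)))"
            using U[of z] z t by simp
          also have "\<dots> = (LINT s|lborel. indicator {0..z} s * (indicator {0..t} s * u s * ((t - z) powr (b - 1) * (z - s) powr (-b))))"
            unfolding Bochner_Integration.integral_mult_right_zero[symmetric]
            using z t by (intro Bochner_Integration.integral_cong refl) (auto simp: indicator_def)
          finally show ?thesis by simp
        qed simp
      qed
    qed
    \<comment> \<open>Swapping once more puts both kernels into the integral over \<open>z\<close>,
      which is the constant \<open>Beta b (1 - b)\<close> for every \<open>s < t\<close>.\<close>
    also have "\<dots> = (LINT s|lborel. indicator {0..t} s * (indicator {0..t} s * u s * (LINT z|lborel. indicator {s..t} z * ((t - z) powr (b - 1) * (z - s) powr (-b)))))"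
      by (rule triangle_Fubini(1)[OF int_u _ bdB, symmetric]) auto
    also have "\<dots> = (LINT s|lborel. Beta b (1 - b) * (indicator {0..t} s * u s))"
    proof (rule Bochner_Integration.integral_cong_AE)
      have "AE s in lborel. s \<noteq> t" by (rule AE_lborel_singleton)
      then show "AE s in lborel. indicator {0..t} s * (indicator {0..t} s * u s * (LINT z|lborel. indicator {s..t} z * ((t - z) powr (b - 1) * (z - s) powr (-b))))
         = Beta b (1 - b) * (indicator {0..t} s * u s)"
        by eventually_elim (simp add: has_bochner_integral_integral_eq[OF Bt] split: split_indicator)
      show "(\<lambda>s. indicator {0..t} s * (indicator {0..t} s * u s * (LINT z|lborel. indicator {s..t} z * ((t - z) powr (b - 1) * (z - s) powr (-b)))))
        \<in> borel_measurable lborel"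
        by (rule borel_measurable_integrable[OF triangle_Fubini(3)[OF int_u _ bdB]]) auto
    qed simp
    finally show ?thesis using \<psi>_eq[of t] by simp
  qed
  have int_\<psi>': "set_integrable lborel {0..T} \<psi>"
    using int_\<psi>[of T] by (simp add: set_integrable_def)
  have int_u': "set_integrable lborel {0..T} (\<lambda>y. Beta b (1 - b) * u y)"
    using int_u[of T] by (simp add: set_integrable_def mult.left_commute)
  have "AE y in lborel. y \<in> {0<..<T} \<longrightarrow> \<psi> y = Beta b (1 - b) * u y"
    by (rule AE_eq_if_indefinite_integrals_eq[OF int_\<psi>' int_u'])
      (use main in \<open>simp add: set_lebesgue_integral_def mult.left_commute\<close>)
  then show ?thesis
  proof eventually_elim
    fix y assume y: "y \<in> {0<..<T} \<longrightarrow> \<psi> y = Beta b (1 - b) * u y"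
    have "y \<in> {0<..<T} \<Longrightarrow> \<psi> y = (LINT x|lborel. indicator {0..y} x * (G x * (y - x) powr (b - 1)))"
      unfolding \<psi>_def by (intro Bochner_Integration.integral_cong refl) (auto simp: A_def indicator_def)
    with y show "y \<in> {0<..<T} \<longrightarrow> (LINT x|lborel. indicator {0..y} x * (G x * (y - x) powr (b - 1))) = Beta b (1 - b) * u y"
      by auto
  qed
qed

section \<open>The generalized Lebesgue--Stieltjes integral as a forward integral\<close>

lemma AE_derivative_upper_integral:
  fixes H :: "real \<Rightarrow> real"
  assumes H: "set_integrable lborel {a..b} H"
  shows "AE x in lborel. x \<in> {a<..<b} \<longrightarrow>
    ((\<lambda>y. LINT s:{y..b}|lborel. H s) has_real_derivative - H x) (at x)"
  using AE_derivative_indefinite_integral[OF H]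
proof (eventually_elim, intro impI)
  fix x assume x: "x \<in> {a<..<b}"
    and d: "x \<in> {a<..<b} \<longrightarrow> ((\<lambda>y. LINT s:{a..y}|lborel. H s) has_real_derivative H x) (at x)"
  have split: "(LINT s:{y..b}|lborel. H s) = (LINT s:{a..b}|lborel. H s) - (LINT s:{a..y}|lborel. H s)" if y: "y \<in> {a<..<b}" for y
  proof -
    have sub: "{y<..b} \<subseteq> {a..b}" "{y..b} \<subseteq> {a..b}" "{a..y} \<subseteq> {a..b}" using y by auto
    have "(LINT s:{a..b}|lborel. H s) = (LINT s:{a..y} \<union> {y<..b}|lborel. H s)"
      using y by (simp add: ivl_disj_un)
    also have "\<dots> = (LINT s:{a..y}|lborel. H s) + (LINT s:{y<..b}|lborel. H s)"
      using y sub by (intro set_integral_Un set_integrable_subset[OF H]) auto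
    also have "(LINT s:{y<..b}|lborel. H s) = (LINT s:{y..b}|lborel. H s)"
    proof (rule set_integral_cong_set)
      have "AE x in lborel. x \<noteq> y" by (rule AE_lborel_singleton)
      then show "AE x in lborel. (x \<in> {y..b}) = (x \<in> {y<..b})"
        by eventually_elim auto
      have "set_integrable lborel {y<..b} H" "set_integrable lborel {y..b} H"
        using set_integrable_subset[OF H] sub by auto
      then show "set_borel_measurable lborel {y<..b} H" "set_borel_measurable lborel {y..b} H"
        unfolding set_integrable_def set_borel_measurable_def by (auto dest: borel_measurable_integrable)
    qed
    finally show ?thesis by simp
  qed
  have "((\<lambda>y. (LINT s:{a..b}|lborel. H s) - (LINT s:{a..y}|lborel. H s)) has_real_derivative - H x) (at x)"
    using d x by (auto intro!: derivative_eq_intros)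
  then show "((\<lambda>y. LINT s:{y..b}|lborel. H s) has_real_derivative - H x) (at x)"
    by (rule has_field_derivative_transform_within_open[of _ _ _ "{a<..<b}"]) (use x split in auto)
qed

text \<open>Translation commutes with the right-sided fractional integral because \<open>g\<close>
  is constant beyond \<open>T\<close>. Hence the forward quotient of \<open>g\<close> can be
  exchanged for the quotient of that fractional integral, which is Lipschitz, at the price of
  exchanging \<open>u\<close> for \<open>G\<close>.\<close>

lemma forward_integral_tendsto:
  fixes u g G H :: "real \<Rightarrow> real" and e :: "nat \<Rightarrow> real"
  assumes [measurable]: "u \<in> borel_measurable borel" and L: "\<And>x. \<bar>u x\<bar> \<le> L"
    and b: "0 < b" "b < 1" and T: "0 < T"
    and G: "integrable lborel (\<lambda>x. indicator {0..T} x * G x)"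
    and U: "\<And>t. 0 < t \<Longrightarrow> t \<le> T \<Longrightarrow>
      (LINT s|lborel. indicator {0..t} s * (u s * (t - s) powr (-b))) = (LINT x|lborel. indicator {0..t} x * G x)"
    and g: "continuous_on UNIV g" and K: "\<And>x. \<bar>g x\<bar> \<le> K" and gT: "\<And>x. T \<le> x \<Longrightarrow> g x = g T"
    and H: "integrable lborel (\<lambda>x. indicator {0..T} x * H x)"
    and C: "\<And>x. 0 \<le> x \<Longrightarrow> x \<le> T \<Longrightarrow> \<bar>H x\<bar> \<le> C"
    and V: "\<And>t. 0 \<le> t \<Longrightarrow> t \<le> T \<Longrightarrow>
      (LINT s|lborel. indicator {t..T} s * ((g T - g s) * (s - t) powr (b - 1))) = (LINT x|lborel. indicator {t..T} x * H x)"
    and e: "\<And>n. 0 < e n" "e \<longlonglongrightarrow> 0"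
  shows "(\<lambda>n. LINT y|lborel. indicator {0..T} y * (u y * ((g (y + e n) - g y) / e n)))
     \<longlonglongrightarrow> (LINT x|lborel. indicator {0..T} x * (G x * H x)) / Beta b (1 - b)"
proof -
  have [measurable]: "g \<in> borel_measurable borel"
    using g by (simp add: borel_measurable_continuous_onI)
  define V where "V t = (LINT s|lborel. indicator {t..T} s * ((g T - g s) * (s - t) powr (b - 1)))" for t
  have V': "V t = (LINT x|lborel. indicator {t..T} x * H x)" if "0 \<le> t" "t \<le> T" for t
    using V that by (simp add: V_def)
  have K0: "0 \<le> K" using K[of 0] by linarith
  have C0: "0 \<le> C" using C[of 0] T by linarith
  have pow: "has_bochner_integral lborel (\<lambda>y. indicator {x..t} y * (y - x) powr (b - 1)) ((t - x) powr b / b)"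
       if "x \<le> t" for x t
    using has_bochner_integral_powr[of "b - 1" x t] b that by simp
  have powK: "integrable lborel (\<lambda>y. indicator {x..t} y * (h y * (y - x) powr (b - 1)))"
    if "x \<le> t" and [measurable]: "h \<in> borel_measurable borel" and h: "\<And>y. \<bar>h y\<bar> \<le> K'" for x t K' h
  proof (rule Bochner_Integration.integrable_bound[of _ "\<lambda>y. K' * (indicator {x..t} y * (y - x) powr (b - 1))"])
    show "integrable lborel (\<lambda>y. K' * (indicator {x..t} y * (y - x) powr (b - 1)))"
      using pow[OF that(1)] by (intro integrable_mult_right) (simp add: has_bochner_integral_iff)
    have "0 \<le> K'" using h[of 0] by linarith
    then show "AE y in lborel. norm (indicator {x..t} y * (h y * (y - x) powr (b - 1))) \<le> norm (K' * (indicator {x..t} y * (y - x) powr (b - 1)))"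
      using h by (auto simp: indicator_def abs_mult intro!: mult_right_mono)
  qed simp
  \<comment> \<open>Substituting \<open>y + d\<close> would shorten the range of integration, but on
    the missing piece \<open>g T - g (y + d)\<close> vanishes, so the range up to \<open>T\<close>
    may be kept.\<close>
  have V_diff: "(V x - V (x + d)) / d = (LINT y|lborel. indicator {x..T} y * ((g (y + d) - g y) / d * (y - x) powr (b - 1)))"
    if x: "0 \<le> x" "x \<le> T" and d: "0 < d" for x d
  proof -
    have "V (x + d) = (LINT y|lborel. indicator {x + d..T} (d + 1 * y) * ((g T - g (d + 1 * y)) * ((d + 1 * y) - (x + d)) powr (b - 1)))"
      unfolding V_def
      using lborel_integral_real_affine[of 1 "\<lambda>s. indicator {x + d..T} s * ((g T - g s) * (s - (x + d)) powr (b - 1))" d]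
      by simp
    also have "\<dots> = (LINT y|lborel. indicator {x..T} y * ((g T - g (y + d)) * (y - x) powr (b - 1)))"
    proof (intro Bochner_Integration.integral_cong refl)
      fix y :: real
      show "indicator {x + d..T} (d + 1 * y) * ((g T - g (d + 1 * y)) * ((d + 1 * y) - (x + d)) powr (b - 1))
        = indicator {x..T} y * ((g T - g (y + d)) * (y - x) powr (b - 1))"
        using gT[of "y + d"] d by (cases "T \<le> y + d") (auto simp: indicator_def algebra_simps)
    qed
    finally have Vd: "V (x + d) = \<dots>" .
    have "V x - V (x + d) = (LINT y|lborel. indicator {x..T} y * ((g T - g y) * (y - x) powr (b - 1)) - indicator {x..T} y * ((g T - g (y + d)) * (y - x) powr (b - 1)))"
      unfolding Vd unfolding V_def
    proof (rule Bochner_Integration.integral_diff[symmetric])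
      have "\<bar>g T - g y\<bar> \<le> 2 * K" for y using K[of T] K[of y] by linarith
      then show "integrable lborel (\<lambda>y. indicator {x..T} y * ((g T - g y) * (y - x) powr (b - 1)))"
        "integrable lborel (\<lambda>y. indicator {x..T} y * ((g T - g (y + d)) * (y - x) powr (b - 1)))"
        by (auto intro!: powK[OF x(2)])
    qed
    also have "\<dots> = (LINT y|lborel. d * (indicator {x..T} y * ((g (y + d) - g y) / d * (y - x) powr (b - 1))))"
      by (intro Bochner_Integration.integral_cong refl) (use d in \<open>auto simp: indicator_def field_simps\<close>)
    also have "\<dots> = d * (LINT y|lborel. indicator {x..T} y * ((g (y + d) - g y) / d * (y - x) powr (b - 1)))"
      by simp
    finally show ?thesis using d by simp
  qed
  \<comment> \<open>\<open>H\<close> is controlled on \<open>{0..T}\<close> only; since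
    \<open>V\<close> vanishes from \<open>T\<close> on, the endpoint \<open>x + d\<close> may be
    replaced by \<open>min (x + d) T\<close>.\<close>
  have V_lip: "\<bar>V x - V (x + d)\<bar> \<le> C * d" if x: "0 \<le> x" "x \<le> T" and d: "0 < d" for x d
  proof -
    define y where "y = min (x + d) T"
    have xy: "x \<le> y" "y \<le> T" "0 \<le> y" "y - x \<le> d" using x d by (auto simp: y_def)
    have "V (x + d) = V y"
    proof (cases "x + d \<le> T")
      case True then show ?thesis by (simp add: y_def)
    next
      case False
      then have "V (x + d) = 0" by (simp add: V_def)
      moreover have "V T = 0"
        unfolding V_def by (rule integral_eq_zero_AE) (auto simp: indicator_def)
      ultimately show ?thesis using False by (simp add: y_def)
    qed
    have int: "integrable lborel (\<lambda>s. indicator {t..T} s * H s)" if "0 \<le> t" for t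
    proof -
      have "integrable lborel (\<lambda>s. indicator {t..T} s * (indicator {0..T} s * H s))"
        by (rule Bochner_Integration.integrable_bound[OF H])
          (use borel_measurable_integrable[OF H] in \<open>auto simp: indicator_def\<close>)
      also have "(\<lambda>s. indicator {t..T} s * (indicator {0..T} s * H s)) = (\<lambda>s. indicator {t..T} s * H s)"
        using that by (auto simp: indicator_def)
      finally show ?thesis .
    qed
    have "\<bar>V x - V y\<bar> = \<bar>LINT s|lborel. indicator {x..T} s * H s - indicator {y..T} s * H s\<bar>"
      using x xy int by (simp add: V')
    also have "\<dots> \<le> (LINT s|lborel. C * indicator {x..y} s)"
      unfolding real_norm_def[symmetric]
    proof (rule Bochner_Integration.integral_norm_bound_integral)
      show "integrable lborel (\<lambda>s. indicator {x..T} s * H s - indicator {y..T} s * H s)"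
        using int x xy by auto
      show "integrable lborel (\<lambda>s. C * indicator {x..y} s)" by (auto simp: emeasure_lborel_Icc_eq)
      show "norm (indicator {x..T} s * H s - indicator {y..T} s * H s) \<le> C * indicator {x..y} s" for s
        using x xy C C0 by (auto simp: indicator_def)
    qed
    also have "\<dots> = C * (y - x)" using xy by simp
    also have "\<dots> \<le> C * d" using xy C0 by (intro mult_left_mono)
    finally show ?thesis using \<open>V (x + d) = V y\<close> by simp
  qed
  have V_deriv: "AE x in lborel. x \<in> {0<..<T} \<longrightarrow> (\<lambda>n. (V x - V (x + e n)) / e n) \<longlonglongrightarrow> H x"
  proof -
    have H': "set_integrable lborel {0..T} H" using H by (simp add: set_integrable_def)
    show ?thesis
      using AE_derivative_upper_integral[OF H']
    proof (eventually_elim, intro impI)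
      fix x assume x: "x \<in> {0<..<T}"
        and d: "x \<in> {0<..<T} \<longrightarrow> ((\<lambda>y. LINT s:{y..T}|lborel. H s) has_real_derivative - H x) (at x)"
      have "(V has_real_derivative - H x) (at x)"
        by (rule has_field_derivative_transform_within_open[OF d[rule_format, OF x], of "{0<..<T}"])
          (use x V' in \<open>auto simp: set_lebesgue_integral_def\<close>)
      then have "((\<lambda>h. (V (x + h) - V x) / h) \<longlongrightarrow> - H x) (at 0)" by (simp add: DERIV_def)
      moreover have "filterlim e (at 0) sequentially"
        using e by (auto simp: filterlim_at intro!: always_eventually less_imp_neq[symmetric])
      ultimately have "(\<lambda>n. (V (x + e n) - V x) / e n) \<longlonglongrightarrow> - H x"
        by (rule filterlim_compose)
      then have "(\<lambda>n. - ((V (x + e n) - V x) / e n)) \<longlonglongrightarrow> - (- H x)" by (rule tendsto_minus)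
      then show "(\<lambda>n. (V x - V (x + e n)) / e n) \<longlonglongrightarrow> H x"
        by (simp only: minus_divide_left minus_diff_eq minus_minus)
    qed
  qed
  define A where "A = (\<lambda>x. indicator {0..T} x * G x)"
  have A: "integrable lborel A" using G by (simp add: A_def)
  then have [measurable]: "A \<in> borel_measurable borel" using borel_measurable_integrable[OF A] by simp
  have Beta_pos: "Beta b (1 - b) > 0" using b by (simp add: Beta_def Gamma_real_pos)
  \<comment> \<open>For a fixed step \<open>d\<close> this is an exact identity, so the limit has to
    be taken only on the side that contains \<open>V\<close>.\<close>
  have J: "(LINT y|lborel. indicator {0..T} y * (u y * ((g (y + d) - g y) / d)))
      = (LINT x|lborel. indicator {0..T} x * (A x * ((V x - V (x + d)) / d))) / Beta b (1 - b)"
    and J_meas: "(\<lambda>x. indicator {0..T} x * (A x * ((V x - V (x + d)) / d))) \<in> borel_measurable lborel" if d: "0 < d" for d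
  proof -
    define k where "k y = (g (y + d) - g y) / d" for y
    have [measurable]: "k \<in> borel_measurable borel" unfolding k_def by simp
    have k: "\<bar>k y\<bar> \<le> 2 * K / d" for y
      using d K[of y] K[of "y + d"] by (simp add: k_def abs_le_iff divide_right_mono)
    have bd: "(\<integral>\<^sup>+y. ennreal (indicator {x..T} y * \<bar>k y * (y - x) powr (b - 1)\<bar>) \<partial>lborel) \<le> ennreal (2 * K / d * (T powr b / b))"
      if "0 \<le> x" "x \<le> T" for x
    proof -
      have "(\<integral>\<^sup>+y. ennreal (indicator {x..T} y * \<bar>k y * (y - x) powr (b - 1)\<bar>) \<partial>lborel) \<le>
         (\<integral>\<^sup>+y. ennreal (2 * K / d * (indicator {x..T} y * (y - x) powr (b - 1))) \<partial>lborel)"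
      proof (intro nn_integral_mono ennreal_leI)
        fix y
        have "\<bar>k y\<bar> * (y - x) powr (b - 1) \<le> 2 * K / d * (y - x) powr (b - 1)"
          using k by (rule mult_right_mono) simp
        then show "indicator {x..T} y * \<bar>k y * (y - x) powr (b - 1)\<bar> \<le> 2 * K / d * (indicator {x..T} y * (y - x) powr (b - 1))"
          by (auto simp: indicator_def abs_mult)
      qed
      also have "\<dots> = ennreal (2 * K / d * ((T - x) powr b / b))"
        using that d K0 by (intro nn_integral_eq_has_bochner has_bochner_integral_mult_right pow) auto
      also have "\<dots> \<le> ennreal (2 * K / d * (T powr b / b))"
        using that d K0 b by (intro ennreal_leI mult_left_mono divide_right_mono powr_mono2) auto
      finally show ?thesis .
    qed
    have m: "case_prod (\<lambda>x y. k y * (y - x) powr (b - 1)) \<in> borel_measurable (borel \<Otimes>\<^sub>M borel)" by simp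
    note F = triangle_Fubini[OF A m bd]
    have Vk: "indicator {0..T} x * (A x * ((V x - V (x + d)) / d)) = indicator {0..T} x * (A x * (LINT y|lborel. indicator {x..T} y * (k y * (y - x) powr (b - 1))))" for x
    proof (cases "x \<in> {0..T}")
      case True
      then show ?thesis using V_diff[of x d] d unfolding k_def by auto
    qed simp
    show "(\<lambda>x. indicator {0..T} x * (A x * ((V x - V (x + d)) / d))) \<in> borel_measurable lborel"
      unfolding Vk using borel_measurable_integrable[OF F(3)] .
    have "(LINT x|lborel. indicator {0..T} x * (A x * ((V x - V (x + d)) / d)))
      = (LINT y|lborel. indicator {0..T} y * (LINT x|lborel. indicator {0..y} x * (A x * (k y * (y - x) powr (b - 1)))))"
      unfolding Vk by (rule F(1))
    also have "\<dots> = (LINT y|lborel. Beta b (1 - b) * (indicator {0..T} y * (u y * k y)))"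
    proof (rule Bochner_Integration.integral_cong_AE)
      show "(\<lambda>y. indicator {0..T} y * (LINT x|lborel. indicator {0..y} x * (A x * (k y * (y - x) powr (b - 1))))) \<in> borel_measurable lborel"
        using borel_measurable_integrable[OF F(2)] .
      have "AE y in lborel. y \<in> {0<..<T} \<longrightarrow>
         (LINT x|lborel. indicator {0..y} x * (G x * (y - x) powr (b - 1))) = Beta b (1 - b) * u y"
        using assms(1) L b T G U by (rule abel_inversion)
      moreover have "AE y::real in lborel. y \<noteq> 0" by (rule AE_lborel_singleton)
      moreover have "AE y::real in lborel. y \<noteq> T" by (rule AE_lborel_singleton)
      ultimately show "AE y in lborel. indicator {0..T} y * (LINT x|lborel. indicator {0..y} x * (A x * (k y * (y - x) powr (b - 1))))
         = Beta b (1 - b) * (indicator {0..T} y * (u y * k y))"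
      proof eventually_elim
        fix y assume y: "y \<in> {0<..<T} \<longrightarrow> (LINT x|lborel. indicator {0..y} x * (G x * (y - x) powr (b - 1))) = Beta b (1 - b) * u y" "y \<noteq> 0" "y \<noteq> T"
        show "indicator {0..T} y * (LINT x|lborel. indicator {0..y} x * (A x * (k y * (y - x) powr (b - 1))))
         = Beta b (1 - b) * (indicator {0..T} y * (u y * k y))"
        proof (cases "y \<in> {0<..<T}")
          case True
          have "(LINT x|lborel. indicator {0..y} x * (A x * (k y * (y - x) powr (b - 1)))) = (LINT x|lborel. k y * (indicator {0..y} x * (G x * (y - x) powr (b - 1))))"
            using True by (intro Bochner_Integration.integral_cong refl) (auto simp: A_def indicator_def)
          also have "\<dots> = k y * (Beta b (1 - b) * u y)" using y True by simp
          finally show ?thesis by simp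
        next
          case False
          then have "y \<notin> {0..T}" using y(2,3) by auto
          then show ?thesis by simp
        qed
      qed
    qed simp
    also have "\<dots> = Beta b (1 - b) * (LINT y|lborel. indicator {0..T} y * (u y * k y))" by simp
    finally show "(LINT y|lborel. indicator {0..T} y * (u y * ((g (y + d) - g y) / d)))
      = (LINT x|lborel. indicator {0..T} x * (A x * ((V x - V (x + d)) / d))) / Beta b (1 - b)"
      using Beta_pos d by (simp add: k_def)
  qed
  \<comment> \<open>The Lipschitz bound gives the majorant \<open>C * \<bar>A x\<bar>\<close>,
    uniformly in the step. The quotients of a merely Hoelder continuous \<open>g\<close> have no
    such bound.\<close>
  have "(\<lambda>n. LINT x|lborel. indicator {0..T} x * (A x * ((V x - V (x + e n)) / e n))) \<longlonglongrightarrow> (LINT x|lborel. A x * (indicator {0..T} x * H x))"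
  proof (rule integral_dominated_convergence[where w="\<lambda>x. C * \<bar>A x\<bar>"])
    show "integrable lborel (\<lambda>x. C * \<bar>A x\<bar>)" using A by simp
    show "(\<lambda>x. A x * (indicator {0..T} x * H x)) \<in> borel_measurable lborel"
      using borel_measurable_integrable[OF H] by simp
    show "(\<lambda>x. indicator {0..T} x * (A x * ((V x - V (x + e i)) / e i))) \<in> borel_measurable lborel" for i
      using J_meas e by simp
    show "AE x in lborel. norm (indicator {0..T} x * (A x * ((V x - V (x + e i)) / e i))) \<le> C * \<bar>A x\<bar>" for i
    proof (rule AE_I2)
      fix x :: real
      show "norm (indicator {0..T} x * (A x * ((V x - V (x + e i)) / e i))) \<le> C * \<bar>A x\<bar>"
      proof (cases "x \<in> {0..T}")
        case True
        have "\<bar>(V x - V (x + e i)) / e i\<bar> \<le> C"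
          using V_lip[of x "e i"] True e(1)[of i] by (simp add: abs_divide divide_le_eq)
        then have "\<bar>A x\<bar> * \<bar>(V x - V (x + e i)) / e i\<bar> \<le> \<bar>A x\<bar> * C" by (intro mult_left_mono) auto
        then show ?thesis using True by (simp add: abs_mult mult.commute)
      next
        case False then show ?thesis using C0 by simp
      qed
    qed
    have "AE x::real in lborel. x \<noteq> 0" "AE x::real in lborel. x \<noteq> T" by (rule AE_lborel_singleton)+
    with V_deriv show "AE x in lborel. (\<lambda>i. indicator {0..T} x * (A x * ((V x - V (x + e i)) / e i))) \<longlonglongrightarrow> A x * (indicator {0..T} x * H x)"
    proof eventually_elim
      fix x assume x: "x \<in> {0<..<T} \<longrightarrow> (\<lambda>n. (V x - V (x + e n)) / e n) \<longlonglongrightarrow> H x" "x \<noteq> 0" "x \<noteq> T"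
      show "(\<lambda>i. indicator {0..T} x * (A x * ((V x - V (x + e i)) / e i))) \<longlonglongrightarrow> A x * (indicator {0..T} x * H x)"
      proof (cases "x \<in> {0<..<T}")
        case True
        then have "(\<lambda>i. A x * ((V x - V (x + e i)) / e i)) \<longlonglongrightarrow> A x * H x"
          using x by (intro tendsto_mult tendsto_const) auto
        then show ?thesis using True by simp
      next
        case False
        then have "x \<notin> {0..T}" using x(2,3) by auto
        then show ?thesis by simp
      qed
    qed
  qed
  moreover have "(LINT x|lborel. A x * (indicator {0..T} x * H x)) = (LINT x|lborel. indicator {0..T} x * (G x * H x))"
    by (intro Bochner_Integration.integral_cong refl) (auto simp: A_def indicator_def)
  ultimately show ?thesis
    unfolding J[OF e(1)] using Beta_pos by (intro tendsto_divide tendsto_const) auto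
qed

text \<open>The Besov norm uses completed measures and a function known only on
  \<open>{0..T}\<close>, while Tonelli arguments want a Borel function on the line. Nonnegative
  integrals do not change under completion, so \<open>u\<close> may stand in for
  \<open>\<phi>\<close>.\<close>

lemma besov2_double_integral_eq:
  assumes \<phi>u: "\<And>x. 0 \<le> x \<Longrightarrow> x \<le> T \<Longrightarrow> \<phi> x = u x"
  shows "(\<integral>\<^sup>+t\<in>{0..T}. (\<integral>\<^sup>+s\<in>{0..t}. ennreal (\<bar>\<phi> t - \<phi> s\<bar> / (t - s) powr (b + 1)) \<partial>lebesgue) \<partial>lebesgue)
    = (\<integral>\<^sup>+t\<in>{0..T}. (\<integral>\<^sup>+s\<in>{0..t}. ennreal (\<bar>u t - u s\<bar> / (t - s) powr (b + 1)) \<partial>lborel) \<partial>lborel)"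
  unfolding nn_integral_completion
proof (rule nn_integral_cong)
  fix t
  have "(\<integral>\<^sup>+s\<in>{0..t}. ennreal (\<bar>\<phi> t - \<phi> s\<bar> / (t - s) powr (b + 1)) \<partial>lborel)
      = (\<integral>\<^sup>+s\<in>{0..t}. ennreal (\<bar>u t - u s\<bar> / (t - s) powr (b + 1)) \<partial>lborel)" if "t \<in> {0..T}"
    using that by (intro nn_integral_cong) (auto simp: \<phi>u indicator_def)
  then show "(\<integral>\<^sup>+s\<in>{0..t}. ennreal (\<bar>\<phi> t - \<phi> s\<bar> / (t - s) powr (b + 1)) \<partial>lborel) * indicator {0..T} t
      = (\<integral>\<^sup>+s\<in>{0..t}. ennreal (\<bar>u t - u s\<bar> / (t - s) powr (b + 1)) \<partial>lborel) * indicator {0..T} t"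
    by (cases "t \<in> {0..T}") auto
qed

lemma besov2_double_integral_finite:
  assumes "\<phi> \<in> besov2 T b" and \<phi>u: "\<And>x. 0 \<le> x \<Longrightarrow> x \<le> T \<Longrightarrow> \<phi> x = u x"
  shows "(\<integral>\<^sup>+t\<in>{0..T}. (\<integral>\<^sup>+s\<in>{0..t}. ennreal (\<bar>u t - u s\<bar> / (t - s) powr (b + 1)) \<partial>lborel) \<partial>lborel) < \<infinity>"
proof -
  have "(\<integral>\<^sup>+t\<in>{0..T}. (\<integral>\<^sup>+s\<in>{0..t}. ennreal (\<bar>\<phi> t - \<phi> s\<bar> / (t - s) powr (b + 1)) \<partial>lebesgue) \<partial>lebesgue) < \<infinity>"
    using assms(1) by (auto simp: besov2_def besov2_norm_def less_top[symmetric])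
  moreover note besov2_double_integral_eq[where \<phi>=\<phi> and u=u and T=T and b=b, OF \<phi>u]
  ultimately show ?thesis by simp
qed

text \<open>The approximating integrals do not mention \<open>b\<close>: every admissible exponent
  leads to the limit of one and the same sequence. \<open>u\<close> and \<open>h\<close> are
  extensions of \<open>\<phi>\<close> and \<open>g\<close> from \<open>{0..T}\<close> to the
  line.\<close>

lemma gls_integral_is_forward_limit:
  fixes \<phi> g u h :: "real \<Rightarrow> real" and e :: "nat \<Rightarrow> real"
  assumes [measurable]: "u \<in> borel_measurable borel" and L: "\<And>x. \<bar>u x\<bar> \<le> L"
    and T: "0 < T"
    and \<phi>u: "\<And>x. 0 \<le> x \<Longrightarrow> x \<le> T \<Longrightarrow> \<phi> x = u x"
    and h: "continuous_on UNIV h" and K: "\<And>x. \<bar>h x\<bar> \<le> K" and hT: "\<And>x. T \<le> x \<Longrightarrow> h x = h T"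
    and gh: "\<And>x. 0 \<le> x \<Longrightarrow> x \<le> T \<Longrightarrow> g x = h x"
    and adm: "gls_admissible T \<phi> g b"
    and e: "\<And>n. 0 < e n" "e \<longlonglongrightarrow> 0"
  shows "set_integrable lebesgue {0..T} (gls_integrand \<phi> g T b)"
    and "(\<lambda>n. LINT y|lborel. indicator {0..T} y * (u y * ((h (y + e n) - h y) / e n)))
     \<longlonglongrightarrow> (LINT x:{0..T}|lebesgue. gls_integrand \<phi> g T b x)"
proof -
  have b: "0 < b" "b < 1" using adm by (auto simp: gls_admissible_def)
  define a where "a = 1 - b"
  have a: "0 < a" "a < 1" using b by (auto simp: a_def)
  have [measurable]: "h \<in> borel_measurable borel"
    using h by (simp add: borel_measurable_continuous_onI)
  define I where "I v b t = (\<integral>\<^sup>+s\<in>{0..t}. ennreal (\<bar>v t - v s\<bar> / (t - s) powr (b + 1)) \<partial>lborel)" for v :: "real \<Rightarrow> real" and b t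
  have fin_u: "(\<integral>\<^sup>+t\<in>{0..T}. I u b t \<partial>lborel) < \<infinity>"
    unfolding I_def using adm by (intro besov2_double_integral_finite[of \<phi>] \<phi>u) (auto simp: gls_admissible_def)
  have fin_sub: "(\<integral>\<^sup>+t\<in>{0..\<tau>}. I v c t \<partial>lborel) < \<infinity>"
    if "(\<integral>\<^sup>+t\<in>{0..T}. I v c t \<partial>lborel) < \<infinity>" "\<tau> \<le> T" for v c \<tau>
    by (rule le_less_trans[OF nn_integral_mono that(1)]) (use that(2) in \<open>auto simp: indicator_def\<close>)
  define G where "G = (\<lambda>t. u t * t powr (-b) + b * (LINT s:{0..t}|lborel. (u t - u s) / (t - s) powr (b + 1)))"
  note RLu = riemann_liouville_eq_integral_marchaud[OF assms(1) L b, folded G_def, folded I_def]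
  have G: "set_integrable lborel {0..T} G" by (rule RLu(1)[OF T fin_u])
  have U: "(LINT s:{0..t}|lborel. u s * (t - s) powr (-b)) = (LINT x:{0..t}|lborel. G x)" if "0 < t" "t \<le> T" for t
    by (rule RLu(2)[OF that(1) fin_sub[OF fin_u that(2)]])
  \<comment> \<open>The function differentiated in \<open>frac_deriv_0\<close> coincides near
    \<open>x\<close> with the primitive of \<open>G\<close>, so Lebesgue differentiation identifies
    the classical derivative almost everywhere.\<close>
  have D0: "AE x in lborel. x \<in> {0<..<T} \<longrightarrow> frac_deriv_0 b \<phi> x = G x / Gamma (1 - b)"
    using AE_derivative_indefinite_integral[OF G]
  proof (eventually_elim, intro impI)
    fix x assume x: "x \<in> {0<..<T}"
      and d: "x \<in> {0<..<T} \<longrightarrow> ((\<lambda>y. LINT s:{0..y}|lborel. G s) has_real_derivative G x) (at x)"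
    have eq: "(LINT s:{0..y}|lebesgue. \<phi> s * (y - s) powr (-b)) = (LINT s:{0..y}|lborel. G s)" if y: "y \<in> {0<..<T}" for y
    proof -
      have "(LINT s:{0..y}|lebesgue. \<phi> s * (y - s) powr (-b)) = (LINT s:{0..y}|lebesgue. u s * (y - s) powr (-b))"
        using y by (intro set_lebesgue_integral_cong) (auto simp: \<phi>u)
      also have "\<dots> = (LINT s:{0..y}|lborel. u s * (y - s) powr (-b))"
        unfolding set_lebesgue_integral_def by (intro integral_completion) simp
      finally show ?thesis using U[of y] y by simp
    qed
    have "((\<lambda>y. LINT s:{0..y}|lebesgue. \<phi> s * (y - s) powr (-b)) has_real_derivative G x) (at x)"
      by (rule has_field_derivative_transform_within_open[OF d[rule_format, OF x], of "{0<..<T}"])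
        (use x eq in auto)
    then show "frac_deriv_0 b \<phi> x = G x / Gamma (1 - b)"
      by (simp add: frac_deriv_0_def DERIV_imp_deriv)
  qed

  define N where "N = enn2real (besov1_norm T a g)"
  have N: "ennreal (\<bar>g t - g s\<bar> / (t - s) powr a) + (\<integral>\<^sup>+u\<in>{s..t}. ennreal (\<bar>g u - g s\<bar> / (u - s) powr (a + 1)) \<partial>lebesgue) \<le> ennreal N"
    if "0 \<le> s" "s < t" "t \<le> T" for s t
  proof -
    have "besov1_norm T a g < \<infinity>" using adm by (auto simp: gls_admissible_def besov1_def a_def)
    then have "ennreal N = besov1_norm T a g" by (simp add: N_def)
    then show ?thesis
      unfolding besov1_norm_def using that by (auto intro!: SUP_upper2[of "(s,t)"])
  qed
  have N0: "0 \<le> N" by (simp add: N_def)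
  \<comment> \<open>The reflection \<open>x \<mapsto> T - x\<close> turns the right-sided derivative
    into a left-sided one, so the same Marchaud representation serves both factors. Subtraction from
    \<open>h T\<close> makes \<open>v 0 = 0\<close>.\<close>
  define v where "v x = h T - h (T - x)" for x
  have [measurable]: "v \<in> borel_measurable borel" unfolding v_def by simp
  have v: "\<bar>v x\<bar> \<le> 2 * K" for x using K[of T] K[of "T - x"] by (auto simp: v_def)
  have v_Hoelder: "\<bar>v t\<bar> * t powr (-a) \<le> N" if t: "0 < t" "t \<le> T" for t
  proof -
    have "ennreal (\<bar>g T - g (T - t)\<bar> / (T - (T - t)) powr a) \<le> ennreal N"
      using N[of "T - t" T] t by (auto intro: order_trans[rotated])
    then have "\<bar>g T - g (T - t)\<bar> / t powr a \<le> N" using N0 by simp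
    then show ?thesis using t T by (simp add: v_def gh powr_minus_divide)
  qed
  have v_I: "I v a t \<le> ennreal N" if t: "0 \<le> t" "t \<le> T" for t
  proof (cases "t = 0")
    case True
    have "I v a t = (\<integral>\<^sup>+s. 0 \<partial>(lborel :: real measure))"
      unfolding I_def True by (intro nn_integral_cong) (auto simp: indicator_def)
    then show ?thesis by simp
  next
    case False
    have "I v a t = (\<integral>\<^sup>+s. ennreal (\<bar>v t - v s\<bar> / (t - s) powr (a + 1)) * indicator {0..t} s \<partial>lborel)"
      by (simp add: I_def)
    also have "\<dots> = (\<integral>\<^sup>+s. ennreal (\<bar>v t - v (T + (-1) * s)\<bar> / (t - (T + (-1) * s)) powr (a + 1)) * indicator {0..t} (T + (-1) * s) \<partial>lborel)"
      by (subst nn_integral_real_affine[of _ "-1" T]) auto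
    also have "\<dots> = (\<integral>\<^sup>+s\<in>{T - t..T}. ennreal (\<bar>g s - g (T - t)\<bar> / (s - (T - t)) powr (a + 1)) \<partial>lborel)"
    proof (rule nn_integral_cong)
      fix s :: real
      have e: "t - (T + (-1) * s) = s - (T - t)" by simp
      show "ennreal (\<bar>v t - v (T + (-1) * s)\<bar> / (t - (T + (-1) * s)) powr (a + 1)) * indicator {0..t} (T + (-1) * s)
         = ennreal (\<bar>g s - g (T - t)\<bar> / (s - (T - t)) powr (a + 1)) * indicator {T - t..T} s"
        unfolding e using t by (auto simp: indicator_def v_def gh)
    qed
    also have "\<dots> \<le> ennreal N"
      using N[of "T - t" T] t False unfolding nn_integral_completion by (auto intro: order_trans[rotated])
    finally show ?thesis .
  qed
  have fin_v: "(\<integral>\<^sup>+t\<in>{0..T}. I v a t \<partial>lborel) < \<infinity>"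
  proof -
    have "(\<integral>\<^sup>+t\<in>{0..T}. I v a t \<partial>lborel) \<le> (\<integral>\<^sup>+t. ennreal N * indicator {0..T} t \<partial>lborel)"
      using v_I by (intro nn_integral_mono) (auto simp: indicator_def)
    also have "\<dots> < \<infinity>"
      using T by (simp add: nn_integral_cmult_indicator ennreal_mult_less_top)
    finally show ?thesis .
  qed
  define Gv where "Gv = (\<lambda>t. v t * t powr (-a) + a * (LINT s:{0..t}|lborel. (v t - v s) / (t - s) powr (a + 1)))"
  note RLv = riemann_liouville_eq_integral_marchaud[OF \<open>v \<in> borel_measurable borel\<close> v a, folded Gv_def, folded I_def]
  have Gv: "set_integrable lborel {0..T} Gv" by (rule RLv(1)[OF T fin_v])
  have Vv: "(LINT s:{0..t}|lborel. v s * (t - s) powr (-a)) = (LINT x:{0..t}|lborel. Gv x)" if "0 < t" "t \<le> T" for t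
    by (rule RLv(2)[OF that(1) fin_sub[OF fin_v that(2)]])
  \<comment> \<open>The two summands of the Marchaud form match the two summands of the
    \<open>besov1\<close> norm with base point \<open>T - t\<close>: the Hoelder quotient against
    \<open>T\<close>, and the singular integral. Each is at most \<open>N\<close>, the factor
    \<open>a\<close> being below 1.\<close>
  have Gv_bound: "\<bar>Gv t\<bar> \<le> 2 * N" if t: "0 \<le> t" "t \<le> T" for t
  proof -
    have "\<bar>LINT s:{0..t}|lborel. (v t - v s) / (t - s) powr (a + 1)\<bar> \<le> N"
    proof -
      have Iv: "(\<integral>\<^sup>+s. ennreal (norm (indicator {0..t} s *\<^sub>R ((v t - v s) / (t - s) powr (a + 1)))) \<partial>lborel) = I v a t"
        unfolding I_def by (intro nn_integral_cong) (auto simp: indicator_def abs_mult)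
      have "integrable lborel (\<lambda>s. indicator {0..t} s *\<^sub>R ((v t - v s) / (t - s) powr (a + 1)))"
      proof (rule integrableI_bounded)
        show "(\<integral>\<^sup>+s. ennreal (norm (indicator {0..t} s *\<^sub>R ((v t - v s) / (t - s) powr (a + 1)))) \<partial>lborel) < \<infinity>"
          unfolding Iv using v_I[OF t] by (rule le_less_trans) simp
      qed simp
      then have "ennreal (norm (LINT s:{0..t}|lborel. (v t - v s) / (t - s) powr (a + 1)))
         \<le> (\<integral>\<^sup>+s. ennreal (norm (indicator {0..t} s *\<^sub>R ((v t - v s) / (t - s) powr (a + 1)))) \<partial>lborel)"
        unfolding set_lebesgue_integral_def by (rule integral_norm_bound_ennreal)
      also have "\<dots> = I v a t" by (rule Iv)
      also have "\<dots> \<le> ennreal N" by (rule v_I[OF t])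
      finally show ?thesis using N0 by simp
    qed
    then have "a * \<bar>LINT s:{0..t}|lborel. (v t - v s) / (t - s) powr (a + 1)\<bar> \<le> 1 * N"
      using a N0 by (intro mult_mono) auto
    moreover have "\<bar>v t\<bar> * t powr (-a) \<le> N"
      using v_Hoelder[of t] t N0 by (cases "t = 0") auto
    moreover have "\<bar>Gv t\<bar> \<le> \<bar>v t\<bar> * t powr (-a) + a * \<bar>LINT s:{0..t}|lborel. (v t - v s) / (t - s) powr (a + 1)\<bar>"
      unfolding Gv_def using a by (intro order_trans[OF abs_triangle_ineq]) (simp add: abs_mult)
    ultimately show ?thesis by simp
  qed
  define H where "H x = Gv (T - x)" for x
  have reflect: "indicator {0..T} (T + (-1) * x) = (indicator {0..T} x :: real)" for x
    by (auto simp: indicator_def)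
  have H: "set_integrable lborel {0..T} H"
    using lborel_integrable_real_affine[OF Gv[unfolded set_integrable_def], of "-1" T]
    unfolding set_integrable_def reflect by (simp add: H_def)
  have H_bound: "\<bar>H x\<bar> \<le> 2 * N" if "0 \<le> x" "x \<le> T" for x
    using Gv_bound[of "T - x"] that by (simp add: H_def)
  have VH: "(LINT s|lborel. indicator {t..T} s * ((h T - h s) * (s - t) powr (b - 1))) = (LINT x|lborel. indicator {t..T} x * H x)"
    if t: "0 \<le> t" "t \<le> T" for t
  proof (cases "t = T")
    case True
    have "AE s in lborel. s \<noteq> T" by (rule AE_lborel_singleton)
    then have "AE s in lborel. indicator {t..T} s * H s = 0"
      by eventually_elim (auto simp: True indicator_def)
    then have "(LINT x|lborel. indicator {t..T} x * H x) = 0" by (rule integral_eq_zero_AE)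
    moreover have "(LINT s|lborel. indicator {t..T} s * ((h T - h s) * (s - t) powr (b - 1))) = 0"
      by (rule integral_eq_zero_AE) (auto simp: True indicator_def)
    ultimately show ?thesis by simp
  next
    case False
    have i: "indicator {t..T} (T + (-1) * s) = (indicator {0..T-t} s :: real)" for s
      by (auto simp: indicator_def)
    have "(LINT s|lborel. indicator {t..T} s * ((h T - h s) * (s - t) powr (b - 1)))
       = (LINT s|lborel. indicator {t..T} (T + (-1) * s) * ((h T - h (T + (-1) * s)) * ((T + (-1) * s) - t) powr (b - 1)))"
      using lborel_integral_real_affine[of "-1" "\<lambda>s. indicator {t..T} s * ((h T - h s) * (s - t) powr (b - 1))" T] by simp
    also have "\<dots> = (LINT s:{0..T-t}|lborel. v s * ((T - t) - s) powr (-a))"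
      unfolding i set_lebesgue_integral_def by (simp add: v_def a_def algebra_simps)
    also have "\<dots> = (LINT x:{0..T-t}|lborel. Gv x)" using Vv[of "T - t"] t False by simp
    also have "\<dots> = (LINT s|lborel. indicator {t..T} (T + (-1) * s) * Gv s)"
      unfolding i set_lebesgue_integral_def by simp
    also have "\<dots> = (LINT s|lborel. indicator {t..T} s * H s)"
      using lborel_integral_real_affine[of "-1" "\<lambda>s. indicator {t..T} s * H s" T] by (simp add: H_def)
    finally show ?thesis .
  qed
  \<comment> \<open>The integrand contains the left limit of \<open>g\<close> at \<open>T\<close>;
    the continuous extension \<open>h\<close> identifies it with a value.\<close>
  have Lim_g: "Lim (at_left T) g = h T"
  proof (rule tendsto_Lim)
    have "(h \<longlongrightarrow> h T) (at T within {..<T})"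
      using h by (meson UNIV_I continuous_on_def tendsto_within_subset subset_UNIV)
    moreover have "eventually (\<lambda>x. h x = g x) (at_left T)"
      using eventually_at_left_real[OF T] by eventually_elim (simp add: gh)
    ultimately show "(g \<longlongrightarrow> h T) (at_left T)" by (rule Lim_transform_eventually)
  qed simp
  have D1: "AE x in lborel. x \<in> {0<..<T} \<longrightarrow>
     frac_deriv_end T (1 - b) (\<lambda>y. Lim (at_left T) g - g y) x = H x / Gamma b"
    using AE_derivative_upper_integral[OF H]
  proof (eventually_elim, intro impI)
    fix x assume x: "x \<in> {0<..<T}"
      and d: "x \<in> {0<..<T} \<longrightarrow> ((\<lambda>y. LINT s:{y..T}|lborel. H s) has_real_derivative - H x) (at x)"
    have eq: "(LINT s:{y..T}|lebesgue. (Lim (at_left T) g - g s) * (s - y) powr (-(1 - b))) = (LINT s:{y..T}|lborel. H s)"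
      if y: "y \<in> {0<..<T}" for y
    proof -
      have "(LINT s:{y..T}|lebesgue. (Lim (at_left T) g - g s) * (s - y) powr (-(1 - b)))
          = (LINT s:{y..T}|lebesgue. (h T - h s) * (s - y) powr (b - 1))"
        using y by (intro set_lebesgue_integral_cong) (auto simp: gh Lim_g)
      also have "\<dots> = (LINT s:{y..T}|lborel. (h T - h s) * (s - y) powr (b - 1))"
        unfolding set_lebesgue_integral_def by (intro integral_completion) simp
      finally show ?thesis using VH[of y] y by (simp add: set_lebesgue_integral_def)
    qed
    have "((\<lambda>y. LINT s:{y..T}|lebesgue. (Lim (at_left T) g - g s) * (s - y) powr (-(1 - b))) has_real_derivative - H x) (at x)"
      by (rule has_field_derivative_transform_within_open[OF d[rule_format, OF x], of "{0<..<T}"])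
        (use x eq in auto)
    then show "frac_deriv_end T (1 - b) (\<lambda>y. Lim (at_left T) g - g y) x = H x / Gamma b"
      unfolding frac_deriv_end_def by (simp add: DERIV_imp_deriv)
  qed
  \<comment> \<open>The two derivatives contribute the factors \<open>1 / Gamma (1 - b)\<close> and
    \<open>1 / Gamma b\<close>; since \<open>Gamma 1 = 1\<close>, their product is exactly the
    normalisation \<open>1 / Beta b (1 - b)\<close> of the forward limit.\<close>
  define R where "R x = G x * H x / Beta b (1 - b)" for x
  have Beta_eq: "Beta b (1 - b) = Gamma b * Gamma (1 - b)" by (simp add: Beta_def)
  have int_R: "integrable lborel (\<lambda>x. indicator {0..T} x * R x)"
  proof -
    have G': "integrable lborel (\<lambda>x. indicator {0..T} x * G x)" and H': "integrable lborel (\<lambda>x. indicator {0..T} x * H x)"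
      using G H by (auto simp: set_integrable_def)
    have "integrable lborel (\<lambda>x. (indicator {0..T} x * G x) * (indicator {0..T} x * H x))"
    proof (rule Bochner_Integration.integrable_bound[of _ "\<lambda>x. 2 * N * (indicator {0..T} x * G x)"])
      show "integrable lborel (\<lambda>x. 2 * N * (indicator {0..T} x * G x))" using G' by (rule integrable_mult_right)
      show "(\<lambda>x. (indicator {0..T} x * G x) * (indicator {0..T} x * H x)) \<in> borel_measurable lborel"
        using borel_measurable_integrable[OF G'] borel_measurable_integrable[OF H'] by simp
      show "AE x in lborel. norm ((indicator {0..T} x * G x) * (indicator {0..T} x * H x)) \<le> norm (2 * N * (indicator {0..T} x * G x))"
      proof (rule AE_I2)
        fix x
        show "norm ((indicator {0..T} x * G x) * (indicator {0..T} x * H x)) \<le> norm (2 * N * (indicator {0..T} x * G x))"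
          using mult_right_mono[OF H_bound[of x], of "\<bar>G x\<bar>"] N0
          by (cases "x \<in> {0..T}") (auto simp: abs_mult mult.commute)
      qed
    qed
    then have "integrable lborel (\<lambda>x. (indicator {0..T} x * G x) * (indicator {0..T} x * H x) / Beta b (1 - b))"
      by simp
    also have "(\<lambda>x. (indicator {0..T} x * G x) * (indicator {0..T} x * H x) / Beta b (1 - b)) = (\<lambda>x. indicator {0..T} x * R x)"
      by (auto simp: R_def indicator_def)
    finally show ?thesis .
  qed
  have R_leb: "R absolutely_integrable_on {0..T}"
    unfolding set_integrable_def real_scaleR_def
    using int_R borel_measurable_integrable[OF int_R] by (subst integrable_completion) auto
  have "AE x in lborel. x \<noteq> 0" "AE x in lborel. x \<noteq> T" by (rule AE_lborel_singleton)+
  with D0 D1 have "AE x in lborel. x \<in> {0..T} \<longrightarrow> gls_integrand \<phi> g T b x = R x"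
    by eventually_elim (auto simp: gls_integrand_def R_def Beta_eq)
  then have "AE x in lebesgue. x \<in> {0..T} \<longrightarrow> gls_integrand \<phi> g T b x = R x"
    by (rule AE_completion)
  \<comment> \<open>\<open>gls_integrand\<close> is built from \<open>deriv\<close>, so its
    measurability is not at hand directly. Equality with \<open>R\<close> off a negligible set
    transfers both integrability and value through the spike rules.\<close>
  then obtain Z where Z: "Z \<in> null_sets lebesgue" "{x. \<not> (x \<in> {0..T} \<longrightarrow> gls_integrand \<phi> g T b x = R x)} \<subseteq> Z"
    by (auto simp: eventually_ae_filter)
  then have negl: "negligible Z" by (simp add: negligible_iff_null_sets)
  have eqR: "gls_integrand \<phi> g T b x = R x" if "x \<in> {0..T} - Z" for x using Z that by auto
  show int_gls: "set_integrable lebesgue {0..T} (gls_integrand \<phi> g T b)"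
    by (rule absolutely_integrable_spike[OF R_leb negl eqR])
  have "(LINT x:{0..T}|lebesgue. gls_integrand \<phi> g T b x) = integral {0..T} (gls_integrand \<phi> g T b)"
    by (rule set_lebesgue_integral_eq_integral(2)[OF int_gls])
  also have "\<dots> = integral {0..T} R"
    by (rule integral_spike[OF negl, symmetric]) (use eqR in auto)
  also have "\<dots> = (LINT x:{0..T}|lebesgue. R x)"
    by (rule set_lebesgue_integral_eq_integral(2)[OF R_leb, symmetric])
  also have "\<dots> = (LINT x|lborel. indicator {0..T} x * R x)"
    unfolding set_lebesgue_integral_def real_scaleR_def
    using borel_measurable_integrable[OF int_R] by (intro integral_completion) simp
  also have "(\<lambda>x. indicator {0..T} x * R x) = (\<lambda>x. indicator {0..T} x * (G x * H x) / Beta b (1 - b))"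
    by (simp add: R_def)
  finally have val: "(LINT x:{0..T}|lebesgue. gls_integrand \<phi> g T b x) = (LINT x|lborel. indicator {0..T} x * (G x * H x)) / Beta b (1 - b)"
    by simp
  show "(\<lambda>n. LINT y|lborel. indicator {0..T} y * (u y * ((h (y + e n) - h y) / e n)))
     \<longlonglongrightarrow> (LINT x:{0..T}|lebesgue. gls_integrand \<phi> g T b x)"
    unfolding val
  proof (rule forward_integral_tendsto[OF assms(1) L b T _ _ h K hT _ H_bound VH e])
    show "integrable lborel (\<lambda>x. indicator {0..T} x * G x)" "integrable lborel (\<lambda>x. indicator {0..T} x * H x)"
      using G H by (auto simp: set_integrable_def)
    show "(LINT s|lborel. indicator {0..t} s * (u s * (t - s) powr (-b))) = (LINT x|lborel. indicator {0..t} x * G x)"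
      if "0 < t" "t \<le> T" for t
      using U[OF that] by (simp add: set_lebesgue_integral_def)
  qed
qed

section \<open>The change of variables formula for Hoelder paths\<close>

text \<open>The lag \<open>r = t - s\<close> becomes the outer variable. In this form the Besov
  double integral averages, over all steps \<open>r\<close>, the L1 size of the increments with step
  \<open>r\<close>, which links it to forward integrals.\<close>

lemma nn_integral_triangle_shift:
  fixes F :: "real \<Rightarrow> real \<Rightarrow> ennreal"
  assumes [measurable]: "case_prod F \<in> borel_measurable (borel \<Otimes>\<^sub>M borel)"
  shows "(\<integral>\<^sup>+t\<in>{0..T}. (\<integral>\<^sup>+s\<in>{0..t}. F s t \<partial>lborel) \<partial>lborel)
    = (\<integral>\<^sup>+r\<in>{0..T}. (\<integral>\<^sup>+s\<in>{0..T-r}. F s (s + r) \<partial>lborel) \<partial>lborel)"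
proof -
  define \<Delta> where "\<Delta> = {(s::real,t). 0 \<le> s \<and> s \<le> t \<and> t \<le> T}"
  have "closed \<Delta>"
    by (auto simp: \<Delta>_def case_prod_unfold intro!: closed_Collect_conj closed_Collect_le continuous_intros)
  then have "\<Delta> \<in> sets borel" by simp
  then have [measurable]: "\<Delta> \<in> sets (borel \<Otimes>\<^sub>M borel)" unfolding borel_prod .
  define f where "f s t = F s t * indicator \<Delta> (s,t)" for s t
  have f[measurable]: "case_prod f \<in> borel_measurable (borel \<Otimes>\<^sub>M borel)" unfolding f_def by measurable
  have "(\<integral>\<^sup>+t\<in>{0..T}. (\<integral>\<^sup>+s\<in>{0..t}. F s t \<partial>lborel) \<partial>lborel) = (\<integral>\<^sup>+t. (\<integral>\<^sup>+s. f s t \<partial>lborel) \<partial>lborel)"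
  proof (rule nn_integral_cong)
    fix t
    have "(\<integral>\<^sup>+s. f s t \<partial>lborel) = (\<integral>\<^sup>+s. F s t * indicator {0..t} s * indicator {0..T} t \<partial>lborel)"
      by (intro nn_integral_cong) (auto simp: f_def \<Delta>_def indicator_def)
    also have "\<dots> = (\<integral>\<^sup>+s\<in>{0..t}. F s t \<partial>lborel) * indicator {0..T} t"
      by (rule nn_integral_multc) simp
    finally show "(\<integral>\<^sup>+s\<in>{0..t}. F s t \<partial>lborel) * indicator {0..T} t = (\<integral>\<^sup>+s. f s t \<partial>lborel)" by simp
  qed
  also have "\<dots> = (\<integral>\<^sup>+s. (\<integral>\<^sup>+t. f s t \<partial>lborel) \<partial>lborel)"
    by (rule lborel_pair.Fubini') simp
  also have "\<dots> = (\<integral>\<^sup>+s. (\<integral>\<^sup>+r. f s (s + r) \<partial>lborel) \<partial>lborel)"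
  proof (rule nn_integral_cong)
    fix s
    show "(\<integral>\<^sup>+t. f s t \<partial>lborel) = (\<integral>\<^sup>+r. f s (s + r) \<partial>lborel)"
      using nn_integral_real_affine[of "f s" 1 s] by simp
  qed
  also have "\<dots> = (\<integral>\<^sup>+r. (\<integral>\<^sup>+s. f s (s + r) \<partial>lborel) \<partial>lborel)"
    by (rule lborel_pair.Fubini') simp
  also have "\<dots> = (\<integral>\<^sup>+r\<in>{0..T}. (\<integral>\<^sup>+s\<in>{0..T-r}. F s (s + r) \<partial>lborel) \<partial>lborel)"
  proof (rule nn_integral_cong)
    fix r
    have "(\<integral>\<^sup>+s. f s (s + r) \<partial>lborel) = (\<integral>\<^sup>+s. F s (s + r) * indicator {0..T-r} s * indicator {0..T} r \<partial>lborel)"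
      by (intro nn_integral_cong) (auto simp: f_def \<Delta>_def indicator_def)
    also have "\<dots> = (\<integral>\<^sup>+s\<in>{0..T-r}. F s (s + r) \<partial>lborel) * indicator {0..T} r"
      by (rule nn_integral_multc) simp
    finally show "(\<integral>\<^sup>+s. f s (s + r) \<partial>lborel) = (\<integral>\<^sup>+s\<in>{0..T-r}. F s (s + r) \<partial>lborel) * indicator {0..T} r" .
  qed
  finally show ?thesis .
qed

lemma nn_integral_inverse_near_0:
  fixes q :: real
  assumes q: "0 < q"
  shows "(\<integral>\<^sup>+r. ennreal (indicator {0<..q} r * inverse r) \<partial>lborel) = \<infinity>"
proof -
  have "ennreal M \<le> (\<integral>\<^sup>+r. ennreal (indicator {0<..q} r * inverse r) \<partial>lborel)" if M: "0 \<le> M" for M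
  proof -
    \<comment> \<open>Chosen so that the integral of \<open>1 / r\<close> over
      \<open>{p..q}\<close>, which is \<open>ln q - ln p\<close>, equals \<open>M\<close>.\<close>
    define p where "p = q * exp (- M)"
    have p: "0 < p" "p \<le> q" using q M by (auto simp: p_def)
    have "((\<lambda>r. inverse r) has_integral (ln q - ln p)) {p..q}"
    proof (rule fundamental_theorem_of_calculus[OF p(2)])
      fix x assume "x \<in> {p..q}"
      then show "(ln has_vector_derivative inverse x) (at x within {p..q})"
        using p unfolding has_real_derivative_iff_has_vector_derivative[symmetric]
        by (auto intro!: derivative_eq_intros simp: inverse_eq_divide)
    qed
    then have "has_bochner_integral lborel (\<lambda>r. indicator {p..q} r * inverse r) (ln q - ln p)"
      by (rule has_bochner_integral_lborel_nonneg[rotated 3]) (use p in auto)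
    then have "(\<integral>\<^sup>+r. ennreal (indicator {p..q} r * inverse r) \<partial>lborel) = ennreal (ln q - ln p)"
      by (rule nn_integral_eq_has_bochner) (use p in \<open>auto simp: indicator_def\<close>)
    moreover have "ln q - ln p = M" using q by (simp add: p_def ln_mult)
    moreover have "(\<integral>\<^sup>+r. ennreal (indicator {p..q} r * inverse r) \<partial>lborel) \<le> (\<integral>\<^sup>+r. ennreal (indicator {0<..q} r * inverse r) \<partial>lborel)"
      using p by (intro nn_integral_mono ennreal_leI) (auto simp: indicator_def)
    ultimately show ?thesis by simp
  qed
  note le = this
  show ?thesis
  proof (rule ccontr)
    let ?I = "\<integral>\<^sup>+r. ennreal (indicator {0<..q} r * inverse r) \<partial>lborel"
    assume "?I \<noteq> \<infinity>"
    then have "?I = ennreal (enn2real ?I)" by (simp add: less_top)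
    moreover have "ennreal (enn2real ?I + 1) \<le> ?I" by (rule le) simp
    ultimately have "ennreal (enn2real ?I + 1) \<le> ennreal (enn2real ?I)" by (simp only:)
    then show False by (simp del: ennreal_plus)
  qed
qed

text \<open>Otherwise the Besov norm would dominate the divergent integral of \<open>c / r\<close> near \<open>0\<close>.\<close>

lemma besov2_small_increment:
  fixes u :: "real \<Rightarrow> real"
  assumes [measurable]: "u \<in> borel_measurable borel" and L: "\<And>x. \<bar>u x\<bar> \<le> L"
    and T: "0 < T" and c: "0 < c" and \<delta>: "0 < \<delta>"
    and fin: "(\<integral>\<^sup>+t\<in>{0..T}. (\<integral>\<^sup>+s\<in>{0..t}. ennreal (\<bar>u t - u s\<bar> / (t - s) powr (b + 1)) \<partial>lborel) \<partial>lborel) < \<infinity>"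
  obtains r where "0 < r" "r < \<delta>" "r < T"
    "(LINT s|lborel. indicator {0..T-r} s * \<bar>u (s + r) - u s\<bar>) < c * r powr b"
proof (rule ccontr)
  assume "\<not> thesis"
  with that have neg: "\<And>r. 0 < r \<Longrightarrow> r < \<delta> \<Longrightarrow> r < T \<Longrightarrow> c * r powr b \<le> (LINT s|lborel. indicator {0..T-r} s * \<bar>u (s + r) - u s\<bar>)"
    by (meson linorder_not_le)
  define q where "q = min \<delta> T / 2"
  have q: "0 < q" "q < \<delta>" "q < T" using \<delta> T by (auto simp: q_def)
  have "(\<integral>\<^sup>+r\<in>{0..T}. (\<integral>\<^sup>+s\<in>{0..T-r}. ennreal (\<bar>u (s + r) - u s\<bar> / (s + r - s) powr (b + 1)) \<partial>lborel) \<partial>lborel) < \<infinity>"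
    using fin by (subst nn_integral_triangle_shift[symmetric]) auto
  \<comment> \<open>For \<open>r\<close> in \<open>{0<..q}\<close> the failure of the conclusion
    bounds the slice at lag \<open>r\<close> from below by
    \<open>r powr (-b-1) * (c * r powr b)\<close>, which is \<open>c / r\<close>.\<close>
  moreover have "(\<integral>\<^sup>+r. ennreal c * ennreal (indicator {0<..q} r * inverse r) \<partial>lborel)
    \<le> (\<integral>\<^sup>+r\<in>{0..T}. (\<integral>\<^sup>+s\<in>{0..T-r}. ennreal (\<bar>u (s + r) - u s\<bar> / (s + r - s) powr (b + 1)) \<partial>lborel) \<partial>lborel)"
  proof (rule nn_integral_mono)
    fix r
    show "ennreal c * ennreal (indicator {0<..q} r * inverse r) \<le> (\<integral>\<^sup>+s\<in>{0..T-r}. ennreal (\<bar>u (s + r) - u s\<bar> / (s + r - s) powr (b + 1)) \<partial>lborel) * indicator {0..T} r"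
    proof (cases "r \<in> {0<..q}")
      case True
      then have r: "0 < r" "r < \<delta>" "r < T" using q by auto
      have int: "integrable lborel (\<lambda>s. indicator {0..T-r} s * \<bar>u (s + r) - u s\<bar>)"
      proof (rule integrableI_bounded_set[where A="{0..T-r}" and B="2 * L"])
        have "\<bar>u (x + r) - u x\<bar> \<le> 2 * L" for x using L[of x] L[of "x + r"] by linarith
        then show "AE x in lborel. x \<in> {0..T-r} \<longrightarrow> norm (indicator {0..T-r} x * \<bar>u (x + r) - u x\<bar>) \<le> 2 * L"
          by simp
      qed (use r in \<open>auto simp: emeasure_lborel_Icc_eq\<close>)
      have "ennreal c * ennreal (indicator {0<..q} r * inverse r) = ennreal (r powr (-b-1)) * ennreal (c * r powr b)"
      proof -
        have "r powr (-b-1) * r powr b = inverse r"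
          using r by (simp add: powr_add[symmetric] powr_minus powr_one)
        then have "c * inverse r = r powr (-b-1) * (c * r powr b)" by (simp add: mult.left_commute)
        then show ?thesis using True c r by (simp add: ennreal_mult[symmetric] del: ennreal_mult'')
      qed
      also have "\<dots> \<le> ennreal (r powr (-b-1)) * ennreal (LINT s|lborel. indicator {0..T-r} s * \<bar>u (s + r) - u s\<bar>)"
        using neg[OF r] by (intro mult_left_mono ennreal_leI) auto
      also have "\<dots> = ennreal (r powr (-b-1)) * (\<integral>\<^sup>+s. ennreal (indicator {0..T-r} s * \<bar>u (s + r) - u s\<bar>) \<partial>lborel)"
        by (subst nn_integral_eq_integral[OF int]) auto
      also have "\<dots> = (\<integral>\<^sup>+s. ennreal (r powr (-b-1)) * ennreal (indicator {0..T-r} s * \<bar>u (s + r) - u s\<bar>) \<partial>lborel)"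
        by (rule nn_integral_cmult[symmetric]) simp
      also have "\<dots> = (\<integral>\<^sup>+s\<in>{0..T-r}. ennreal (\<bar>u (s + r) - u s\<bar> / (s + r - s) powr (b + 1)) \<partial>lborel)"
      proof (rule nn_integral_cong)
        fix s
        have "r powr (-b-1) = 1 / r powr (b + 1)" using powr_minus_divide[of r "b+1"] by simp
        then show "ennreal (r powr (-b-1)) * ennreal (indicator {0..T-r} s * \<bar>u (s + r) - u s\<bar>)
          = ennreal (\<bar>u (s + r) - u s\<bar> / (s + r - s) powr (b + 1)) * indicator {0..T-r} s"
          by (auto simp: indicator_def ennreal_mult[symmetric])
      qed
      finally show ?thesis using r by simp
    qed simp
  qed
  moreover have "(\<integral>\<^sup>+r. ennreal c * ennreal (indicator {0<..q} r * inverse r) \<partial>lborel) = \<infinity>"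
    using c by (subst nn_integral_cmult) (auto simp: nn_integral_inverse_near_0[OF q(1)] ennreal_mult_top)
  ultimately show False by simp
qed

text \<open>Slopes of a convex function increase. The slopes from \<open>z\<close> to
  \<open>x\<close> with \<open>z\<close> tending to \<open>x\<close> from the left dominate the
  slope from \<open>y\<close> to \<open>x\<close> when \<open>y < x\<close> and stay below it when
  \<open>x < y\<close>; both inequalities survive the limit.\<close>

lemma convex_left_derivative_subgradient:
  fixes f f' :: "real \<Rightarrow> real"
  assumes f: "convex_on UNIV f" and f': "\<And>x. (f has_real_derivative f' x) (at_left x)"
  shows "f' x * (y - x) \<le> f y - f x"
proof -
  have lim: "((\<lambda>z. (f z - f x) / (z - x)) \<longlongrightarrow> f' x) (at_left x)"
    using f'[of x] by (simp add: has_field_derivative_iff)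
  consider "y < x" | "y = x" | "x < y" by linarith
  then show ?thesis
  proof cases
    case 1
    have "eventually (\<lambda>z. (f y - f x) / (y - x) \<le> (f z - f x) / (z - x)) (at_left x)"
      using eventually_at_left_real[OF 1]
    proof eventually_elim
      case (elim z)
      then show ?case using convex_on_slope_le(2)[OF f, of y x z] by simp
    qed
    then have "(f y - f x) / (y - x) \<le> f' x"
      by (intro tendsto_lowerbound[OF lim]) simp_all
    then show ?thesis using 1 by (simp add: field_simps)
  next
    case 3
    have "eventually (\<lambda>z. (f z - f x) / (z - x) \<le> (f y - f x) / (y - x)) (at_left x)"
      using eventually_at_left_real[of "x - 1" x, simplified]
    proof eventually_elim
      case (elim z)
      then have "(f z - f x) / (z - x) \<le> (f z - f y) / (z - y)" "(f z - f y) / (z - y) \<le> (f x - f y) / (x - y)"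
        using convex_on_slope_le[OF f, of z y x] 3 by auto
      moreover have "(f x - f y) / (x - y) = (f y - f x) / (y - x)" using 3 by (simp add: field_simps)
      ultimately show ?case by linarith
    qed
    then have "f' x \<le> (f y - f x) / (y - x)"
      by (intro tendsto_upperbound[OF lim]) simp_all
    then show ?thesis using 3 by (simp add: field_simps)
  qed simp
qed

lemma convex_left_derivative_mono:
  fixes f f' :: "real \<Rightarrow> real"
  assumes "convex_on UNIV f" and "\<And>x. (f has_real_derivative f' x) (at_left x)"
  shows "mono f'"
proof (rule monoI)
  fix x y :: real assume "x \<le> y"
  have "f' x * (y - x) \<le> f y - f x" "f' y * (x - y) \<le> f x - f y"
    by (rule convex_left_derivative_subgradient[OF assms])+
  then have "f' x * (y - x) \<le> f' y * (y - x)" by (simp add: algebra_simps)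
  then show "f' x \<le> f' y" using \<open>x \<le> y\<close> by (cases "x = y") auto
qed

text \<open>The subgradient at \<open>x\<close> makes the remainder nonnegative, and the subgradient
  at \<open>y\<close> bounds it above by \<open>(f' y - f' x) * (y - x)\<close>. Continuity of
  \<open>f'\<close> does not enter.\<close>

lemma convex_left_derivative_remainder:
  fixes f f' :: "real \<Rightarrow> real"
  assumes "convex_on UNIV f" and "\<And>x. (f has_real_derivative f' x) (at_left x)"
  shows "\<bar>f y - f x - f' x * (y - x)\<bar> \<le> \<bar>f' y - f' x\<bar> * \<bar>y - x\<bar>"
proof -
  have "f' x * (y - x) \<le> f y - f x" "f' y * (x - y) \<le> f x - f y"
    by (rule convex_left_derivative_subgradient[OF assms])+
  then have "\<bar>f y - f x - f' x * (y - x)\<bar> \<le> (f' y - f' x) * (y - x)"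
    by (simp add: algebra_simps)
  also have "\<dots> \<le> \<bar>(f' y - f' x) * (y - x)\<bar>" by simp
  finally show ?thesis by (simp add: abs_mult)
qed

section \<open>Tangent-line bounds for the exponential function\<close>

lemma abs_exp_diff_le:
  fixes x y :: real
  assumes "x \<le> m" "y \<le> m"
  shows "\<bar>exp x - exp y\<bar> \<le> exp m * \<bar>x - y\<bar>"
proof -
  have *: "exp x - exp y \<le> exp m * \<bar>x - y\<bar>" if "x \<le> m" for x y :: real
  proof -
    have "exp x * (1 + (y - x)) \<le> exp x * exp (y - x)"
      by (intro mult_left_mono) (auto simp: exp_ge_add_one_self)
    then have "exp x - exp y \<le> exp x * (x - y)"
      by (simp add: algebra_simps flip: exp_add)
    also have "\<dots> \<le> exp x * \<bar>x - y\<bar>" by (intro mult_left_mono) auto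
    also have "\<dots> \<le> exp m * \<bar>x - y\<bar>" using that by (intro mult_right_mono) auto
    finally show ?thesis .
  qed
  from *[OF assms(1), of y] *[OF assms(2), of x] show ?thesis by (simp add: abs_le_iff abs_minus_commute)
qed

text \<open>The two-subgradient argument for convex functions, applied to \<open>exp\<close> as its
  own derivative, leaves \<open>(exp y - exp x) * (y - x)\<close>; the Lipschitz bound then gives
  the square.\<close>

lemma abs_exp_remainder_le:
  fixes x y :: real
  assumes "x \<le> m" "y \<le> m"
  shows "\<bar>exp y - exp x - exp x * (y - x)\<bar> \<le> exp m * (y - x)\<^sup>2"
proof -
  have 1: "exp x * (1 + (y - x)) \<le> exp x * exp (y - x)" "exp y * (1 + (x - y)) \<le> exp y * exp (x - y)"
    by (intro mult_left_mono; auto simp: exp_ge_add_one_self)+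
  then have "\<bar>exp y - exp x - exp x * (y - x)\<bar> \<le> (exp y - exp x) * (y - x)"
    by (simp add: algebra_simps flip: exp_add)
  also have "\<dots> \<le> \<bar>exp y - exp x\<bar> * \<bar>y - x\<bar>" by (metis abs_ge_self abs_mult)
  also have "\<dots> \<le> exp m * \<bar>y - x\<bar> * \<bar>y - x\<bar>"
    using abs_exp_diff_le[OF assms(2,1)] by (intro mult_right_mono) auto
  also have "\<dots> = exp m * (y - x)\<^sup>2" by (simp add: power2_eq_square)
  finally show ?thesis .
qed

text \<open>With a primitive \<open>P\<close> of \<open>Y\<close> the integral telescopes to two
  difference quotients of \<open>P\<close>, one at \<open>T\<close> and one at 0.\<close>

lemma steklov_difference_tendsto:
  fixes Y :: "real \<Rightarrow> real" and e :: "nat \<Rightarrow> real"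
  assumes Y: "continuous_on UNIV Y" and T: "0 < T"
    and e: "\<And>n. 0 < e n" "e \<longlonglongrightarrow> 0"
  shows "(\<lambda>n. LINT y|lborel. indicator {0..T} y * ((Y (y + e n) - Y y) / e n)) \<longlonglongrightarrow> Y T - Y 0"
proof -
  \<comment> \<open>Starting the primitive at -1 makes 0 an interior point, so that \<open>P\<close>
    has a two-sided derivative there.\<close>
  define P where "P x = integral {-1..x} Y" for x
  have P: "(P has_real_derivative Y x) (at x)" if "-1 < x" "x < T + 2" for x
  proof -
    have "(P has_real_derivative Y x) (at x within {-1..T+2})"
      unfolding P_def using that by (intro integral_has_real_derivative continuous_on_subset[OF Y]) auto
    moreover have "at x within {-1..T+2} = at x" using that by (intro at_within_interior) auto
    ultimately show ?thesis by simp
  qed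
  have int_shift: "(LINT y|lborel. indicator {0..T} y * Y (y + d)) = P (T + d) - P d" if d: "0 \<le> d" "d < 1" for d
  proof -
    have c: "continuous_on {0..T} (\<lambda>y. Y (y + d))"
      by (intro continuous_on_compose2[OF Y] continuous_intros) auto
    have "(LINT y|lborel. indicator {0..T} y * Y (y + d)) = integral {0..T} (\<lambda>y. Y (y + d))"
      using set_borel_integral_eq_integral(2)[OF borel_integrable_atLeastAtMost'[OF c]]
      by (simp add: set_lebesgue_integral_def)
    also have "((\<lambda>y. Y (y + d)) has_integral (P (T + d) - P (0 + d))) {0..T}"
    proof (rule fundamental_theorem_of_calculus)
      fix x assume x: "x \<in> {0..T}"
      have "((\<lambda>y. P (y + d)) has_real_derivative Y (x + d) * 1) (at x within {0..T})"
        by (rule DERIV_chain2[where f=P]) (use P[of "x + d"] x d in \<open>auto intro!: derivative_eq_intros\<close>)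
      then show "((\<lambda>y. P (y + d)) has_vector_derivative Y (x + d)) (at x within {0..T})"
        by (simp add: has_real_derivative_iff_has_vector_derivative)
    qed (use T in simp)
    then have "integral {0..T} (\<lambda>y. Y (y + d)) = P (T + d) - P d" by (simp add: integral_unique)
    finally show ?thesis .
  qed
  have int: "integrable lborel (\<lambda>y. indicator {0..T} y * Y (y + d))" for d
  proof -
    have "continuous_on {0..T} (\<lambda>y. Y (y + d))"
      by (intro continuous_on_compose2[OF Y] continuous_intros) auto
    from borel_integrable_atLeastAtMost'[OF this] show ?thesis by (simp add: set_integrable_def)
  qed
  have eq: "(LINT y|lborel. indicator {0..T} y * ((Y (y + d) - Y y) / d)) = (P (T + d) - P T) / d - (P (0 + d) - P 0) / d"
    if d: "0 < d" "d < 1" for d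
  proof -
    have "(LINT y|lborel. indicator {0..T} y * ((Y (y + d) - Y y) / d))
       = (LINT y|lborel. (indicator {0..T} y * Y (y + d) - indicator {0..T} y * Y (y + 0)) / d)"
      by (intro Bochner_Integration.integral_cong refl) (auto simp: indicator_def)
    also have "\<dots> = ((LINT y|lborel. indicator {0..T} y * Y (y + d)) - (LINT y|lborel. indicator {0..T} y * Y (y + 0))) / d"
      using int[of d] int[of 0] by simp
    finally show ?thesis
      unfolding int_shift[OF less_imp_le[OF d(1)] d(2)] using int_shift[of 0] by (simp add: diff_divide_distrib)
  qed
  have "filterlim e (at 0) sequentially"
    using e by (auto simp: filterlim_at intro!: always_eventually less_imp_neq[symmetric])
  then have "(\<lambda>n. (P (T + e n) - P T) / e n - (P (0 + e n) - P 0) / e n) \<longlonglongrightarrow> Y T - Y 0"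
    using P[of T] P[of 0] T unfolding DERIV_def by (intro tendsto_diff) (auto intro: filterlim_compose)
  moreover have "eventually (\<lambda>n. e n < 1) sequentially" using order_tendstoD(2)[OF e(2), of 1] by simp
  then have "eventually (\<lambda>n. (P (T + e n) - P T) / e n - (P (0 + e n) - P 0) / e n
      = (LINT y|lborel. indicator {0..T} y * ((Y (y + e n) - Y y) / e n))) sequentially"
    by eventually_elim (use eq e in auto)
  ultimately show ?thesis by (rule Lim_transform_eventually)
qed

section \<open>Pathwise expansion of the averaged process along a Hoelder path\<close>

locale hoelder_path =
  fixes T \<gamma> K :: real and B :: "real \<Rightarrow> real"
  assumes T_pos: "0 < T" and \<gamma>: "1 / 2 < \<gamma>" "\<gamma> < 1"
    and B_Hoelder: "\<And>s t. 0 \<le> s \<Longrightarrow> s \<le> t \<Longrightarrow> t \<le> T \<Longrightarrow> \<bar>B t - B s\<bar> \<le> K * (t - s) powr \<gamma>"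
begin

definition w :: "real \<Rightarrow> real" where "w s = (T - s) / T * exp (B s)"
definition X :: "real \<Rightarrow> real" where "X s = w s + 1 / T * integral {0..s} (\<lambda>u. exp (B u))"
definition bnd :: real where "bnd = exp (\<bar>B 0\<bar> + K * T powr \<gamma>)"
text \<open>The projection onto \<open>{0..T}\<close>. Composition with it extends paths to the
  whole line, continuous and constant outside, which is the form the forward-limit lemmas ask
  for.\<close>

definition clip :: "real \<Rightarrow> real" where "clip x = max 0 (min x T)"

lemma K_nonneg: "0 \<le> K"
proof -
  have "0 \<le> K * T powr \<gamma>" using B_Hoelder[of 0 T] T_pos by (simp add: order_trans[OF abs_ge_zero])
  then show ?thesis using T_pos by (simp add: zero_le_mult_iff)
qed

lemma B_le: "0 \<le> s \<Longrightarrow> s \<le> T \<Longrightarrow> \<bar>B s\<bar> \<le> \<bar>B 0\<bar> + K * T powr \<gamma>"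
proof -
  assume s: "0 \<le> s" "s \<le> T"
  have "K * (s - 0) powr \<gamma> \<le> K * T powr \<gamma>"
    using s \<gamma> K_nonneg by (intro mult_left_mono powr_mono2) auto
  then show ?thesis using B_Hoelder[of 0 s] s by linarith
qed

lemma bnd_pos: "0 < bnd" by (simp add: bnd_def)

lemma exp_B_le: "0 \<le> s \<Longrightarrow> s \<le> T \<Longrightarrow> exp (B s) \<le> bnd"
  using B_le[of s] by (simp add: bnd_def abs_le_iff)

lemma exp_B_diff: "0 \<le> s \<Longrightarrow> s \<le> t \<Longrightarrow> t \<le> T \<Longrightarrow> \<bar>exp (B t) - exp (B s)\<bar> \<le> bnd * (K * (t - s) powr \<gamma>)"
proof -
  assume st: "0 \<le> s" "s \<le> t" "t \<le> T"
  have "\<bar>exp (B t) - exp (B s)\<bar> \<le> bnd * \<bar>B t - B s\<bar>"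
    unfolding bnd_def using B_le[of s] B_le[of t] st by (intro abs_exp_diff_le) auto
  also have "\<dots> \<le> bnd * (K * (t - s) powr \<gamma>)"
    using B_Hoelder[OF st] bnd_pos by (intro mult_left_mono) auto
  finally show ?thesis .
qed

lemma continuous_on_B: "continuous_on {0..T} B"
  unfolding continuous_on_def
proof
  fix x assume x: "x \<in> {0..T}"
  have "((\<lambda>y. \<bar>y - x\<bar> powr \<gamma>) \<longlongrightarrow> \<bar>x - x\<bar> powr \<gamma>) (at x within {0..T})"
    using \<gamma> by (intro tendsto_powr2 tendsto_intros) (auto intro!: always_eventually)
  then have "((\<lambda>y. K * \<bar>y - x\<bar> powr \<gamma>) \<longlongrightarrow> K * 0) (at x within {0..T})"
    by (intro tendsto_mult tendsto_const) simp
  then have lim: "((\<lambda>y. K * \<bar>y - x\<bar> powr \<gamma>) \<longlongrightarrow> 0) (at x within {0..T})" by simp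
  have "\<bar>B y - B x\<bar> \<le> K * \<bar>y - x\<bar> powr \<gamma>" if "y \<in> {0..T}" for y
    using B_Hoelder[of x y] B_Hoelder[of y x] x that by (cases "x \<le> y") (auto simp: abs_minus_commute)
  then have "eventually (\<lambda>y. norm (B y - B x) \<le> K * \<bar>y - x\<bar> powr \<gamma>) (at x within {0..T})"
    by (auto simp: eventually_at_filter)
  then have "((\<lambda>y. B y - B x) \<longlongrightarrow> 0) (at x within {0..T})"
    using lim by (rule Lim_null_comparison)
  then show "(B \<longlongrightarrow> B x) (at x within {0..T})" by (simp add: LIM_zero_cancel)
qed

lemma w_bounds: "0 \<le> s \<Longrightarrow> s \<le> T \<Longrightarrow> 0 \<le> w s" "0 \<le> s \<Longrightarrow> s \<le> T \<Longrightarrow> w s \<le> bnd"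
proof -
  assume s: "0 \<le> s" "s \<le> T"
  show "0 \<le> w s" using s T_pos by (simp add: w_def)
  have "(T - s) / T * exp (B s) \<le> 1 * bnd"
    using s T_pos exp_B_le[OF s] by (intro mult_mono) auto
  then show "w s \<le> bnd" by (simp add: w_def)
qed

text \<open>For \<open>d / T \<le> 1\<close> a smaller exponent increases the power. This absorbs
  terms linear in the time step into the Hoelder scale.\<close>

lemma frac_le_powr: "0 \<le> d \<Longrightarrow> d \<le> T \<Longrightarrow> d / T \<le> T powr (-\<gamma>) * d powr \<gamma>"
proof -
  assume d: "0 \<le> d" "d \<le> T"
  have "(d / T) powr 1 \<le> (d / T) powr \<gamma>"
    using d T_pos \<gamma> by (intro powr_mono') auto
  then show ?thesis using d T_pos by (simp add: powr_divide powr_minus_divide)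
qed

definition Cw :: real where "Cw = bnd * K + T powr (-\<gamma>) * bnd"

lemma w_Hoelder:
  assumes st: "0 \<le> s" "s \<le> t" "t \<le> T"
  shows "\<bar>w t - w s\<bar> \<le> Cw * (t - s) powr \<gamma>"
proof -
  have "w t - w s = (T - t) / T * (exp (B t) - exp (B s)) - (t - s) / T * exp (B s)"
    using T_pos by (simp add: w_def field_simps)
  also have "\<bar>\<dots>\<bar> \<le> \<bar>(T - t) / T * (exp (B t) - exp (B s))\<bar> + \<bar>(t - s) / T * exp (B s)\<bar>"
    by (rule abs_triangle_ineq4)
  also have "\<dots> \<le> 1 * (bnd * (K * (t - s) powr \<gamma>)) + T powr (-\<gamma>) * (t - s) powr \<gamma> * bnd"
  proof (rule add_mono)
    show "\<bar>(T - t) / T * (exp (B t) - exp (B s))\<bar> \<le> 1 * (bnd * (K * (t - s) powr \<gamma>))"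
      unfolding abs_mult using st T_pos exp_B_diff[OF st] by (intro mult_mono) auto
    show "\<bar>(t - s) / T * exp (B s)\<bar> \<le> T powr (-\<gamma>) * (t - s) powr \<gamma> * bnd"
      unfolding abs_mult using st T_pos exp_B_le[of s] frac_le_powr[of "t - s"] by (intro mult_mono) auto
  qed
  also have "\<dots> = Cw * (t - s) powr \<gamma>" by (simp add: Cw_def algebra_simps)
  finally show ?thesis .
qed

text \<open>The first summand is the second-order remainder of \<open>exp\<close>, the second the
  variation of \<open>exp (B u)\<close> inside the average, with one linear factor
  \<open>(t - s) / T\<close> lowered to the Hoelder scale.\<close>

definition CX :: real where "CX = bnd * K\<^sup>2 + T powr (-\<gamma>) * (bnd * K)"

lemma CX_nonneg: "0 \<le> CX"
  using bnd_pos K_nonneg by (simp add: CX_def)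

text \<open>The factor \<open>T - s\<close> is tuned to the average: what its decrease removes,
  \<open>(t - s) / T * exp (B t)\<close>, is nearly what the average gains,
  \<open>(t - s) / T * exp (B z)\<close> for an intermediate time \<open>z\<close>. The difference
  has order \<open>1 + \<gamma>\<close>, better than \<open>2 * \<gamma>\<close>, and only
  \<open>(T - s) / T\<close> times the increment of \<open>exp (B u)\<close> remains at first
  order.\<close>

lemma X_expansion:
  assumes st: "0 \<le> s" "s \<le> t" "t \<le> T"
  shows "\<bar>X t - X s - w s * (B t - B s)\<bar> \<le> CX * (t - s) powr (2 * \<gamma>)"
proof (cases "s = t")
  case False
  with st have "s < t" by simp
  have S: "continuous_on {0..T} (\<lambda>u. exp (B u))" by (intro continuous_intros continuous_on_B)
  have "\<exists>z\<in>{s<..<t}. integral {0..t} (\<lambda>u. exp (B u)) - integral {0..s} (\<lambda>u. exp (B u)) = exp (B z) * (t - s)"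
  proof (rule mvt_simple[OF \<open>s < t\<close>])
    fix x assume "s \<le> x" "x \<le> t"
    then have "((\<lambda>x. integral {0..x} (\<lambda>u. exp (B u))) has_real_derivative exp (B x)) (at x within {0..T})"
      using st by (intro integral_has_real_derivative[OF S]) auto
    then have "((\<lambda>x. integral {0..x} (\<lambda>u. exp (B u))) has_real_derivative exp (B x)) (at x within {s..t})"
      by (rule has_field_derivative_subset) (use st in auto)
    then show "((\<lambda>x. integral {0..x} (\<lambda>u. exp (B u))) has_derivative (\<lambda>h. exp (B x) * h)) (at x within {s..t})"
      by (simp add: has_field_derivative_def)
  qed
  then obtain z where z: "s < z" "z < t" "integral {0..t} (\<lambda>u. exp (B u)) - integral {0..s} (\<lambda>u. exp (B u)) = (t - s) * exp (B z)"
    by (auto simp: mult.commute)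
  have "X t - X s = w t - w s + 1 / T * ((t - s) * exp (B z))"
    unfolding z(3)[symmetric] X_def by (simp add: algebra_simps)
  then have "X t - X s - w s * (B t - B s) = (T - s) / T * (exp (B t) - exp (B s) - exp (B s) * (B t - B s)) + (t - s) / T * (exp (B z) - exp (B t))"
    using T_pos by (simp add: w_def field_simps)
  also have "\<bar>\<dots>\<bar> \<le> \<bar>(T - s) / T * (exp (B t) - exp (B s) - exp (B s) * (B t - B s))\<bar> + \<bar>(t - s) / T * (exp (B z) - exp (B t))\<bar>"
    by (rule abs_triangle_ineq)
  also have "\<dots> \<le> 1 * (bnd * (K * (t - s) powr \<gamma>)\<^sup>2) + T powr (-\<gamma>) * (t - s) powr \<gamma> * (bnd * (K * (t - s) powr \<gamma>))"
  proof (rule add_mono)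
    have "\<bar>exp (B t) - exp (B s) - exp (B s) * (B t - B s)\<bar> \<le> bnd * (B t - B s)\<^sup>2"
      unfolding bnd_def using B_le[of s] B_le[of t] st by (intro abs_exp_remainder_le) auto
    also have "\<dots> \<le> bnd * (K * (t - s) powr \<gamma>)\<^sup>2"
      using B_Hoelder[OF st] bnd_pos by (intro mult_left_mono) (auto simp: abs_le_square_iff[symmetric])
    finally show "\<bar>(T - s) / T * (exp (B t) - exp (B s) - exp (B s) * (B t - B s))\<bar> \<le> 1 * (bnd * (K * (t - s) powr \<gamma>)\<^sup>2)"
      unfolding abs_mult using st T_pos by (intro mult_mono) auto
    have "\<bar>exp (B z) - exp (B t)\<bar> \<le> bnd * (K * (t - z) powr \<gamma>)"
      using exp_B_diff[of z t] z st by (simp add: abs_minus_commute)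
    also have "\<dots> \<le> bnd * (K * (t - s) powr \<gamma>)"
      using z \<gamma> bnd_pos K_nonneg by (intro mult_left_mono powr_mono2) auto
    finally show "\<bar>(t - s) / T * (exp (B z) - exp (B t))\<bar> \<le> T powr (-\<gamma>) * (t - s) powr \<gamma> * (bnd * (K * (t - s) powr \<gamma>))"
      unfolding abs_mult using st T_pos frac_le_powr[of "t - s"] by (intro mult_mono) auto
  qed
  also have "\<dots> = CX * ((t - s) powr \<gamma> * (t - s) powr \<gamma>)"
    by (simp add: CX_def power2_eq_square algebra_simps)
  also have "(t - s) powr \<gamma> * (t - s) powr \<gamma> = (t - s) powr (2 * \<gamma>)"
    unfolding powr_add[symmetric] by simp
  finally show ?thesis .
qed simp

definition DX :: real where "DX = bnd * K + CX * T powr \<gamma>"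

lemma X_Hoelder:
  assumes st: "0 \<le> s" "s \<le> t" "t \<le> T"
  shows "\<bar>X t - X s\<bar> \<le> DX * (t - s) powr \<gamma>"
proof -
  have "\<bar>X t - X s\<bar> \<le> \<bar>w s * (B t - B s)\<bar> + \<bar>X t - X s - w s * (B t - B s)\<bar>" by linarith
  also have "\<dots> \<le> bnd * (K * (t - s) powr \<gamma>) + CX * (t - s) powr (2 * \<gamma>)"
  proof (rule add_mono[OF _ X_expansion[OF st]])
    show "\<bar>w s * (B t - B s)\<bar> \<le> bnd * (K * (t - s) powr \<gamma>)"
      unfolding abs_mult using w_bounds[of s] B_Hoelder[OF st] st bnd_pos by (intro mult_mono) auto
  qed
  also have "(t - s) powr (2 * \<gamma>) = (t - s) powr \<gamma> * (t - s) powr \<gamma>"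
    unfolding powr_add[symmetric] by simp
  also have "bnd * (K * (t - s) powr \<gamma>) + CX * ((t - s) powr \<gamma> * (t - s) powr \<gamma>) \<le> bnd * (K * (t - s) powr \<gamma>) + CX * (T powr \<gamma> * (t - s) powr \<gamma>)"
    using st \<gamma> CX_nonneg by (intro add_left_mono mult_left_mono mult_right_mono powr_mono2) auto
  finally show ?thesis by (simp add: DX_def algebra_simps)
qed

end

section \<open>Change of variables along a single path\<close>

context hoelder_path
begin

lemma continuous_on_w: "continuous_on {0..T} w"
  unfolding w_def using T_pos by (intro continuous_intros continuous_on_B) auto

lemma continuous_on_X: "continuous_on {0..T} X"
proof -
  have "(\<lambda>u. exp (B u)) integrable_on {0..T}"
    by (intro integrable_continuous_real continuous_intros continuous_on_B)
  then show ?thesis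
    unfolding X_def by (intro continuous_intros continuous_on_w indefinite_integral_continuous_1)
qed

lemma clip: "clip x \<in> {0..T}" "0 \<le> x \<Longrightarrow> x \<le> T \<Longrightarrow> clip x = x" "T \<le> x \<Longrightarrow> clip x = T"
  using T_pos by (auto simp: clip_def)

lemma continuous_on_comp_clip: "continuous_on {0..T} f \<Longrightarrow> continuous_on UNIV (\<lambda>x. f (clip x))"
  by (rule continuous_on_compose2[of "{0..T}"]) (use T_pos in \<open>auto simp: clip_def intro!: continuous_intros\<close>)

text \<open>Forward integrals along any null sequence converge to the generalized integral, so one
  well-chosen sequence suffices to compute it, for all admissible exponents at once.\<close>

lemma has_gls_integral_convex:
  fixes f f' \<phi> :: "real \<Rightarrow> real"
  assumes f: "convex_on UNIV f" and f': "\<And>x. (f has_real_derivative f' x) (at_left x)"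
    and \<phi>: "\<And>s. 0 \<le> s \<Longrightarrow> s \<le> T \<Longrightarrow> \<phi> s = f' (X s) * w s"
    and reg: "\<phi> \<in> besov2 T (1 - \<gamma>)" and B: "B \<in> besov1 T \<gamma>"
  shows "has_gls_integral T \<phi> B T (f (X T) - f (X 0))"
proof -
  define u where "u x = f' (X (clip x)) * w (clip x)" for x
  define h where "h x = B (clip x)" for x
  define Y where "Y x = f (X (clip x))" for x
  have [measurable]: "f' \<in> borel_measurable borel"
    by (intro borel_measurable_mono convex_left_derivative_mono[OF f f'])
  have [measurable]: "(\<lambda>x. X (clip x)) \<in> borel_measurable borel" "(\<lambda>x. w (clip x)) \<in> borel_measurable borel"
    by (intro borel_measurable_continuous_onI continuous_on_comp_clip continuous_on_X continuous_on_w)+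
  have u_meas[measurable]: "u \<in> borel_measurable borel" unfolding u_def by measurable
  have h_cont: "continuous_on UNIV h" unfolding h_def by (intro continuous_on_comp_clip continuous_on_B)
  have Y_cont: "continuous_on UNIV Y"
    unfolding Y_def
    by (intro continuous_on_comp_clip continuous_on_compose2[OF convex_on_continuous[OF open_UNIV f]] continuous_on_X) auto
  obtain R where "\<forall>x\<in>X ` {0..T}. norm x \<le> R"
    using compact_imp_bounded[OF compact_continuous_image[OF continuous_on_X compact_Icc]] bounded_iff by blast
  then have R: "\<bar>X s\<bar> \<le> R" if "s \<in> {0..T}" for s using that by simp
  define L where "L = max \<bar>f' R\<bar> \<bar>f' (-R)\<bar>"
  have f'_bd: "\<bar>f' (X s)\<bar> \<le> L" if "s \<in> {0..T}" for s
  proof -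
    have "f' (-R) \<le> f' (X s)" "f' (X s) \<le> f' R"
      using R[OF that] by (auto intro!: monoD[OF convex_left_derivative_mono[OF f f']])
    then show ?thesis unfolding L_def by linarith
  qed
  have L0: "0 \<le> L" by (simp add: L_def)
  have u_bd: "\<bar>u x\<bar> \<le> L * bnd" for x
    unfolding u_def abs_mult using f'_bd[of "clip x"] w_bounds[of "clip x"] clip(1)[of x] L0
    by (intro mult_mono) auto
  have h_bd: "\<bar>h x\<bar> \<le> \<bar>B 0\<bar> + K * T powr \<gamma>" for x
    unfolding h_def using B_le[of "clip x"] clip(1)[of x] by auto
  have \<phi>u: "\<phi> x = u x" and Bh: "B x = h x" if "0 \<le> x" "x \<le> T" for x
    using that by (auto simp: u_def h_def clip \<phi>)
  have hT: "h x = h T" if "T \<le> x" for x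
    using that T_pos by (auto simp: h_def clip)
  \<comment> \<open>Of the three copies of \<open>L * CX\<close>, two come from the difference of
    \<open>f'\<close> multiplied by the remainder of \<open>X\<close>, and one from replacing the
    increment of \<open>X\<close> by \<open>w s * (B t - B s)\<close>. The term
    \<open>K * L * Cw\<close> pays for the increment of \<open>w\<close> in passing from
    \<open>f'\<close> to \<open>\<phi>\<close>.\<close>
  define C where "C = 3 * L * CX + K * L * Cw"
  have Cw0: "0 \<le> Cw" using bnd_pos K_nonneg by (simp add: Cw_def)
  have C0: "0 \<le> C" using L0 CX_nonneg K_nonneg Cw0 by (simp add: C_def)
  have local_error: "\<bar>f (X t) - f (X s) - \<phi> s * (B t - B s)\<bar> \<le> K * (t - s) powr \<gamma> * \<bar>\<phi> t - \<phi> s\<bar> + C * (t - s) powr (2 * \<gamma>)"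
    if st: "0 \<le> s" "s \<le> t" "t \<le> T" for s t
  proof -
    define d where "d = (t - s) powr \<gamma>"
    have d0: "0 \<le> d" by (simp add: d_def)
    have d2: "(t - s) powr (2 * \<gamma>) = d * d"
      unfolding d_def powr_add[symmetric] by simp
    have bd: "\<bar>f' (X t)\<bar> \<le> L" "\<bar>f' (X s)\<bar> \<le> L" using st by (auto intro!: f'_bd)
    have w0: "0 \<le> w s" using st w_bounds by auto
    have exp: "\<bar>X t - X s - w s * (B t - B s)\<bar> \<le> CX * (d * d)" using X_expansion[OF st] by (simp add: d2)
    have Bd: "\<bar>B t - B s\<bar> \<le> K * d" using B_Hoelder[OF st] by (simp add: d_def)
    have 1: "\<bar>f (X t) - f (X s) - f' (X s) * (X t - X s)\<bar> \<le> \<bar>f' (X t) - f' (X s)\<bar> * \<bar>X t - X s\<bar>"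
      by (rule convex_left_derivative_remainder[OF f f'])
    have 2: "\<bar>f' (X s) * (X t - X s - w s * (B t - B s))\<bar> \<le> L * (CX * (d * d))"
      unfolding abs_mult using bd exp L0 by (intro mult_mono) auto
    have 3: "\<bar>X t - X s\<bar> \<le> w s * (K * d) + CX * (d * d)"
    proof -
      have "\<bar>w s * (B t - B s)\<bar> \<le> w s * (K * d)"
        unfolding abs_mult using w0 Bd by (simp add: mult_left_mono)
      then show ?thesis using exp by linarith
    qed
    \<comment> \<open>The factor \<open>w s\<close> is supplied by the increment of
      \<open>X\<close>, so only this product has to be controlled. It is an increment of
      \<open>\<phi>\<close> up to a Hoelder increment of \<open>w\<close>; no lower bound on
      \<open>w\<close> is involved.\<close>
    have 4: "\<bar>f' (X t) - f' (X s)\<bar> * w s \<le> \<bar>\<phi> t - \<phi> s\<bar> + L * (Cw * d)"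
    proof -
      have "\<bar>f' (X t) - f' (X s)\<bar> * w s = \<bar>(f' (X t) - f' (X s)) * w s\<bar>" using w0 by (simp add: abs_mult)
      also have "(f' (X t) - f' (X s)) * w s = (\<phi> t - \<phi> s) - f' (X t) * (w t - w s)"
        using \<phi>[of s] \<phi>[of t] st by (simp add: algebra_simps)
      also have "\<bar>\<dots>\<bar> \<le> \<bar>\<phi> t - \<phi> s\<bar> + \<bar>f' (X t) * (w t - w s)\<bar>" by (rule abs_triangle_ineq4)
      also have "\<bar>f' (X t) * (w t - w s)\<bar> \<le> L * (Cw * d)"
        unfolding abs_mult using bd w_Hoelder[OF st] L0 by (intro mult_mono) (auto simp: d_def)
      finally show ?thesis by simp
    qed
    have 5: "\<bar>f' (X t) - f' (X s)\<bar> * (CX * (d * d)) \<le> 2 * L * (CX * (d * d))"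
      using bd CX_nonneg d0 by (intro mult_right_mono) auto
    have "\<bar>f' (X t) - f' (X s)\<bar> * \<bar>X t - X s\<bar> \<le> \<bar>f' (X t) - f' (X s)\<bar> * (w s * (K * d) + CX * (d * d))"
      using 3 by (intro mult_left_mono) auto
    also have "\<dots> = (\<bar>f' (X t) - f' (X s)\<bar> * w s) * (K * d) + \<bar>f' (X t) - f' (X s)\<bar> * (CX * (d * d))"
      by (simp add: algebra_simps)
    also have "\<dots> \<le> (\<bar>\<phi> t - \<phi> s\<bar> + L * (Cw * d)) * (K * d) + 2 * L * (CX * (d * d))"
      by (rule add_mono[OF mult_right_mono[OF 4] 5]) (use K_nonneg d0 in simp)
    finally have 6: "\<bar>f' (X t) - f' (X s)\<bar> * \<bar>X t - X s\<bar> \<le> \<dots>" .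
    have "f (X t) - f (X s) - \<phi> s * (B t - B s) = (f (X t) - f (X s) - f' (X s) * (X t - X s)) + f' (X s) * (X t - X s - w s * (B t - B s))"
      using \<phi>[of s] st by (simp add: algebra_simps)
    then have "\<bar>f (X t) - f (X s) - \<phi> s * (B t - B s)\<bar> \<le> (\<bar>\<phi> t - \<phi> s\<bar> + L * (Cw * d)) * (K * d) + 2 * L * (CX * (d * d)) + L * (CX * (d * d))"
      using 1 2 6 by linarith
    also have "\<dots> = K * d * \<bar>\<phi> t - \<phi> s\<bar> + C * (d * d)" by (simp add: C_def algebra_simps)
    finally show ?thesis unfolding d2 d_def .
  qed
  have fin: "(\<integral>\<^sup>+t\<in>{0..T}. (\<integral>\<^sup>+s\<in>{0..t}. ennreal (\<bar>u t - u s\<bar> / (t - s) powr ((1 - \<gamma>) + 1)) \<partial>lborel) \<partial>lborel) < \<infinity>"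
    by (rule besov2_double_integral_finite[OF reg]) (rule \<phi>u)
  \<comment> \<open>The power \<open>1 - \<gamma>\<close> is dictated by the local error:
    \<open>K * r powr \<gamma> / r\<close> times the increment integral is then at most
    \<open>K / Suc n\<close>.\<close>
  define P where "P n r \<longleftrightarrow> 0 < r \<and> r < 1 / real (Suc n) \<and> r < T \<and>
    (LINT s|lborel. indicator {0..T-r} s * \<bar>u (s + r) - u s\<bar>) < 1 / real (Suc n) * r powr (1 - \<gamma>)" for n r
  have "\<exists>r. P n r" for n
  proof -
    have "0 < 1 / real (Suc n)" by simp
    from besov2_small_increment[OF u_meas u_bd T_pos this this fin]
    show ?thesis unfolding P_def by blast
  qed
  then obtain e where P: "P n (e n)" for n by metis
  then have e: "\<And>n. 0 < e n" "\<And>n. e n < 1 / real (Suc n)" "\<And>n. e n < T"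
    "\<And>n. (LINT s|lborel. indicator {0..T-e n} s * \<bar>u (s + e n) - u s\<bar>) < 1 / real (Suc n) * e n powr (1 - \<gamma>)"
    unfolding P_def by blast+
  have lim_n: "(\<lambda>n. 1 / real (Suc n)) \<longlonglongrightarrow> 0" by (rule LIMSEQ_Suc[OF lim_1_over_n])
  have e0: "e \<longlonglongrightarrow> 0"
    by (rule tendsto_sandwich[OF _ _ tendsto_const lim_n]) (use e in \<open>auto intro!: always_eventually less_imp_le\<close>)
  define J where "J n = (LINT y|lborel. indicator {0..T} y * (u y * ((h (y + e n) - h y) / e n)))" for n
  define I where "I n = (LINT y|lborel. indicator {0..T} y * ((Y (y + e n) - Y y) / e n))" for n
  have I_lim: "I \<longlonglongrightarrow> Y T - Y 0"
    unfolding I_def using Y_cont T_pos e(1) e0 by (rule steklov_difference_tendsto)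
  have IJ: "\<bar>I n - J n\<bar> \<le> K * (1 / real (Suc n)) + 2 * (L * bnd) * K * e n powr \<gamma> + C * T * e n powr (2 * \<gamma> - 1)" for n
  proof -
    define r where "r = e n"
    have r: "0 < r" "r < T" using e by (auto simp: r_def)
    have [measurable]: "h \<in> borel_measurable borel" "Y \<in> borel_measurable borel"
      using h_cont Y_cont by (auto intro: borel_measurable_continuous_onI)
    have bdd_int: "integrable lborel (\<lambda>y. indicator {0..T} y * v y)"
      if [measurable]: "v \<in> borel_measurable borel" and v: "\<And>y. y \<in> {0..T} \<Longrightarrow> \<bar>v y\<bar> \<le> M" for v and M :: real
      by (rule integrableI_bounded_set[where A="{0..T}" and B=M])
        (use v in \<open>auto simp: emeasure_lborel_Icc_eq indicator_def\<close>)
    obtain MY where MY: "\<And>y. \<bar>Y y\<bar> \<le> MY"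
    proof -
      have "continuous_on {0..T} (\<lambda>s. f (X s))"
        by (intro continuous_on_compose2[OF convex_on_continuous[OF open_UNIV f]] continuous_on_X) auto
      from compact_imp_bounded[OF compact_continuous_image[OF this compact_Icc]]
      obtain M where "\<forall>x\<in>(\<lambda>s. f (X s)) ` {0..T}. norm x \<le> M" using bounded_iff by blast
      then have "\<bar>Y y\<bar> \<le> M" for y using clip(1)[of y] by (simp add: Y_def)
      then show ?thesis by (rule that)
    qed
    have intI: "integrable lborel (\<lambda>y. indicator {0..T} y * ((Y (y + r) - Y y) / r))"
    proof (rule bdd_int)
      fix y show "\<bar>(Y (y + r) - Y y) / r\<bar> \<le> 2 * MY / r"
        using r MY[of y] MY[of "y + r"] by (simp add: abs_le_iff divide_right_mono)
    qed simp
    have intJ: "integrable lborel (\<lambda>y. indicator {0..T} y * (u y * ((h (y + r) - h y) / r)))"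
    proof (rule bdd_int)
      fix y
      have "\<bar>(h (y + r) - h y) / r\<bar> \<le> 2 * (\<bar>B 0\<bar> + K * T powr \<gamma>) / r"
        using r h_bd[of y] h_bd[of "y + r"] by (simp add: abs_le_iff divide_right_mono)
      then show "\<bar>u y * ((h (y + r) - h y) / r)\<bar> \<le> L * bnd * (2 * (\<bar>B 0\<bar> + K * T powr \<gamma>) / r)"
        unfolding abs_mult using u_bd[of y] L0 bnd_pos by (intro mult_mono) auto
    qed simp
    have du: "\<bar>u (y + r) - u y\<bar> \<le> 2 * (L * bnd)" for y
      using u_bd[of y] u_bd[of "y + r"] by linarith
    have intD: "integrable lborel (\<lambda>y. indicator {0..T-r} y * \<bar>u (y + r) - u y\<bar>)"
      by (rule integrableI_bounded_set[where A="{0..T-r}" and B="2 * (L * bnd)"])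
        (use du r in \<open>auto simp: emeasure_lborel_Icc_eq indicator_def\<close>)
    have abs_integral_le: "\<bar>LINT x|lborel. f1 x\<bar> \<le> (LINT x|lborel. g1 x)"
      if "integrable lborel f1" "integrable lborel g1" "\<And>x. \<bar>f1 x\<bar> \<le> g1 x" for f1 g1 :: "real \<Rightarrow> real"
      using Bochner_Integration.integral_norm_bound_integral[OF that(1,2)] that(3) by simp
    define D where "D = (LINT y|lborel. indicator {0..T-r} y * \<bar>u (y + r) - u y\<bar>)"
    have D: "D < 1 / real (Suc n) * r powr (1 - \<gamma>)" using e(4)[of n] by (simp add: D_def r_def)
    \<comment> \<open>On \<open>{0..T-r}\<close> the increments of \<open>u\<close> are kept, to be
      controlled in L1. On the strip \<open>{T-r..T}\<close>, where \<open>y + r\<close> leaves the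
      time interval, only their supremum is used, but the strip has length \<open>r\<close>. The
      last term is the second-order error.\<close>
    let ?bound = "\<lambda>y. K * r powr \<gamma> / r * (indicator {0..T-r} y * \<bar>u (y + r) - u y\<bar>)
       + K * r powr \<gamma> / r * (2 * (L * bnd)) * indicator {T-r..T} y + C * r powr (2 * \<gamma>) / r * indicator {0..T} y"
    have "\<bar>I n - J n\<bar> = \<bar>LINT y|lborel. indicator {0..T} y * ((Y (y + r) - Y y) / r) - indicator {0..T} y * (u y * ((h (y + r) - h y) / r))\<bar>"
      unfolding I_def J_def using intI intJ by (simp add: r_def)
    also have "\<dots> \<le> (LINT y|lborel. ?bound y)"
    proof (rule abs_integral_le)
      show "integrable lborel (\<lambda>y. indicator {0..T} y * ((Y (y + r) - Y y) / r) - indicator {0..T} y * (u y * ((h (y + r) - h y) / r)))"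
        using intI intJ by (rule Bochner_Integration.integrable_diff)
      show "integrable lborel ?bound"
        using intD by (intro Bochner_Integration.integrable_add integrable_mult_right) (auto simp: emeasure_lborel_Icc_eq)
      fix y :: real
      show "\<bar>indicator {0..T} y * ((Y (y + r) - Y y) / r) - indicator {0..T} y * (u y * ((h (y + r) - h y) / r))\<bar> \<le> ?bound y"
      proof (cases "y \<in> {0..T}")
        case True
        define t where "t = clip (y + r)"
        have t: "0 \<le> y" "y \<le> t" "t \<le> T" "t - y \<le> r" using True r by (auto simp: t_def clip_def)
        have "\<bar>(Y (y + r) - Y y) / r - u y * ((h (y + r) - h y) / r)\<bar> = \<bar>f (X t) - f (X y) - \<phi> y * (B t - B y)\<bar> / r"
          using True r \<phi>[of y] by (simp add: Y_def u_def h_def t_def clip diff_divide_distrib[symmetric] abs_divide)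
        also have "\<dots> \<le> (K * (t - y) powr \<gamma> * \<bar>\<phi> t - \<phi> y\<bar> + C * (t - y) powr (2 * \<gamma>)) / r"
          using local_error[OF t(1-3)] r by (intro divide_right_mono) auto
        also have "\<dots> \<le> (K * r powr \<gamma> * \<bar>\<phi> t - \<phi> y\<bar> + C * r powr (2 * \<gamma>)) / r"
          using t r K_nonneg C0 \<gamma> by (intro divide_right_mono add_mono mult_left_mono mult_right_mono powr_mono2) auto
        also have "\<bar>\<phi> t - \<phi> y\<bar> = \<bar>u (y + r) - u y\<bar>"
          using True \<phi>[of y] \<phi>[of t] t by (simp add: u_def t_def clip)
        also have "(K * r powr \<gamma> * \<bar>u (y + r) - u y\<bar> + C * r powr (2 * \<gamma>)) / r = K * r powr \<gamma> / r * \<bar>u (y + r) - u y\<bar> + C * r powr (2 * \<gamma>) / r"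
          by (simp add: add_divide_distrib)
        also have "\<dots> \<le> ?bound y"
        proof (cases "y \<in> {0..T-r}")
          case True2: True
          have "0 \<le> K * r powr \<gamma> / r * (2 * (L * bnd)) * indicator {T-r..T} y"
            using K_nonneg r L0 bnd_pos by simp
          then show ?thesis using True True2 by simp
        next
          case False
          have "K * r powr \<gamma> / r * \<bar>u (y + r) - u y\<bar> \<le> K * r powr \<gamma> / r * (2 * (L * bnd))"
            using du[of y] K_nonneg r by (intro mult_left_mono) auto
          then show ?thesis using True False by simp
        qed
        finally show ?thesis using True by simp
      next
        case False
        have "0 \<le> K * r powr \<gamma> / r * (indicator {0..T-r} y * \<bar>u (y + r) - u y\<bar>)"
          "0 \<le> K * r powr \<gamma> / r * (2 * (L * bnd)) * indicator {T-r..T} y" "0 \<le> C * r powr (2 * \<gamma>) / r * indicator {0..T} y"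
          using K_nonneg r L0 bnd_pos C0 by auto
        with False show ?thesis by simp
      qed
    qed
    also have "\<dots> = K * r powr \<gamma> / r * D + K * r powr \<gamma> / r * (2 * (L * bnd)) * r + C * r powr (2 * \<gamma>) / r * T"
    proof -
      have "has_bochner_integral lborel ?bound (K * r powr \<gamma> / r * D + K * r powr \<gamma> / r * (2 * (L * bnd)) * r + C * r powr (2 * \<gamma>) / r * T)"
      proof (intro has_bochner_integral_add has_bochner_integral_mult_right)
        show "has_bochner_integral lborel (\<lambda>y. indicator {0..T-r} y * \<bar>u (y + r) - u y\<bar>) D"
          using intD by (simp add: has_bochner_integral_iff D_def)
        show "has_bochner_integral lborel (indicator {T-r..T} :: real \<Rightarrow> real) r"
          "has_bochner_integral lborel (indicator {0..T} :: real \<Rightarrow> real) T"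
          using r T_pos by (auto simp: has_bochner_integral_iff)
      qed
      then show ?thesis by (rule has_bochner_integral_integral_eq)
    qed
    also have "\<dots> \<le> K * (1 / real (Suc n)) + 2 * (L * bnd) * K * r powr \<gamma> + C * T * r powr (2 * \<gamma> - 1)"
    proof -
      have p: "r powr \<gamma> / r * r powr (1 - \<gamma>) = 1" "r powr (2 * \<gamma>) / r = r powr (2 * \<gamma> - 1)"
        using r by (simp_all add: powr_diff)
      have "K * r powr \<gamma> / r * D \<le> K * r powr \<gamma> / r * (1 / real (Suc n) * r powr (1 - \<gamma>))"
        using D K_nonneg r by (intro mult_left_mono) auto
      also have "\<dots> = K * (1 / real (Suc n)) * (r powr \<gamma> / r * r powr (1 - \<gamma>))" by (simp add: mult_ac)
      finally have "K * r powr \<gamma> / r * D \<le> K * (1 / real (Suc n))" unfolding p(1) by simp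
      moreover have "K * r powr \<gamma> / r * (2 * (L * bnd)) * r = 2 * (L * bnd) * K * r powr \<gamma>" using r by simp
      moreover have "C * r powr (2 * \<gamma>) / r * T = C * T * (r powr (2 * \<gamma>) / r)" by simp
      ultimately show ?thesis unfolding p(2) by linarith
    qed
    finally show ?thesis by (simp add: r_def)
  qed
  have "(\<lambda>n. I n - J n) \<longlonglongrightarrow> 0"
  proof (rule Lim_null_comparison)
    show "eventually (\<lambda>n. norm (I n - J n) \<le> K * (1 / real (Suc n)) + 2 * (L * bnd) * K * e n powr \<gamma> + C * T * e n powr (2 * \<gamma> - 1)) sequentially"
      unfolding real_norm_def using IJ by (intro always_eventually allI)
    have pw: "(\<lambda>n. e n powr a) \<longlonglongrightarrow> 0" if "0 < a" for a
    proof -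
      have "(\<lambda>n. e n powr a) \<longlonglongrightarrow> 0 powr a"
        using e0 that by (intro tendsto_powr2 tendsto_const) (auto intro!: always_eventually less_imp_le e)
      then show ?thesis by simp
    qed
    \<comment> \<open>The last summand tends to 0 because \<open>2 * \<gamma> - 1\<close> is
      positive; this is where Hoelder exponents above one half are essential.\<close>
    have "(\<lambda>n. K * (1 / real (Suc n)) + 2 * (L * bnd) * K * e n powr \<gamma> + C * T * e n powr (2 * \<gamma> - 1)) \<longlonglongrightarrow> K * 0 + 2 * (L * bnd) * K * 0 + C * T * 0"
      using \<gamma> by (intro tendsto_add tendsto_mult tendsto_const lim_n pw) auto
    then show "(\<lambda>n. K * (1 / real (Suc n)) + 2 * (L * bnd) * K * e n powr \<gamma> + C * T * e n powr (2 * \<gamma> - 1)) \<longlonglongrightarrow> 0" by simp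
  qed
  then have "(\<lambda>n. I n - (I n - J n)) \<longlonglongrightarrow> (Y T - Y 0) - 0" by (intro tendsto_diff I_lim)
  then have J_lim: "J \<longlonglongrightarrow> f (X T) - f (X 0)"
    using T_pos by (simp add: Y_def clip)
  have adm: "gls_admissible T \<phi> B (1 - \<gamma>)"
    using reg B \<gamma> by (simp add: gls_admissible_def)
  \<comment> \<open>The sequence \<open>e\<close> was chosen with the exponent
    \<open>1 - \<gamma>\<close> in view, yet the forward limit along it equals the integral for
    every admissible \<open>b\<close>, and limits are unique.\<close>
  have "set_integrable lebesgue {0..T} (gls_integrand \<phi> B T b) \<and> (LINT x:{0..T}|lebesgue. gls_integrand \<phi> B T b x) = f (X T) - f (X 0)"
    if "gls_admissible T \<phi> B b" for b
    using gls_integral_is_forward_limit[OF u_meas u_bd T_pos \<phi>u h_cont h_bd hT Bh that e(1) e0] J_lim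
    unfolding J_def[symmetric] by (auto intro: LIMSEQ_unique)
  with adm show ?thesis
    unfolding has_gls_integral_def by blast
qed

end

section \<open>Besov regularity of the integrand reduced to an energy integral\<close>

context hoelder_path
begin

text \<open>Within lag \<open>r\<close> the process \<open>X\<close> moves by at most
  \<open>K' * r powr \<gamma>\<close>, so by monotonicity the jump of \<open>f'\<close> is at most
  the increment of \<open>h\<close> over a symmetric window of that half-width. The truncation at
  \<open>N\<close> makes \<open>h\<close> bounded without changing it on the range of
  \<open>X\<close>; \<open>K'\<close> and \<open>N\<close> are free parameters so that they can be
  fixed before the path.\<close>

lemma besov2_convex_derivative:
  fixes f' \<phi> :: "real \<Rightarrow> real" and K' N :: real
  defines "h \<equiv> \<lambda>x. f' (max (- N) (min x N))"
  assumes mono: "mono f'" and DX: "DX \<le> K'" and N: "\<And>s. 0 \<le> s \<Longrightarrow> s \<le> T \<Longrightarrow> \<bar>X s\<bar> \<le> N"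
    and \<phi>: "\<And>s. 0 \<le> s \<Longrightarrow> s \<le> T \<Longrightarrow> \<phi> s = f' (X s) * w s"
    and fin: "(\<integral>\<^sup>+r\<in>{0..T}. (\<integral>\<^sup>+s\<in>{0..T}. ennreal ((h (X (clip s) + K' * r powr \<gamma>) - h (X (clip s) - K' * r powr \<gamma>))
        * w (clip s) / r powr ((1 - \<gamma>) + 1)) \<partial>lborel) \<partial>lborel) < \<infinity>"
  shows "\<phi> \<in> besov2 T (1 - \<gamma>)"
proof -
  define u where "u x = f' (X (clip x)) * w (clip x)" for x
  define b where "b = 1 - \<gamma>"
  have b: "0 < b" "b < 1 / 2" using \<gamma> by (auto simp: b_def)
  have [measurable]: "f' \<in> borel_measurable borel" by (rule borel_measurable_mono[OF mono])
  have hmono: "mono h" unfolding h_def by (intro monoI monoD[OF mono]) auto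
  have [measurable]: "h \<in> borel_measurable borel" by (rule borel_measurable_mono[OF hmono])
  have [measurable]: "(\<lambda>x. X (clip x)) \<in> borel_measurable borel" "(\<lambda>x. w (clip x)) \<in> borel_measurable borel"
    by (intro borel_measurable_continuous_onI continuous_on_comp_clip continuous_on_X continuous_on_w)+
  have u_meas[measurable]: "u \<in> borel_measurable borel" unfolding u_def by measurable
  define L where "L = max \<bar>f' N\<bar> \<bar>f' (-N)\<bar>"
  have f'_bd: "\<bar>f' (X s)\<bar> \<le> L" if "0 \<le> s" "s \<le> T" for s
  proof -
    have "f' (-N) \<le> f' (X s)" "f' (X s) \<le> f' N"
      using N[OF that] by (auto intro!: monoD[OF mono])
    then show ?thesis unfolding L_def by linarith
  qed
  have L0: "0 \<le> L" by (simp add: L_def)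
  have Cw0: "0 \<le> Cw" using bnd_pos K_nonneg by (simp add: Cw_def)
  have \<phi>_bd: "\<bar>\<phi> s\<bar> \<le> L * bnd" if "0 \<le> s" "s \<le> T" for s
    unfolding \<phi>[OF that] abs_mult using f'_bd[OF that] w_bounds[of s] that L0 by (intro mult_mono) auto
  have \<phi>_meas: "\<phi> \<in> borel_measurable (lebesgue_on {0..T})"
  proof -
    have "u \<in> borel_measurable lebesgue" using u_meas by (simp add: measurable_completion)
    then have "u \<in> borel_measurable (lebesgue_on {0..T})" by (rule measurable_restrict_space1)
    moreover have "u x = \<phi> x" if "x \<in> space (lebesgue_on {0..T})" for x
      using that by (simp add: u_def clip \<phi>)
    ultimately show ?thesis using measurable_cong[of "lebesgue_on {0..T}" u \<phi> borel] by blast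
  qed
  have powr_fin: "(\<integral>\<^sup>+r\<in>{0..T}. ennreal (c * r powr p) \<partial>lborel) < \<infinity>" if "-1 < p" "0 \<le> c" for c p
  proof -
    have "(\<integral>\<^sup>+r\<in>{0..T}. ennreal (c * r powr p) \<partial>lborel) = (\<integral>\<^sup>+r. ennreal (c * (indicator {0..T} r * (r - 0) powr p)) \<partial>lborel)"
      by (intro nn_integral_cong) (auto simp: indicator_def)
    also have "\<dots> = ennreal (c * ((T - 0) powr (p + 1) / (p + 1)))"
      using that T_pos by (intro nn_integral_eq_has_bochner has_bochner_integral_mult_right has_bochner_integral_powr) auto
    finally show ?thesis by simp
  qed
  have fin1: "(\<integral>\<^sup>+t\<in>{0..T}. ennreal (\<bar>\<phi> t\<bar> / t powr b) \<partial>lebesgue) < \<infinity>"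
  proof -
    have "(\<integral>\<^sup>+t\<in>{0..T}. ennreal (\<bar>\<phi> t\<bar> / t powr b) \<partial>lebesgue) \<le> (\<integral>\<^sup>+t\<in>{0..T}. ennreal (L * bnd * t powr (- b)) \<partial>lebesgue)"
      using \<phi>_bd by (intro nn_integral_mono)
        (auto simp: indicator_def powr_minus_divide intro!: ennreal_leI divide_right_mono)
    also have "\<dots> < \<infinity>"
      unfolding nn_integral_completion using b L0 bnd_pos by (intro powr_fin) auto
    finally show ?thesis .
  qed
  define q where "q r s = (h (X (clip s) + K' * r powr \<gamma>) - h (X (clip s) - K' * r powr \<gamma>)) * w (clip s) / r powr (b + 1)" for r s
  have q_nonneg: "0 \<le> q r s" for r s
  proof -
    have "0 \<le> K'" using DX bnd_pos K_nonneg CX_nonneg by (simp add: DX_def order_trans[rotated])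
    then have "X (clip s) - K' * r powr \<gamma> \<le> X (clip s) + K' * r powr \<gamma>" by simp
    then have "h (X (clip s) - K' * r powr \<gamma>) \<le> h (X (clip s) + K' * r powr \<gamma>)" by (rule monoD[OF hmono])
    then show ?thesis
      unfolding q_def using w_bounds(1)[of "clip s"] clip(1)[of s]
      by (intro divide_nonneg_nonneg mult_nonneg_nonneg) auto
  qed
  \<comment> \<open>The second term stems from the increment of \<open>w\<close>:
    \<open>r powr \<gamma>\<close> divided by \<open>r powr (2 - \<gamma>)\<close>, integrable at 0
    as \<open>2 * \<gamma> - 2 > -1\<close>. At \<open>r = 0\<close> all quotients are divisions by
    0 and vanish.\<close>
  have pw: "\<bar>\<phi> (s + r) - \<phi> s\<bar> / r powr (b + 1) \<le> q r s + L * Cw * r powr (2 * \<gamma> - 2)"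
    if r: "0 \<le> r" "0 \<le> s" "s + r \<le> T" for r s
  proof (cases "r = 0")
    case True
    then show ?thesis by (simp add: q_def)
  next
    case False
    then have r0: "0 < r" using r by simp
    let ?t = "s + r"
    have st: "0 \<le> s" "s \<le> ?t" "?t \<le> T" using r by auto
    have sT: "s \<le> T" using r by simp
    have w0: "0 \<le> w s" using st w_bounds sT by auto
    have hX: "h (X v) = f' (X v)" if "0 \<le> v" "v \<le> T" for v
      using N[OF that] unfolding h_def by (auto simp: abs_le_iff max_def min_def)
    have "\<bar>X ?t - X s\<bar> \<le> K' * r powr \<gamma>"
    proof -
      have "\<bar>X ?t - X s\<bar> \<le> DX * r powr \<gamma>" using X_Hoelder[OF st] by simp
      also have "\<dots> \<le> K' * r powr \<gamma>" using DX by (intro mult_right_mono) auto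
      finally show ?thesis .
    qed
    then have "h (X s - K' * r powr \<gamma>) \<le> h (X ?t)" "h (X ?t) \<le> h (X s + K' * r powr \<gamma>)"
      "h (X s - K' * r powr \<gamma>) \<le> h (X s)" "h (X s) \<le> h (X s + K' * r powr \<gamma>)"
      by (auto intro!: monoD[OF hmono])
    then have hd: "\<bar>f' (X ?t) - f' (X s)\<bar> \<le> h (X s + K' * r powr \<gamma>) - h (X s - K' * r powr \<gamma>)"
      using hX[of ?t] hX[of s] st sT by auto
    have "\<phi> ?t - \<phi> s = (f' (X ?t) - f' (X s)) * w s + f' (X ?t) * (w ?t - w s)"
      using \<phi>[of s] \<phi>[of ?t] st sT by (simp add: algebra_simps)
    then have "\<bar>\<phi> ?t - \<phi> s\<bar> \<le> \<bar>f' (X ?t) - f' (X s)\<bar> * w s + \<bar>f' (X ?t)\<bar> * \<bar>w ?t - w s\<bar>"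
      using abs_triangle_ineq[of "(f' (X ?t) - f' (X s)) * w s" "f' (X ?t) * (w ?t - w s)"] w0 by (simp add: abs_mult)
    also have "\<dots> \<le> (h (X s + K' * r powr \<gamma>) - h (X s - K' * r powr \<gamma>)) * w s + L * (Cw * r powr \<gamma>)"
      using hd w0 f'_bd[of ?t] w_Hoelder[OF st] st L0 by (intro add_mono mult_right_mono mult_mono) auto
    finally have "\<bar>\<phi> ?t - \<phi> s\<bar> / r powr (b + 1) \<le> ((h (X s + K' * r powr \<gamma>) - h (X s - K' * r powr \<gamma>)) * w s + L * (Cw * r powr \<gamma>)) / r powr (b + 1)"
      by (rule divide_right_mono) simp
    also have "\<dots> = q r s + L * Cw * (r powr \<gamma> / r powr (b + 1))"
      using st sT by (simp add: q_def clip add_divide_distrib)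
    also have "r powr \<gamma> / r powr (b + 1) = r powr (2 * \<gamma> - 2)"
      using r0 by (simp add: powr_diff[symmetric] b_def)
    finally show ?thesis .
  qed
  have fin2: "(\<integral>\<^sup>+t\<in>{0..T}. (\<integral>\<^sup>+s\<in>{0..t}. ennreal (\<bar>\<phi> t - \<phi> s\<bar> / (t - s) powr (b + 1)) \<partial>lebesgue) \<partial>lebesgue) < \<infinity>"
  proof -
    have "(\<integral>\<^sup>+t\<in>{0..T}. (\<integral>\<^sup>+s\<in>{0..t}. ennreal (\<bar>\<phi> t - \<phi> s\<bar> / (t - s) powr (b + 1)) \<partial>lebesgue) \<partial>lebesgue)
      = (\<integral>\<^sup>+t\<in>{0..T}. (\<integral>\<^sup>+s\<in>{0..t}. ennreal (\<bar>u t - u s\<bar> / (t - s) powr (b + 1)) \<partial>lborel) \<partial>lborel)"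
      by (rule besov2_double_integral_eq) (simp add: u_def clip \<phi>)
    also have "\<dots> = (\<integral>\<^sup>+r\<in>{0..T}. (\<integral>\<^sup>+s\<in>{0..T-r}. ennreal (\<bar>u (s + r) - u s\<bar> / (s + r - s) powr (b + 1)) \<partial>lborel) \<partial>lborel)"
      by (rule nn_integral_triangle_shift) simp
    also have "\<dots> \<le> (\<integral>\<^sup>+r. (\<integral>\<^sup>+s\<in>{0..T}. ennreal (q r s) \<partial>lborel) * indicator {0..T} r + ennreal (T * (L * Cw) * r powr (2 * \<gamma> - 2)) * indicator {0..T} r \<partial>lborel)"
    proof (rule nn_integral_mono)
      fix r :: real
      show "(\<integral>\<^sup>+s\<in>{0..T-r}. ennreal (\<bar>u (s + r) - u s\<bar> / (s + r - s) powr (b + 1)) \<partial>lborel) * indicator {0..T} r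
        \<le> (\<integral>\<^sup>+s\<in>{0..T}. ennreal (q r s) \<partial>lborel) * indicator {0..T} r + ennreal (T * (L * Cw) * r powr (2 * \<gamma> - 2)) * indicator {0..T} r"
      proof (cases "r \<in> {0..T}")
        case True
        have q_meas: "(\<lambda>s. ennreal (q r s)) \<in> borel_measurable borel" unfolding q_def by measurable
        have "(\<integral>\<^sup>+s\<in>{0..T-r}. ennreal (\<bar>u (s + r) - u s\<bar> / (s + r - s) powr (b + 1)) \<partial>lborel)
          \<le> (\<integral>\<^sup>+s. ennreal (q r s) * indicator {0..T} s + ennreal (L * Cw * r powr (2 * \<gamma> - 2)) * indicator {0..T} s \<partial>lborel)"
        proof (rule nn_integral_mono)
          fix s :: real
          show "ennreal (\<bar>u (s + r) - u s\<bar> / (s + r - s) powr (b + 1)) * indicator {0..T-r} s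
            \<le> ennreal (q r s) * indicator {0..T} s + ennreal (L * Cw * r powr (2 * \<gamma> - 2)) * indicator {0..T} s"
          proof (cases "s \<in> {0..T-r}")
            case s: True
            have "ennreal (\<bar>u (s + r) - u s\<bar> / (s + r - s) powr (b + 1)) \<le> ennreal (q r s + L * Cw * r powr (2 * \<gamma> - 2))"
              using pw[of r s] True s by (intro ennreal_leI) (simp add: u_def clip \<phi>)
            also have "\<dots> = ennreal (q r s) + ennreal (L * Cw * r powr (2 * \<gamma> - 2))"
              using q_nonneg L0 Cw0 by (intro ennreal_plus) auto
            finally show ?thesis using True s by simp
          qed simp
        qed
        also have "\<dots> = (\<integral>\<^sup>+s\<in>{0..T}. ennreal (q r s) \<partial>lborel) + (\<integral>\<^sup>+s. ennreal (L * Cw * r powr (2 * \<gamma> - 2)) * indicator {0..T} s \<partial>lborel)"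
          using q_meas by (intro nn_integral_add) auto
        also have "(\<integral>\<^sup>+s. ennreal (L * Cw * r powr (2 * \<gamma> - 2)) * indicator {0..T} s \<partial>lborel) = ennreal (T * (L * Cw) * r powr (2 * \<gamma> - 2))"
          by (subst nn_integral_cmult_indicator) (use T_pos L0 Cw0 in \<open>auto simp: ennreal_mult[symmetric] mult_ac\<close>)
        finally show ?thesis using True by simp
      qed simp
    qed
    also have "\<dots> = (\<integral>\<^sup>+r\<in>{0..T}. (\<integral>\<^sup>+s\<in>{0..T}. ennreal (q r s) \<partial>lborel) \<partial>lborel) + (\<integral>\<^sup>+r\<in>{0..T}. ennreal (T * (L * Cw) * r powr (2 * \<gamma> - 2)) \<partial>lborel)"
      unfolding q_def by (rule nn_integral_add) measurable
    also have "\<dots> < \<infinity>"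
      using fin powr_fin[of "2 * \<gamma> - 2" "T * (L * Cw)"] \<gamma> T_pos L0 Cw0 by (simp add: q_def b_def)
    finally show ?thesis .
  qed
  have "besov2_norm T b \<phi> < \<infinity>" unfolding besov2_norm_def using fin1 fin2 by simp
  then show ?thesis unfolding besov2_def using \<phi>_meas by (simp add: b_def)
qed

end

section \<open>Gaussian regression\<close>

context prob_space
begin

text \<open>\<open>Y\<close> acts as a signed density. Adding a multiple of it to the constant 1
  gives a probability density under which \<open>U\<close> keeps its characteristic function, hence
  by uniqueness its law; comparing the probabilities of \<open>A\<close> isolates the contribution
  of \<open>Y\<close>.\<close>

lemma real_char_zero_imp_indicator_zero:
  fixes Y U :: "'a \<Rightarrow> real"
  assumes [measurable]: "Y \<in> borel_measurable M" "U \<in> borel_measurable M" "A \<in> sets borel"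
    and Y: "\<And>\<omega>. \<bar>Y \<omega>\<bar> \<le> C"
    and zero: "\<And>\<theta>. (CLINT \<omega>|M. complex_of_real (Y \<omega>) * iexp (\<theta> * U \<omega>)) = 0"
  shows "(LINT \<omega>|M. Y \<omega> * indicator A (U \<omega>)) = 0"
proof -
  \<comment> \<open>Strictly positive and at least \<open>\<bar>Y \<omega>\<bar>\<close>, so that
    \<open>1 + Y \<omega> / c\<close> is nonnegative.\<close>
  define c where "c = \<bar>C\<bar> + 1"
  have c: "0 < c" "\<And>\<omega>. \<bar>Y \<omega>\<bar> \<le> c"
  proof -
    show "\<bar>Y \<omega>\<bar> \<le> c" for \<omega> using Y[of \<omega>] by (simp add: c_def)
  qed (simp add: c_def)
  define D where "D \<omega> = 1 + Y \<omega> / c" for \<omega>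
  have D0: "0 \<le> D \<omega>" for \<omega>
    using c(1) c(2)[of \<omega>] by (auto simp: D_def field_simps abs_le_iff)
  have [measurable]: "D \<in> borel_measurable M" unfolding D_def by simp
  have intY: "integrable M Y" by (rule integrable_const_bound[where B=C]) (use Y in auto)
  \<comment> \<open>Frequency 0 gives mean 0, so the new density has total mass 1.\<close>
  have EY: "(LINT \<omega>|M. Y \<omega>) = 0"
    using zero[of 0] by (simp add: integral_complex_of_real)
  have intD: "integrable M D" unfolding D_def using intY by simp
  have ED: "(LINT \<omega>|M. D \<omega>) = 1"
    unfolding D_def using intY EY by (simp add: prob_space)
  define N where "N = density M (\<lambda>\<omega>. ennreal (D \<omega>))"
  have [measurable_cong]: "sets N = sets M" by (simp add: N_def)
  interpret N: prob_space N
  proof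
    have "emeasure N (space N) = (\<integral>\<^sup>+\<omega>. ennreal (D \<omega>) \<partial>M)"
      unfolding N_def by (subst emeasure_density) (auto intro!: nn_integral_cong simp: indicator_def)
    also have "\<dots> = 1" using ED D0 by (subst nn_integral_eq_integral[OF intD]) auto
    finally show "emeasure N (space N) = 1" .
  qed
  have "char (distr N borel U) = char (distr M borel U)"
  proof
    fix t
    have i1: "integrable M (\<lambda>\<omega>. iexp (t * U \<omega>))"
      by (rule integrable_const_bound[where B=1]) auto
    have i2: "integrable M (\<lambda>\<omega>. complex_of_real (Y \<omega>) * iexp (t * U \<omega>))"
      by (rule integrable_const_bound[where B=C]) (use Y in \<open>auto simp: norm_mult\<close>)
    have "char (distr N borel U) t = (CLINT \<omega>|N. iexp (t * U \<omega>))"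
      unfolding char_def by (rule integral_distr) auto
    also have "\<dots> = (CLINT \<omega>|M. D \<omega> *\<^sub>R iexp (t * U \<omega>))"
      unfolding N_def by (rule integral_density) (use D0 in auto)
    also have "\<dots> = (CLINT \<omega>|M. iexp (t * U \<omega>) + (1 / complex_of_real c) * (complex_of_real (Y \<omega>) * iexp (t * U \<omega>)))"
      by (intro Bochner_Integration.integral_cong refl) (simp add: D_def scaleR_conv_of_real algebra_simps)
    also have "\<dots> = (CLINT \<omega>|M. iexp (t * U \<omega>)) + (1 / complex_of_real c) * (CLINT \<omega>|M. complex_of_real (Y \<omega>) * iexp (t * U \<omega>))"
      using i1 i2 by (subst Bochner_Integration.integral_add) auto
    also have "\<dots> = (CLINT \<omega>|M. iexp (t * U \<omega>))" unfolding zero by simp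
    also have "\<dots> = char (distr M borel U) t"
      unfolding char_def by (rule integral_distr[symmetric]) auto
    finally show "char (distr N borel U) t = char (distr M borel U) t" .
  qed
  then have eq: "distr N borel U = distr M borel U"
    by (intro Levy_uniqueness N.real_distribution_distr real_distribution_distr) auto
  have "(LINT x|distr N borel U. indicator A x :: real) = (LINT x|distr M borel U. indicator A x)"
    unfolding eq ..
  then have "(LINT \<omega>|N. indicator A (U \<omega>) :: real) = (LINT \<omega>|M. indicator A (U \<omega>))"
    by (subst (asm) (1 2) integral_distr) auto
  moreover have "(LINT \<omega>|N. indicator A (U \<omega>) :: real) = (LINT \<omega>|M. D \<omega> *\<^sub>R indicator A (U \<omega>))"
    unfolding N_def by (rule integral_density) (use D0 in auto)
  moreover have "(LINT \<omega>|M. D \<omega> *\<^sub>R (indicator A (U \<omega>) :: real)) = (LINT \<omega>|M. indicator A (U \<omega>) + (1 / c) * (Y \<omega> * indicator A (U \<omega>)))"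
    by (intro Bochner_Integration.integral_cong refl) (simp add: D_def algebra_simps)
  moreover have "integrable M (\<lambda>\<omega>. indicator A (U \<omega>) :: real)"
    by (rule integrable_const_bound[where B=1]) (auto simp: indicator_def)
  moreover have "integrable M (\<lambda>\<omega>. Y \<omega> * indicator A (U \<omega>))"
  proof (rule integrable_const_bound[where B="\<bar>C\<bar>"])
    have "\<bar>Y \<omega>\<bar> \<le> \<bar>C\<bar>" for \<omega> using Y[of \<omega>] by linarith
    then show "AE \<omega> in M. norm (Y \<omega> * indicator A (U \<omega>)) \<le> \<bar>C\<bar>" by (simp add: indicator_def)
  qed simp
  ultimately show ?thesis using c(1) by simp
qed

text \<open>Reduction to the real and imaginary parts of \<open>Y\<close>. They are combinations of
  \<open>Y\<close> and \<open>cnj Y\<close>, and conjugation merely reflects the frequency, so the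
  vanishing at all frequencies is inherited.\<close>

lemma char_zero_imp_indicator_zero:
  fixes Y :: "'a \<Rightarrow> complex" and U :: "'a \<Rightarrow> real"
  assumes [measurable]: "Y \<in> borel_measurable M" "U \<in> borel_measurable M" "A \<in> sets borel"
    and Y: "\<And>\<omega>. norm (Y \<omega>) \<le> C"
    and zero: "\<And>\<theta>. (CLINT \<omega>|M. Y \<omega> * iexp (\<theta> * U \<omega>)) = 0"
  shows "(CLINT \<omega>|M. Y \<omega> * complex_of_real (indicator A (U \<omega>))) = 0"
proof -
  have [measurable]: "(\<lambda>\<omega>. cnj (Y \<omega>)) \<in> borel_measurable M"
    by (rule measurable_compose[OF assms(1) borel_measurable_continuous_onI]) (intro continuous_intros)
  have int: "integrable M (\<lambda>\<omega>. Y \<omega> * iexp (\<theta> * U \<omega>))" for \<theta>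
    by (rule integrable_const_bound[where B=C]) (use Y in \<open>auto simp: norm_mult\<close>)
  have int': "integrable M (\<lambda>\<omega>. cnj (Y \<omega>) * iexp (\<theta> * U \<omega>))" for \<theta>
    by (rule integrable_const_bound[where B=C]) (use Y in \<open>auto simp: norm_mult\<close>)
  have zero': "(CLINT \<omega>|M. cnj (Y \<omega>) * iexp (\<theta> * U \<omega>)) = 0" for \<theta>
  proof -
    have "(CLINT \<omega>|M. cnj (Y \<omega>) * iexp (\<theta> * U \<omega>)) = (CLINT \<omega>|M. cnj (Y \<omega> * iexp ((- \<theta>) * U \<omega>)))"
      by (intro Bochner_Integration.integral_cong refl) (simp add: exp_cnj)
    also have "\<dots> = cnj (CLINT \<omega>|M. Y \<omega> * iexp ((- \<theta>) * U \<omega>))"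
      by (rule integral_bounded_linear[OF bounded_linear_cnj int])
    finally show ?thesis unfolding zero by simp
  qed
  have re: "(LINT \<omega>|M. Re (Y \<omega>) * indicator A (U \<omega>)) = 0"
  proof (rule real_char_zero_imp_indicator_zero)
    show "\<bar>Re (Y \<omega>)\<bar> \<le> C" for \<omega> using abs_Re_le_cmod Y by (rule order_trans)
    fix \<theta>
    have "(CLINT \<omega>|M. complex_of_real (Re (Y \<omega>)) * iexp (\<theta> * U \<omega>)) = (CLINT \<omega>|M. (1/2) * (Y \<omega> * iexp (\<theta> * U \<omega>) + cnj (Y \<omega>) * iexp (\<theta> * U \<omega>)))"
      by (intro Bochner_Integration.integral_cong refl) (simp add: distrib_right[symmetric] complex_add_cnj)
    also have "\<dots> = 0" using int int' zero zero' by simp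
    finally show "(CLINT \<omega>|M. complex_of_real (Re (Y \<omega>)) * iexp (\<theta> * U \<omega>)) = 0" .
  qed simp_all
  have im: "(LINT \<omega>|M. Im (Y \<omega>) * indicator A (U \<omega>)) = 0"
  proof (rule real_char_zero_imp_indicator_zero)
    show "\<bar>Im (Y \<omega>)\<bar> \<le> C" for \<omega> using abs_Im_le_cmod Y by (rule order_trans)
    fix \<theta>
    have "(CLINT \<omega>|M. complex_of_real (Im (Y \<omega>)) * iexp (\<theta> * U \<omega>)) = (CLINT \<omega>|M. (1/(2*\<i>)) * (Y \<omega> * iexp (\<theta> * U \<omega>) - cnj (Y \<omega>) * iexp (\<theta> * U \<omega>)))"
    proof (intro Bochner_Integration.integral_cong refl)
      fix \<omega>
      have "Y \<omega> * e - cnj (Y \<omega>) * e = (2 * \<i>) * (complex_of_real (Im (Y \<omega>)) * e)" for e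
        unfolding left_diff_distrib[symmetric] complex_diff_cnj by (simp only: of_real_mult of_real_numeral mult_ac)
      then show "complex_of_real (Im (Y \<omega>)) * iexp (\<theta> * U \<omega>) = (1/(2*\<i>)) * (Y \<omega> * iexp (\<theta> * U \<omega>) - cnj (Y \<omega>) * iexp (\<theta> * U \<omega>))"
        by simp
    qed
    also have "\<dots> = 0" using int int' zero zero' by simp
    finally show "(CLINT \<omega>|M. complex_of_real (Im (Y \<omega>)) * iexp (\<theta> * U \<omega>)) = 0" .
  qed simp_all
  have i0: "integrable M (\<lambda>\<omega>. V \<omega> * indicator A (U \<omega>))"
    if [measurable]: "V \<in> borel_measurable M" and V: "\<And>\<omega>. \<bar>V \<omega>\<bar> \<le> C" for V :: "'a \<Rightarrow> real"
  proof (rule integrable_const_bound[where B="\<bar>C\<bar>"])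
    have "\<bar>V \<omega>\<bar> \<le> \<bar>C\<bar>" for \<omega> using V[of \<omega>] by linarith
    then show "AE \<omega> in M. norm (V \<omega> * indicator A (U \<omega>)) \<le> \<bar>C\<bar>" by (simp add: indicator_def)
  qed simp
  have i: "integrable M (\<lambda>\<omega>. Re (Y \<omega>) * indicator A (U \<omega>))" "integrable M (\<lambda>\<omega>. Im (Y \<omega>) * indicator A (U \<omega>))"
    by (intro i0 order_trans[OF abs_Re_le_cmod Y] order_trans[OF abs_Im_le_cmod Y]; simp)+
  have "(CLINT \<omega>|M. Y \<omega> * complex_of_real (indicator A (U \<omega>)))
    = (CLINT \<omega>|M. complex_of_real (Re (Y \<omega>) * indicator A (U \<omega>)) + \<i> * complex_of_real (Im (Y \<omega>) * indicator A (U \<omega>)))"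
    by (intro Bochner_Integration.integral_cong refl) (simp add: complex_eq_iff)
  also have "\<dots> = (CLINT \<omega>|M. complex_of_real (Re (Y \<omega>) * indicator A (U \<omega>))) + \<i> * (CLINT \<omega>|M. complex_of_real (Im (Y \<omega>) * indicator A (U \<omega>)))"
    using i[THEN integrable_of_real, where 'a=complex]
    by (subst Bochner_Integration.integral_add) auto
  also have "\<dots> = 0" unfolding integral_complex_of_real re im by simp
  finally show ?thesis .
qed

text \<open>
  The characters \<open>iexp (l t * R t)\<close> are exchanged for indicators one coordinate at a time, so that
  the one-dimensional uniqueness theorem suffices.
\<close>

lemma char_factor_imp_indicator_factor:
  fixes Z :: "'a \<Rightarrow> real" and R :: "'i \<Rightarrow> 'a \<Rightarrow> real"
  assumes I: "finite I" "J \<subseteq> I"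
    and [measurable]: "Z \<in> borel_measurable M" "\<And>t. R t \<in> borel_measurable M"
    and factor: "\<And>\<theta> l. (CLINT \<omega>|M. iexp (\<theta> * Z \<omega> + (\<Sum>t\<in>I. l t * R t \<omega>)))
       = (CLINT \<omega>|M. iexp (\<theta> * Z \<omega>)) * (CLINT \<omega>|M. iexp (\<Sum>t\<in>I. l t * R t \<omega>))"
    and A0[measurable]: "A0 \<in> sets borel" and A: "\<And>t. t \<in> I \<Longrightarrow> A t \<in> sets borel"
  shows "(CLINT \<omega>|M. complex_of_real ((indicator A0 (Z \<omega>) - (LINT \<omega>|M. indicator A0 (Z \<omega>))) * (\<Prod>t\<in>J. indicator (A t) (R t \<omega>)))
     * iexp (\<Sum>t\<in>I - J. l t * R t \<omega>)) = 0"
proof -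
  define p where "p = (LINT \<omega>|M. indicator A0 (Z \<omega>) :: real)"
  have p: "0 \<le> p" "p \<le> 1"
  proof -
    show "0 \<le> p" by (simp add: p_def)
    have "p \<le> (LINT \<omega>|M. 1)"
      unfolding p_def by (intro integral_mono integrable_const_bound[where B=1]) (auto simp: indicator_def)
    then show "p \<le> 1" by (simp add: prob_space)
  qed
  have "finite J" using I finite_subset by blast
  then show ?thesis using I(2) unfolding p_def[symmetric]
  proof (induction J arbitrary: l rule: finite_induct)
    case empty
    define q where "q = (CLINT \<omega>|M. iexp (\<Sum>t\<in>I. l t * R t \<omega>))"
    have i: "integrable M (\<lambda>\<omega>. iexp (h \<omega>))" if [measurable]: "h \<in> borel_measurable M" for h
      by (rule integrable_const_bound[where B=1]) auto
    have *: "(CLINT \<omega>|M. (iexp (\<Sum>t\<in>I. l t * R t \<omega>) - q) * complex_of_real (indicator A0 (Z \<omega>))) = 0"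
    proof (rule char_zero_imp_indicator_zero[where C="1 + norm q"])
      show "norm (iexp (\<Sum>t\<in>I. l t * R t \<omega>) - q) \<le> 1 + norm q" for \<omega>
        using norm_triangle_ineq4[of "iexp (\<Sum>t\<in>I. l t * R t \<omega>)" q] by simp
      fix \<theta>
      have "(CLINT \<omega>|M. (iexp (\<Sum>t\<in>I. l t * R t \<omega>) - q) * iexp (\<theta> * Z \<omega>)) =
        (CLINT \<omega>|M. iexp (\<theta> * Z \<omega> + (\<Sum>t\<in>I. l t * R t \<omega>)) - q * iexp (\<theta> * Z \<omega>))"
        by (intro Bochner_Integration.integral_cong refl) (simp add: left_diff_distrib right_diff_distrib distrib_left exp_add mult.commute)
      also have "\<dots> = (CLINT \<omega>|M. iexp (\<theta> * Z \<omega> + (\<Sum>t\<in>I. l t * R t \<omega>))) - (CLINT \<omega>|M. q * iexp (\<theta> * Z \<omega>))"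
        by (intro Bochner_Integration.integral_diff integrable_mult_right i) auto
      also have "\<dots> = 0" unfolding factor by (simp add: q_def)
      finally show "(CLINT \<omega>|M. (iexp (\<Sum>t\<in>I. l t * R t \<omega>) - q) * iexp (\<theta> * Z \<omega>)) = 0" .
    qed auto
    have i1: "integrable M (\<lambda>\<omega>. iexp (\<Sum>t\<in>I. l t * R t \<omega>) * complex_of_real (indicator A0 (Z \<omega>)))"
      by (rule integrable_const_bound[where B=1]) (auto simp: norm_mult indicator_def)
    have i2: "integrable M (\<lambda>\<omega>. complex_of_real (indicator A0 (Z \<omega>)))"
      by (rule integrable_const_bound[where B=1]) (auto simp: norm_mult indicator_def)
    have "(CLINT \<omega>|M. (iexp (\<Sum>t\<in>I. l t * R t \<omega>) - q) * complex_of_real (indicator A0 (Z \<omega>)))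
       = (CLINT \<omega>|M. iexp (\<Sum>t\<in>I. l t * R t \<omega>) * complex_of_real (indicator A0 (Z \<omega>))) - q * (CLINT \<omega>|M. complex_of_real (indicator A0 (Z \<omega>)))"
      unfolding left_diff_distrib using i1 i2 by simp
    then have eq: "(CLINT \<omega>|M. iexp (\<Sum>t\<in>I. l t * R t \<omega>) * complex_of_real (indicator A0 (Z \<omega>))) = q * complex_of_real p"
      using * unfolding integral_complex_of_real p_def by simp
    have "(CLINT \<omega>|M. complex_of_real ((indicator A0 (Z \<omega>) - p) * (\<Prod>t\<in>{}. indicator (A t) (R t \<omega>))) * iexp (\<Sum>t\<in>I - {}. l t * R t \<omega>))
      = (CLINT \<omega>|M. iexp (\<Sum>t\<in>I. l t * R t \<omega>) * complex_of_real (indicator A0 (Z \<omega>)) - complex_of_real p * iexp (\<Sum>t\<in>I. l t * R t \<omega>))"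
      by (intro Bochner_Integration.integral_cong refl) (simp add: algebra_simps)
    also have "\<dots> = q * complex_of_real p - complex_of_real p * q"
    proof -
      have i0: "integrable M (\<lambda>\<omega>. complex_of_real p * iexp (\<Sum>t\<in>I. l t * R t \<omega>))"
        by (intro integrable_mult_right i) auto
      show ?thesis
        unfolding Bochner_Integration.integral_diff[OF i1 i0] eq q_def by simp
    qed
    finally show ?case by simp
  next
    case (insert j J)
    then have j: "j \<in> I" "j \<notin> J" "J \<subseteq> I" by auto
    have [measurable]: "A t \<in> sets borel" if "t \<in> I" for t using A that by simp
    \<comment> \<open>Everything except the coordinate \<open>j\<close>, which is the one exchanged
      next. The induction hypothesis, with the coefficient of \<open>j\<close> set to
      \<open>\<theta>\<close>, says that \<open>W\<close> is orthogonal to every character of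
      \<open>R j\<close>.\<close>
    define W where "W \<omega> = complex_of_real ((indicator A0 (Z \<omega>) - p) * (\<Prod>t\<in>J. indicator (A t) (R t \<omega>))) * iexp (\<Sum>t\<in>I - insert j J. l t * R t \<omega>)" for \<omega>
    have pr: "\<bar>\<Prod>t\<in>J. indicator (A t) (R t \<omega>)\<bar> \<le> (1::real)" for \<omega>
      unfolding abs_prod by (rule prod_le_1) (auto simp: indicator_def)
    have W: "norm (W \<omega>) \<le> 1" for \<omega>
    proof -
      have "\<bar>indicator A0 (Z \<omega>) - p\<bar> * \<bar>\<Prod>t\<in>J. indicator (A t) (R t \<omega>)\<bar> \<le> 1 * (1::real)"
        using pr p by (intro mult_mono) (auto simp: indicator_def)
      then show ?thesis by (simp only: W_def norm_mult norm_of_real abs_mult norm_exp_i_times mult_1_right)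
    qed
    have W_meas[measurable]: "W \<in> borel_measurable M"
    proof -
      have "(\<lambda>\<omega>. indicator (A t) (R t \<omega>) :: real) \<in> borel_measurable M" if "t \<in> J" for t
      proof -
        have [measurable]: "A t \<in> sets borel" using A that j(3) by blast
        show ?thesis by measurable
      qed
      then have "(\<lambda>\<omega>. \<Prod>t\<in>J. indicator (A t) (R t \<omega>) :: real) \<in> borel_measurable M"
        by (rule borel_measurable_prod)
      moreover have "(\<lambda>\<omega>. iexp (\<Sum>t\<in>I - insert j J. l t * R t \<omega>)) \<in> borel_measurable M" by simp
      moreover have "(\<lambda>\<omega>. complex_of_real (V \<omega>)) \<in> borel_measurable M" if "V \<in> borel_measurable M" for V
        using that by simp
      ultimately show ?thesis unfolding W_def
        by (intro borel_measurable_times) (auto simp del: of_real_mult of_real_diff of_real_prod)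
    qed
    have "(CLINT \<omega>|M. W \<omega> * complex_of_real (indicator (A j) (R j \<omega>))) = 0"
    proof (rule char_zero_imp_indicator_zero[OF W_meas _ _ W])
      fix \<theta>
      have split: "(\<Sum>t\<in>I - J. (l(j := \<theta>)) t * R t \<omega>) = \<theta> * R j \<omega> + (\<Sum>t\<in>I - insert j J. l t * R t \<omega>)" for \<omega>
      proof -
        have e: "I - J = insert j (I - insert j J)" using j by auto
        have "(\<Sum>t\<in>I - insert j J. (l(j := \<theta>)) t * R t \<omega>) = (\<Sum>t\<in>I - insert j J. l t * R t \<omega>)"
          by (rule sum.cong) auto
        then show ?thesis unfolding e using I by (subst sum.insert) auto
      qed
      have "(CLINT \<omega>|M. W \<omega> * iexp (\<theta> * R j \<omega>)) = (CLINT \<omega>|M. complex_of_real ((indicator A0 (Z \<omega>) - p) * (\<Prod>t\<in>J. indicator (A t) (R t \<omega>))) * iexp (\<Sum>t\<in>I - J. (l(j := \<theta>)) t * R t \<omega>))"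
        unfolding split by (intro Bochner_Integration.integral_cong refl) (simp add: W_def distrib_left exp_add mult_ac)
      also have "\<dots> = 0" by (rule insert.IH[OF j(3)])
      finally show "(CLINT \<omega>|M. W \<omega> * iexp (\<theta> * R j \<omega>)) = 0" .
    qed (use j in auto)
    also have "(\<lambda>\<omega>. W \<omega> * complex_of_real (indicator (A j) (R j \<omega>))) = (\<lambda>\<omega>. complex_of_real ((indicator A0 (Z \<omega>) - p) * (\<Prod>t\<in>insert j J. indicator (A t) (R t \<omega>))) * iexp (\<Sum>t\<in>I - insert j J. l t * R t \<omega>))"
      using insert.hyps by (auto simp: W_def fun_eq_iff)
    finally show ?case .
  qed
qed

text \<open>Exchanging all coordinates leaves a trivial character and gives independence on boxes.
  Boxes generate the finite product sigma-algebra, and measurable rectangles determine a measure on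
  the pair.\<close>

lemma char_factor_imp_product_measure:
  fixes Z :: "'a \<Rightarrow> real" and R :: "'i \<Rightarrow> 'a \<Rightarrow> real"
  assumes I: "finite I"
    and [measurable]: "Z \<in> borel_measurable M" "\<And>t. R t \<in> borel_measurable M"
    and factor: "\<And>\<theta> l. (CLINT \<omega>|M. iexp (\<theta> * Z \<omega> + (\<Sum>t\<in>I. l t * R t \<omega>)))
       = (CLINT \<omega>|M. iexp (\<theta> * Z \<omega>)) * (CLINT \<omega>|M. iexp (\<Sum>t\<in>I. l t * R t \<omega>))"
  shows "distr M borel Z \<Otimes>\<^sub>M distr M (PiM I (\<lambda>_. borel)) (\<lambda>\<omega>. \<lambda>t\<in>I. R t \<omega>)
     = distr M (borel \<Otimes>\<^sub>M PiM I (\<lambda>_. borel)) (\<lambda>\<omega>. (Z \<omega>, \<lambda>t\<in>I. R t \<omega>))"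
proof -
  define V where "V \<omega> = (\<lambda>t\<in>I. R t \<omega>)" for \<omega>
  have V[measurable]: "V \<in> measurable M (PiM I (\<lambda>_. borel))" unfolding V_def by measurable
  interpret Z: prob_space "distr M borel Z" by (rule prob_space_distr) simp
  interpret V: prob_space "distr M (PiM I (\<lambda>_. borel)) V" by (rule prob_space_distr) simp
  have box: "measure M {\<omega>\<in>space M. Z \<omega> \<in> A0 \<and> V \<omega> \<in> Pi\<^sub>E I A} = measure M {\<omega>\<in>space M. Z \<omega> \<in> A0} * measure M {\<omega>\<in>space M. V \<omega> \<in> Pi\<^sub>E I A}"
    if [measurable]: "A0 \<in> sets borel" and A: "\<And>t. t \<in> I \<Longrightarrow> A t \<in> sets borel" for A0 and A :: "'i \<Rightarrow> real set"
  proof -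
    have P: "(\<Prod>t\<in>I. indicator (A t) (R t \<omega>)) = (indicator (Pi\<^sub>E I A) (V \<omega>) :: real)" for \<omega>
      using I by (auto simp: indicator_def V_def PiE_iff prod_zero_iff intro!: prod.neutral)
    have [measurable]: "Pi\<^sub>E I A \<in> sets (PiM I (\<lambda>_. borel))" using A I by (intro sets_PiM_I_finite) auto
    define p where "p = (LINT \<omega>|M. indicator A0 (Z \<omega>) :: real)"
    have "(CLINT \<omega>|M. complex_of_real ((indicator A0 (Z \<omega>) - p) * indicator (Pi\<^sub>E I A) (V \<omega>))) = 0"
      using char_factor_imp_indicator_factor[where J=I and l="\<lambda>_. 0" and A=A, OF I subset_refl assms(2,3) factor that(1) A] by (simp add: P p_def del: of_real_mult)
    then have "(LINT \<omega>|M. (indicator A0 (Z \<omega>) - p) * indicator (Pi\<^sub>E I A) (V \<omega>)) = 0"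
      unfolding integral_complex_of_real by simp
    moreover have "(LINT \<omega>|M. (indicator A0 (Z \<omega>) - p) * indicator (Pi\<^sub>E I A) (V \<omega>))
       = (LINT \<omega>|M. indicator {\<omega>\<in>space M. Z \<omega> \<in> A0 \<and> V \<omega> \<in> Pi\<^sub>E I A} \<omega> - p * indicator {\<omega>\<in>space M. V \<omega> \<in> Pi\<^sub>E I A} \<omega>)"
      by (intro Bochner_Integration.integral_cong refl) (auto simp: indicator_def)
    moreover have "\<dots> = measure M {\<omega>\<in>space M. Z \<omega> \<in> A0 \<and> V \<omega> \<in> Pi\<^sub>E I A} - p * measure M {\<omega>\<in>space M. V \<omega> \<in> Pi\<^sub>E I A}"
      by (subst Bochner_Integration.integral_diff) (auto simp: emeasure_eq_measure Int_absorb2)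
    moreover have "p = measure M {\<omega>\<in>space M. Z \<omega> \<in> A0}"
    proof -
      have "p = (LINT \<omega>|M. indicator {\<omega>\<in>space M. Z \<omega> \<in> A0} \<omega>)"
        unfolding p_def by (intro Bochner_Integration.integral_cong refl) (auto simp: indicator_def)
      then show ?thesis by (simp add: Int_absorb2)
    qed
    ultimately show ?thesis by simp
  qed
  have rect: "emeasure M {\<omega>\<in>space M. Z \<omega> \<in> A0} * emeasure M {\<omega>\<in>space M. V \<omega> \<in> E} = emeasure M {\<omega>\<in>space M. Z \<omega> \<in> A0 \<and> V \<omega> \<in> E}"
    if A0[measurable]: "A0 \<in> sets borel" and E: "E \<in> sets (PiM I (\<lambda>_. borel))" for A0 E
  proof -
    \<comment> \<open>For fixed \<open>A0\<close>, \<open>P\<close> is the law of \<open>V\<close>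
      restricted to the event that \<open>Z\<close> lies in \<open>A0\<close>, and \<open>Q\<close>
      is the unrestricted law scaled by the probability of this event. The two agree on
      boxes.\<close>
    define P where "P = distr (density M (\<lambda>\<omega>. indicator A0 (Z \<omega>))) (PiM I (\<lambda>_. borel)) V"
    define Q where "Q = scale_measure (emeasure M {\<omega>\<in>space M. Z \<omega> \<in> A0}) (distr M (PiM I (\<lambda>_. borel)) V)"
    have emP: "emeasure P E = emeasure M {\<omega>\<in>space M. Z \<omega> \<in> A0 \<and> V \<omega> \<in> E}" if [measurable]: "E \<in> sets (PiM I (\<lambda>_. borel))" for E
    proof -
      have "emeasure P E = (\<integral>\<^sup>+\<omega>. indicator A0 (Z \<omega>) * indicator (V -` E \<inter> space M) \<omega> \<partial>M)"
        unfolding P_def by (simp add: emeasure_distr emeasure_density)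
      also have "\<dots> = (\<integral>\<^sup>+\<omega>. indicator {\<omega>\<in>space M. Z \<omega> \<in> A0 \<and> V \<omega> \<in> E} \<omega> \<partial>M)"
        by (intro nn_integral_cong) (auto simp: indicator_def)
      finally show ?thesis by simp
    qed
    have emQ: "emeasure Q E = emeasure M {\<omega>\<in>space M. Z \<omega> \<in> A0} * emeasure M {\<omega>\<in>space M. V \<omega> \<in> E}" if [measurable]: "E \<in> sets (PiM I (\<lambda>_. borel))" for E
      unfolding Q_def by (simp add: emeasure_distr vimage_def Int_def conj_commute)
    have "P = Q"
    proof (rule measure_eqI_PiM_finite[OF I])
      show "sets P = sets (PiM I (\<lambda>_. borel))" "sets Q = sets (PiM I (\<lambda>_. borel))" by (auto simp: P_def Q_def)
      show "emeasure P (Pi\<^sub>E I A) = emeasure Q (Pi\<^sub>E I A)" if A: "\<And>i. i \<in> I \<Longrightarrow> A i \<in> sets borel" for A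
      proof -
        have [measurable]: "Pi\<^sub>E I A \<in> sets (PiM I (\<lambda>_. borel))" using A I by (intro sets_PiM_I_finite) auto
        show ?thesis
          unfolding emP[OF \<open>Pi\<^sub>E I A \<in> _\<close>] emQ[OF \<open>Pi\<^sub>E I A \<in> _\<close>] emeasure_eq_measure
          using box[of A0 A, OF A0 A] by (simp add: ennreal_mult)
      qed
      show "range (\<lambda>_::nat. space (PiM I (\<lambda>_. borel))) \<subseteq> prod_algebra I (\<lambda>_. borel :: real measure)"
        using prod_algebraI_finite[OF I, of "\<lambda>_. UNIV" "\<lambda>_. borel :: real measure"] by (simp add: space_PiM)
      show "(\<Union>i::nat. space (PiM I (\<lambda>_. borel :: real measure))) = space (PiM I (\<lambda>_. borel :: real measure))" by simp
      show "emeasure P (space (PiM I (\<lambda>_. borel))) \<noteq> \<infinity>"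
        by (subst emP) (auto simp: emeasure_eq_measure)
    qed
    then show ?thesis using emP[OF E] emQ[OF E] by simp
  qed
  have "distr M borel Z \<Otimes>\<^sub>M distr M (PiM I (\<lambda>_. borel)) V = distr M (borel \<Otimes>\<^sub>M PiM I (\<lambda>_. borel)) (\<lambda>\<omega>. (Z \<omega>, V \<omega>))"
  proof (rule pair_measure_eqI)
    show "sigma_finite_measure (distr M borel Z)" "sigma_finite_measure (distr M (PiM I (\<lambda>_. borel)) V)" by unfold_locales
    show "sets (distr M borel Z \<Otimes>\<^sub>M distr M (PiM I (\<lambda>_. borel)) V) = sets (distr M (borel \<Otimes>\<^sub>M PiM I (\<lambda>_. borel)) (\<lambda>\<omega>. (Z \<omega>, V \<omega>)))"
      by (simp cong: sets_pair_measure_cong)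
    fix A E assume "A \<in> sets (distr M borel Z)" "E \<in> sets (distr M (PiM I (\<lambda>_. borel)) V)"
    then have [measurable]: "A \<in> sets borel" "E \<in> sets (PiM I (\<lambda>_. borel))" by auto
    have "(\<lambda>\<omega>. (Z \<omega>, V \<omega>)) -` (A \<times> E) \<inter> space M = {\<omega>\<in>space M. Z \<omega> \<in> A \<and> V \<omega> \<in> E}" by auto
    moreover have "Z -` A \<inter> space M = {\<omega>\<in>space M. Z \<omega> \<in> A}" "V -` E \<inter> space M = {\<omega>\<in>space M. V \<omega> \<in> E}" by auto
    ultimately show "emeasure (distr M borel Z) A * emeasure (distr M (PiM I (\<lambda>_. borel)) V) E
       = emeasure (distr M (borel \<Otimes>\<^sub>M PiM I (\<lambda>_. borel)) (\<lambda>\<omega>. (Z \<omega>, V \<omega>))) (A \<times> E)"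
      by (simp add: emeasure_distr rect)
  qed
  then show ?thesis by (simp add: V_def[abs_def])
qed

end

section \<open>Gaussian moments and regression on one coordinate\<close>

lemma gaussian_process_measurable:
  assumes "gaussian_process M X" "0 \<le> t"
  shows "X t \<in> borel_measurable M"
proof -
  have "gaussian_rv M (\<lambda>\<omega>. \<Sum>u\<in>{t}. 1 * X u \<omega>)"
    using assms(1)[unfolded gaussian_process_def, rule_format, of "{t}" "\<lambda>_. 1"] assms(2) by simp
  then show ?thesis by (simp add: gaussian_rv_def)
qed

context prob_space
begin

text \<open>Degenerate and normal variables obey a common formula for the characteristic function,
  variance 0 included, so later arguments need no case distinction.\<close>

lemma gaussian_rv_moments:
  assumes X: "gaussian_rv M X"
  shows "X \<in> borel_measurable M" "integrable M X" "integrable M (\<lambda>\<omega>. (X \<omega> - expectation X)\<^sup>2)"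
    "(CLINT \<omega>|M. iexp (X \<omega>)) = iexp (expectation X) * complex_of_real (exp (- variance X / 2))"
proof -
  show [measurable]: "X \<in> borel_measurable M" using X by (simp add: gaussian_rv_def)
  consider m where "AE \<omega> in M. X \<omega> = m" | m \<sigma> where "0 < \<sigma>" "distributed M lborel X (\<lambda>x. ennreal (normal_density m \<sigma> x))"
    using X by (auto simp: gaussian_rv_def)
  then have "integrable M X \<and> integrable M (\<lambda>\<omega>. (X \<omega> - expectation X)\<^sup>2) \<and>
    (CLINT \<omega>|M. iexp (X \<omega>)) = iexp (expectation X) * complex_of_real (exp (- variance X / 2))"
  proof cases
    case 1
    have int: "integrable M X"
      by (rule integrable_const_bound[where B="\<bar>m\<bar>"]) (use 1 in auto)
    have E: "expectation X = m"
    proof -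
      have "expectation X = (LINT \<omega>|M. m)" by (rule integral_cong_AE) (use 1 in auto)
      then show ?thesis by (simp add: prob_space)
    qed
    have z: "AE \<omega> in M. (X \<omega> - m)\<^sup>2 = 0" using 1 by eventually_elim simp
    have int2: "integrable M (\<lambda>\<omega>. (X \<omega> - m)\<^sup>2)"
      by (rule integrable_const_bound[where B=0]) (use z in auto)
    have V: "(LINT \<omega>|M. (X \<omega> - m)\<^sup>2) = 0" by (rule integral_eq_zero_AE[OF z])
    have "(CLINT \<omega>|M. iexp (X \<omega>)) = (CLINT \<omega>|M. iexp m)"
      by (rule integral_cong_AE) (use 1 in \<open>auto elim: eventually_mono\<close>)
    then show ?thesis using int int2 V by (simp add: E prob_space)
  next
    case 2
    note D = 2(2)
    have E: "expectation X = m" by (rule normal_distributed_expectation[OF 2])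
    have V: "variance X = \<sigma>\<^sup>2" by (rule normal_distributed_variance[OF 2])
    \<comment> \<open>A nonintegrable function has Bochner integral 0, whereas the known variance
      \<open>\<sigma>\<^sup>2\<close> is positive.\<close>
    have int2: "integrable M (\<lambda>\<omega>. (X \<omega> - m)\<^sup>2)"
      using not_integrable_integral_eq[of M "\<lambda>\<omega>. (X \<omega> - m)\<^sup>2"] V 2(1) by (auto simp: E)
    have "integrable M (\<lambda>\<omega>. X \<omega> - m)"
      by (rule square_integrable_imp_integrable[OF _ int2]) simp
    then have "integrable M (\<lambda>\<omega>. (X \<omega> - m) + m)" by (intro Bochner_Integration.integrable_add) auto
    then have int: "integrable M X" by simp
    define Y where "Y \<omega> = (X \<omega> - m) / \<sigma>" for \<omega>
    have Y: "distributed M lborel Y (\<lambda>x. ennreal (std_normal_density x))"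
      using normal_standard_normal_convert[OF 2(1), of X m] D by (simp add: Y_def[abs_def])
    have "(CLINT \<omega>|M. iexp (\<sigma> * Y \<omega>)) = (CLINT x|distr M lborel Y. iexp (\<sigma> * x))"
      by (rule integral_distr[symmetric]) (auto simp: Y_def)
    also have "distr M lborel Y = std_normal_distribution"
      using Y by (simp add: distributed_def)
    also have "(CLINT x|std_normal_distribution. iexp (\<sigma> * x)) = complex_of_real (exp (- (\<sigma>\<^sup>2) / 2))"
      using char_std_normal_distribution by (auto simp: char_def fun_eq_iff)
    finally have cY: "(CLINT \<omega>|M. iexp (\<sigma> * Y \<omega>)) = complex_of_real (exp (- (\<sigma>\<^sup>2) / 2))" .
    have "(CLINT \<omega>|M. iexp (X \<omega>)) = (CLINT \<omega>|M. iexp m * iexp (\<sigma> * Y \<omega>))"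
      using 2(1) by (intro Bochner_Integration.integral_cong refl) (simp add: Y_def exp_add[symmetric] distrib_left[symmetric])
    also have "\<dots> = iexp m * (CLINT \<omega>|M. iexp (\<sigma> * Y \<omega>))" by (rule integral_mult_right_zero)
    finally show ?thesis using int int2 V cY unfolding E by simp
  qed
  then show "integrable M X" "integrable M (\<lambda>\<omega>. (X \<omega> - expectation X)\<^sup>2)"
    "(CLINT \<omega>|M. iexp (X \<omega>)) = iexp (expectation X) * complex_of_real (exp (- variance X / 2))"
    by auto
qed

lemma integrable_product_of_squares:
  fixes X Y :: "'a \<Rightarrow> real"
  assumes [measurable]: "X \<in> borel_measurable M" "Y \<in> borel_measurable M"
    and "integrable M (\<lambda>\<omega>. (X \<omega>)\<^sup>2)" "integrable M (\<lambda>\<omega>. (Y \<omega>)\<^sup>2)"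
  shows "integrable M (\<lambda>\<omega>. X \<omega> * Y \<omega>)"
proof (rule Bochner_Integration.integrable_bound[of _ "\<lambda>\<omega>. (X \<omega>)\<^sup>2 + (Y \<omega>)\<^sup>2"])
  have "\<bar>x * y\<bar> \<le> x\<^sup>2 + y\<^sup>2" for x y :: real
  proof -
    have "2 * (\<bar>x\<bar> * \<bar>y\<bar>) \<le> x\<^sup>2 + y\<^sup>2"
      using sum_squares_bound[of "\<bar>x\<bar>" "\<bar>y\<bar>"] by (simp add: mult.assoc)
    moreover have "0 \<le> \<bar>x\<bar> * \<bar>y\<bar>" by simp
    ultimately show ?thesis unfolding abs_mult by linarith
  qed
  then show "AE \<omega> in M. norm (X \<omega> * Y \<omega>) \<le> norm ((X \<omega>)\<^sup>2 + (Y \<omega>)\<^sup>2)"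
    by (auto simp: abs_of_nonneg)
qed (use assms in auto)

text \<open>Zero covariance makes variances add, and the Gaussian characteristic function depends on
  mean and variance through an exponential, hence factorises.\<close>

lemma gaussian_char_factor:
  assumes V: "gaussian_rv M V" and W: "gaussian_rv M W" and VW: "gaussian_rv M (\<lambda>\<omega>. V \<omega> + W \<omega>)"
    and uncorr: "covariance M V W = 0"
  shows "(CLINT \<omega>|M. iexp (V \<omega> + W \<omega>)) = (CLINT \<omega>|M. iexp (V \<omega>)) * (CLINT \<omega>|M. iexp (W \<omega>))"
proof -
  note v = gaussian_rv_moments[OF V] and w = gaussian_rv_moments[OF W] and vw = gaussian_rv_moments[OF VW]
  have [measurable]: "V \<in> borel_measurable M" "W \<in> borel_measurable M" using v w by auto
  have E: "expectation (\<lambda>\<omega>. V \<omega> + W \<omega>) = expectation V + expectation W"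
    using v w by simp
  have p: "integrable M (\<lambda>\<omega>. (V \<omega> - expectation V) * (W \<omega> - expectation W))"
    by (rule integrable_product_of_squares) (use v w in auto)
  have "variance (\<lambda>\<omega>. V \<omega> + W \<omega>) = (LINT \<omega>|M. ((V \<omega> - expectation V)\<^sup>2 + (W \<omega> - expectation W)\<^sup>2) + 2 * ((V \<omega> - expectation V) * (W \<omega> - expectation W)))"
    unfolding E by (intro Bochner_Integration.integral_cong refl) (simp add: power2_eq_square algebra_simps)
  also have "\<dots> = (variance V + variance W) + 2 * covariance M V W"
    unfolding covariance_def using v(3) w(3) p
    by (simp add: Bochner_Integration.integral_add)
  finally have "variance (\<lambda>\<omega>. V \<omega> + W \<omega>) = variance V + variance W" using uncorr by simp
  moreover have "iexp (x + y) = iexp x * iexp y" for x y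
    by (simp add: distrib_left exp_add)
  moreover have "exp (- (x + y) / 2) = exp (- x / 2) * exp (- y / 2)" for x y :: real
    unfolding exp_add[symmetric] by (simp add: diff_divide_distrib)
  ultimately show ?thesis
    unfolding v(4) w(4) vw(4) E by (simp only: of_real_mult mult_ac)
qed

text \<open>Given the residuals, \<open>B s\<close> keeps its own Gaussian density, which is at most
  \<open>1 / (\<sigma> * sqrt (2 * pi))\<close>. So the expectation is at most this constant times a
  bound for the Lebesgue integral in \<open>z\<close> that is uniform in the residuals
  \<open>r\<close>.\<close>

lemma gaussian_regression_bound:
  fixes B :: "real \<Rightarrow> 'a \<Rightarrow> real" and \<Phi> :: "real \<times> (real \<Rightarrow> real) \<Rightarrow> ennreal"
  assumes B: "gaussian_process M B" and I: "finite I" "I \<subseteq> {0..}" "s \<in> I"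
    and \<sigma>: "0 < \<sigma>" "covariance M (B s) (B s) = \<sigma>\<^sup>2"
    and [measurable]: "\<Phi> \<in> borel_measurable (borel \<Otimes>\<^sub>M PiM I (\<lambda>_. borel))"
    and D: "\<And>r. (\<integral>\<^sup>+z. \<Phi> (z, r) \<partial>lborel) \<le> ennreal D" and D0: "0 \<le> D"
  defines "\<rho> \<equiv> \<lambda>t. covariance M (B t) (B s) / \<sigma>\<^sup>2"
  shows "(\<integral>\<^sup>+\<omega>. \<Phi> (B s \<omega>, \<lambda>t\<in>I. B t \<omega> - \<rho> t * B s \<omega>) \<partial>M) \<le> ennreal (D / (\<sigma> * sqrt (2 * pi)))"
proof -
  have lin: "gaussian_rv M (\<lambda>\<omega>. \<Sum>t\<in>I. c t * B t \<omega>)" for c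
    using B I unfolding gaussian_process_def by blast
  have one: "gaussian_rv M (B t)" if "t \<in> I" for t
  proof -
    have "(\<Sum>u\<in>I. (if u = t then 1 else 0) * B u \<omega>) = B t \<omega>" for \<omega>
      using that I by (simp add: if_distrib[of "\<lambda>x. x * _"] cong: if_cong)
    then show ?thesis using lin[of "\<lambda>u. if u = t then 1 else 0"] by simp
  qed
  note mom = gaussian_rv_moments[OF one]
  \<comment> \<open>Set to 0 off \<open>I\<close> because the product-measure lemma wants
    measurability for every index.\<close>
  define R where "R t \<omega> = (if t \<in> I then B t \<omega> - \<rho> t * B s \<omega> else 0)" for t \<omega>
  have [measurable]: "B s \<in> borel_measurable M" using mom(1)[OF I(3)] .
  have [measurable]: "R t \<in> borel_measurable M" for t
    using mom(1)[of t] unfolding R_def by (cases "t \<in> I") auto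
  define m where "m t = expectation (B t)" for t
  have prod_int: "integrable M (\<lambda>\<omega>. (B t \<omega> - m t) * (B u \<omega> - m u))" if "t \<in> I" "u \<in> I" for t u
    by (rule integrable_product_of_squares) (use mom that in \<open>auto simp: m_def\<close>)
  have covR: "(LINT \<omega>|M. (B s \<omega> - m s) * (R t \<omega> - (m t - \<rho> t * m s))) = 0" if t: "t \<in> I" for t
  proof -
    have "(LINT \<omega>|M. (B s \<omega> - m s) * (R t \<omega> - (m t - \<rho> t * m s)))
      = (LINT \<omega>|M. (B t \<omega> - m t) * (B s \<omega> - m s) - \<rho> t * ((B s \<omega> - m s) * (B s \<omega> - m s)))"
      using t by (intro Bochner_Integration.integral_cong refl) (simp add: R_def algebra_simps)
    also have "\<dots> = covariance M (B t) (B s) - \<rho> t * covariance M (B s) (B s)"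
      unfolding covariance_def m_def[symmetric] using prod_int t I(3) by simp
    also have "\<dots> = 0" using \<sigma> by (simp add: \<rho>_def)
    finally show ?thesis .
  qed
  have intR: "integrable M (R t)" and ER: "expectation (R t) = m t - \<rho> t * m s" if t: "t \<in> I" for t
  proof -
    have e: "R t = (\<lambda>\<omega>. B t \<omega> - \<rho> t * B s \<omega>)" using t by (simp add: R_def fun_eq_iff)
    show "integrable M (R t)" "expectation (R t) = m t - \<rho> t * m s"
      unfolding e m_def using mom(2)[OF t] mom(2)[OF I(3)] by auto
  qed
  have factor: "(CLINT \<omega>|M. iexp (\<theta> * B s \<omega> + (\<Sum>t\<in>I. l t * R t \<omega>)))
       = (CLINT \<omega>|M. iexp (\<theta> * B s \<omega>)) * (CLINT \<omega>|M. iexp (\<Sum>t\<in>I. l t * R t \<omega>))" for \<theta> l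
  proof (rule gaussian_char_factor)
    let ?W = "\<lambda>\<omega>. \<Sum>t\<in>I. l t * R t \<omega>"
    have V_eq: "\<theta> * B s \<omega> = (\<Sum>t\<in>I. (if t = s then \<theta> else 0) * B t \<omega>)" for \<theta> \<omega>
      using I by (simp add: if_distrib[of "\<lambda>x. x * _"] cong: if_cong)
    \<comment> \<open>A combination of residuals is again a combination of the values of
      \<open>B\<close> on \<open>I\<close>; only the coefficient at \<open>s\<close> is corrected.
      This is why \<open>s \<in> I\<close> is assumed, and it makes every combination
      Gaussian.\<close>
    have W_eq: "?W \<omega> = (\<Sum>t\<in>I. (l t + (if t = s then - (\<Sum>u\<in>I. l u * \<rho> u) else 0)) * B t \<omega>)" for \<omega>
    proof -
      have "?W \<omega> = (\<Sum>t\<in>I. l t * B t \<omega>) + (- (\<Sum>u\<in>I. l u * \<rho> u)) * B s \<omega>"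
        by (simp add: R_def right_diff_distrib sum_subtractf sum_distrib_right mult.assoc)
      then show ?thesis unfolding V_eq by (simp add: distrib_right sum.distrib)
    qed
    show "gaussian_rv M (\<lambda>\<omega>. \<theta> * B s \<omega>)" unfolding V_eq by (rule lin)
    show "gaussian_rv M ?W" unfolding W_eq by (rule lin)
    show "gaussian_rv M (\<lambda>\<omega>. \<theta> * B s \<omega> + ?W \<omega>)"
      unfolding V_eq W_eq sum.distrib[symmetric] distrib_right[symmetric] by (rule lin)
    have EW: "expectation ?W = (\<Sum>t\<in>I. l t * (m t - \<rho> t * m s))"
      using intR by (subst Bochner_Integration.integral_sum) (auto simp: ER)
    have "covariance M (\<lambda>\<omega>. \<theta> * B s \<omega>) ?W = (LINT \<omega>|M. (\<Sum>t\<in>I. \<theta> * l t * ((B s \<omega> - m s) * (R t \<omega> - (m t - \<rho> t * m s)))))"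
      unfolding covariance_def EW
    proof (intro Bochner_Integration.integral_cong refl)
      fix \<omega>
      have "\<theta> * B s \<omega> - (LINT \<omega>|M. \<theta> * B s \<omega>) = \<theta> * (B s \<omega> - m s)"
        by (simp add: m_def right_diff_distrib)
      moreover have "?W \<omega> - (\<Sum>t\<in>I. l t * (m t - \<rho> t * m s)) = (\<Sum>t\<in>I. l t * (R t \<omega> - (m t - \<rho> t * m s)))"
        unfolding sum_subtractf[symmetric] right_diff_distrib[symmetric] ..
      ultimately show "(\<theta> * B s \<omega> - (LINT \<omega>|M. \<theta> * B s \<omega>)) * (?W \<omega> - (\<Sum>t\<in>I. l t * (m t - \<rho> t * m s)))
        = (\<Sum>t\<in>I. \<theta> * l t * ((B s \<omega> - m s) * (R t \<omega> - (m t - \<rho> t * m s))))"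
        by (simp only: sum_distrib_left mult_ac)
    qed
    also have "\<dots> = (\<Sum>t\<in>I. \<theta> * l t * (LINT \<omega>|M. (B s \<omega> - m s) * (R t \<omega> - (m t - \<rho> t * m s))))"
    proof (subst Bochner_Integration.integral_sum)
      fix t assume t: "t \<in> I"
      have "integrable M (\<lambda>\<omega>. (B s \<omega> - m s) * (B t \<omega> - m t) - \<rho> t * ((B s \<omega> - m s) * (B s \<omega> - m s)))"
        using prod_int t I(3) by simp
      also have "(\<lambda>\<omega>. (B s \<omega> - m s) * (B t \<omega> - m t) - \<rho> t * ((B s \<omega> - m s) * (B s \<omega> - m s))) = (\<lambda>\<omega>. (B s \<omega> - m s) * (R t \<omega> - (m t - \<rho> t * m s)))"
        using t by (simp add: R_def algebra_simps fun_eq_iff)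
      finally show "integrable M (\<lambda>\<omega>. \<theta> * l t * ((B s \<omega> - m s) * (R t \<omega> - (m t - \<rho> t * m s))))" by simp
    qed simp
    also have "\<dots> = 0" using covR by simp
    finally show "covariance M (\<lambda>\<omega>. \<theta> * B s \<omega>) ?W = 0" .
  qed
  define PZ where "PZ = distr M borel (B s)"
  define PR where "PR = distr M (PiM I (\<lambda>_. borel)) (\<lambda>\<omega>. \<lambda>t\<in>I. R t \<omega>)"
  have prod: "PZ \<Otimes>\<^sub>M PR = distr M (borel \<Otimes>\<^sub>M PiM I (\<lambda>_. borel)) (\<lambda>\<omega>. (B s \<omega>, \<lambda>t\<in>I. R t \<omega>))"
    unfolding PZ_def PR_def by (rule char_factor_imp_product_measure[OF I(1) _ _ factor]) auto
  interpret PZ: prob_space PZ unfolding PZ_def by (rule prob_space_distr) simp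
  interpret PR: prob_space PR unfolding PR_def by (rule prob_space_distr) measurable
  interpret P: pair_prob_space PZ PR ..
  \<comment> \<open>The degenerate alternative is excluded by \<open>\<sigma> > 0\<close>; in the
    other one the parameters are identified through mean and variance.\<close>
  have dens: "PZ = density lborel (\<lambda>x. ennreal (normal_density (m s) \<sigma> x))"
  proof -
    consider c where "AE \<omega> in M. B s \<omega> = c" | c \<tau> where "0 < \<tau>" "distributed M lborel (B s) (\<lambda>x. ennreal (normal_density c \<tau> x))"
      using one[OF I(3)] by (auto simp: gaussian_rv_def)
    then show ?thesis
    proof cases
      case 1
      have "m s = (LINT \<omega>|M. c)" unfolding m_def by (rule integral_cong_AE) (use 1 in auto)
      then have "m s = c" by (simp add: prob_space)
      then have "AE \<omega> in M. (B s \<omega> - m s) * (B s \<omega> - m s) = 0" using 1 by auto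
      then have "covariance M (B s) (B s) = 0" unfolding covariance_def m_def by (rule integral_eq_zero_AE)
      then show ?thesis using \<sigma> by simp
    next
      case 2
      have "m s = c" unfolding m_def by (rule normal_distributed_expectation[OF 2])
      moreover have "\<tau>\<^sup>2 = \<sigma>\<^sup>2"
        using normal_distributed_variance[OF 2] \<sigma>(2) by (simp add: covariance_def power2_eq_square)
      then have "\<tau> = \<sigma>" using 2(1) \<sigma>(1) by (simp add: power2_eq_iff_nonneg)
      moreover have "distr M borel (B s) = distr M lborel (B s)" by (rule distr_cong) auto
      ultimately show ?thesis using 2(2) unfolding PZ_def by (simp add: distributed_def)
    qed
  qed
  have dens_le: "normal_density (m s) \<sigma> x \<le> 1 / (\<sigma> * sqrt (2 * pi))" for x
  proof -
    have "normal_density (m s) \<sigma> x \<le> 1 / sqrt (2 * pi * \<sigma>\<^sup>2) * 1"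
      unfolding normal_density_def by (intro mult_left_mono) auto
    then show ?thesis using \<sigma>(1) by (simp add: real_sqrt_mult mult.commute)
  qed
  have "(\<integral>\<^sup>+\<omega>. \<Phi> (B s \<omega>, \<lambda>t\<in>I. B t \<omega> - \<rho> t * B s \<omega>) \<partial>M) = (\<integral>\<^sup>+\<omega>. \<Phi> (B s \<omega>, \<lambda>t\<in>I. R t \<omega>) \<partial>M)"
    by (intro nn_integral_cong arg_cong[where f=\<Phi>]) (auto simp: R_def restrict_def)
  also have "\<dots> = (\<integral>\<^sup>+x. \<Phi> x \<partial>(PZ \<Otimes>\<^sub>M PR))"
    unfolding prod by (rule nn_integral_distr[symmetric]) measurable
  also have "\<dots> = (\<integral>\<^sup>+r. (\<integral>\<^sup>+z. \<Phi> (z, r) \<partial>PZ) \<partial>PR)"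
    by (rule P.nn_integral_snd[symmetric]) (simp add: PZ_def PR_def cong: measurable_cong_sets)
  also have "\<dots> \<le> (\<integral>\<^sup>+r. ennreal (D / (\<sigma> * sqrt (2 * pi))) \<partial>PR)"
  proof (rule nn_integral_mono)
    fix r assume "r \<in> space PR"
    then have [measurable]: "(\<lambda>z. \<Phi> (z, r)) \<in> borel_measurable borel"
      by (intro measurable_compose[OF _ assms(7)] measurable_Pair) (auto simp: PR_def)
    have "(\<integral>\<^sup>+z. \<Phi> (z, r) \<partial>PZ) = (\<integral>\<^sup>+z. ennreal (normal_density (m s) \<sigma> z) * \<Phi> (z, r) \<partial>lborel)"
      unfolding dens by (rule nn_integral_density) auto
    also have "\<dots> \<le> (\<integral>\<^sup>+z. ennreal (1 / (\<sigma> * sqrt (2 * pi))) * \<Phi> (z, r) \<partial>lborel)"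
      using dens_le by (intro nn_integral_mono mult_right_mono ennreal_leI) auto
    also have "\<dots> = ennreal (1 / (\<sigma> * sqrt (2 * pi))) * (\<integral>\<^sup>+z. \<Phi> (z, r) \<partial>lborel)"
      by (rule nn_integral_cmult) simp
    also have "\<dots> \<le> ennreal (1 / (\<sigma> * sqrt (2 * pi))) * ennreal D"
      using D by (rule mult_left_mono) simp
    also have "\<dots> = ennreal (D / (\<sigma> * sqrt (2 * pi)))"
      using \<sigma>(1) D0 by (simp add: ennreal_mult[symmetric])
    finally show "(\<integral>\<^sup>+z. \<Phi> (z, r) \<partial>PZ) \<le> ennreal (D / (\<sigma> * sqrt (2 * pi)))" .
  qed
  also have "\<dots> = ennreal (D / (\<sigma> * sqrt (2 * pi)))" by (simp add: PR.emeasure_space_1)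
  finally show ?thesis .
qed

end

section \<open>Regularity of the averaged process\<close>

text \<open>After shifting, the integral is that of \<open>h\<close> over
  \<open>{p+\<eta>..q+\<eta>}\<close> minus that over \<open>{p-\<eta>..q-\<eta>}\<close>. The
  common part cancels, and the excess lies in \<open>{q-\<eta>..q+\<eta>}\<close>, so the bound does
  not depend on \<open>p\<close> and \<open>q\<close>.\<close>

lemma nn_integral_mono_increment_le:
  fixes h :: "real \<Rightarrow> real"
  assumes h: "mono h" and ha: "\<And>x. a \<le> h x" "\<And>x. h x \<le> a + \<Lambda>" and \<eta>: "0 < \<eta>" and pq: "p \<le> q"
  shows "(\<integral>\<^sup>+y. ennreal ((h (y + \<eta>) - h (y - \<eta>)) * indicator {p..q} y) \<partial>lborel) \<le> ennreal (2 * \<eta> * \<Lambda>)"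
proof -
  have [measurable]: "h \<in> borel_measurable borel" by (rule borel_measurable_mono[OF h])
  \<comment> \<open>Increments are unchanged, and nonnegativity allows the left strip, which enters
    with a minus sign, to be dropped.\<close>
  define k where "k x = h x - a" for x
  have [measurable]: "k \<in> borel_measurable borel" unfolding k_def by simp
  have k: "0 \<le> k x" "k x \<le> \<Lambda>" for x using ha[of x] by (auto simp: k_def)
  have int: "integrable lborel (\<lambda>y. indicator {u..v} y * k (y + c))" for u v c
    by (rule integrableI_bounded_set[where A="{u..v}" and B=\<Lambda>])
      (use k in \<open>auto simp: emeasure_lborel_Icc_eq indicator_def\<close>)
  have shift: "(LINT y|lborel. indicator {p..q} y * k (y + c)) = (LINT y|lborel. indicator {p+c..q+c} y * k (y + 0))" for c
  proof -
    have "(LINT y|lborel. indicator {p+c..q+c} y * k (y + 0)) = (LINT y|lborel. indicator {p+c..q+c} (c + 1 * y) * k (c + 1 * y + 0))"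
      using lborel_integral_real_affine[of 1 "\<lambda>y. indicator {p+c..q+c} y * k (y + 0)" c] by simp
    also have "\<dots> = (LINT y|lborel. indicator {p..q} y * k (y + c))"
      by (intro Bochner_Integration.integral_cong refl) (auto simp: indicator_def add.commute)
    finally show ?thesis by simp
  qed
  have eq: "(h (y + \<eta>) - h (y - \<eta>)) * indicator {p..q} y = indicator {p..q} y * k (y + \<eta>) - indicator {p..q} y * k (y + (- \<eta>))" for y
    by (simp add: k_def algebra_simps)
  have 1: "(\<integral>\<^sup>+y. ennreal ((h (y + \<eta>) - h (y - \<eta>)) * indicator {p..q} y) \<partial>lborel)
     = ennreal (LINT y|lborel. (h (y + \<eta>) - h (y - \<eta>)) * indicator {p..q} y)"
  proof (rule nn_integral_eq_integral)
    show "integrable lborel (\<lambda>y. (h (y + \<eta>) - h (y - \<eta>)) * indicator {p..q} y)"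
      unfolding eq by (intro Bochner_Integration.integrable_diff int)
    have "0 \<le> (h (y + \<eta>) - h (y - \<eta>)) * indicator {p..q} y" for y
      using monoD[OF h, of "y - \<eta>" "y + \<eta>"] \<eta> by simp
    then show "AE y in lborel. 0 \<le> (h (y + \<eta>) - h (y - \<eta>)) * indicator {p..q} y" by simp
  qed
  have "(LINT y|lborel. (h (y + \<eta>) - h (y - \<eta>)) * indicator {p..q} y)
     = (LINT y|lborel. indicator {p+\<eta>..q+\<eta>} y * k (y + 0) - indicator {p+(-\<eta>)..q+(-\<eta>)} y * k (y + 0))"
    unfolding eq Bochner_Integration.integral_diff[OF int int] shift ..
  also have "\<dots> \<le> (LINT y|lborel. \<Lambda> * indicator {q-\<eta>..q+\<eta>} y)"
  proof (rule integral_mono)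
    show "integrable lborel (\<lambda>y. indicator {p+\<eta>..q+\<eta>} y * k (y + 0) - indicator {p+(-\<eta>)..q+(-\<eta>)} y * k (y + 0))"
      by (intro Bochner_Integration.integrable_diff int)
    show "integrable lborel (\<lambda>y. \<Lambda> * indicator {q-\<eta>..q+\<eta>} y)" by (auto simp: emeasure_lborel_Icc_eq)
    show "indicator {p+\<eta>..q+\<eta>} y * k (y + 0) - indicator {p+(-\<eta>)..q+(-\<eta>)} y * k (y + 0) \<le> \<Lambda> * indicator {q-\<eta>..q+\<eta>} y" for y
      using k[of y] \<eta> pq by (auto simp: indicator_def)
  qed
  also have "\<dots> = 2 * \<eta> * \<Lambda>" using \<eta> by simp
  finally show ?thesis unfolding 1 by (rule ennreal_leI)
qed

text \<open>Since increments of \<open>h\<close> over the window are nonnegative, \<open>v\<close>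
  may be enlarged to \<open>x'\<close>, and then \<open>y = x z\<close> reduces the claim to the
  preceding estimate. The bound sees neither the curve \<open>x\<close> nor its range.\<close>

lemma nn_integral_increment_along_path_le:
  fixes h x x' v :: "real \<Rightarrow> real"
  assumes h: "mono h" and ha: "\<And>y. a \<le> h y" "\<And>y. h y \<le> a + \<Lambda>" and \<eta>: "0 < \<eta>"
    and x: "\<And>z. (x has_real_derivative x' z) (at z)" and x': "continuous_on UNIV x'"
    and v[measurable]: "v \<in> borel_measurable borel" "\<And>z. 0 \<le> v z" "\<And>z. v z \<le> x' z"
  shows "(\<integral>\<^sup>+z. ennreal ((h (x z + \<eta>) - h (x z - \<eta>)) * v z) \<partial>lborel) \<le> ennreal (2 * \<eta> * \<Lambda>)"
proof -
  have [measurable]: "h \<in> borel_measurable borel" by (rule borel_measurable_mono[OF h])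
  have "continuous_on UNIV x" by (intro continuous_at_imp_continuous_on ballI DERIV_isCont[OF x])
  then have [measurable]: "x \<in> borel_measurable borel" by (rule borel_measurable_continuous_onI)
  define g where "g z = (h (x z + \<eta>) - h (x z - \<eta>)) * v z" for z
  have g0: "0 \<le> g z" for z using monoD[OF h, of "x z - \<eta>" "x z + \<eta>"] \<eta> v(2)[of z] by (simp add: g_def)
  \<comment> \<open>The substitution rule is for compact intervals; the bound is uniform over the
    windows \<open>{- real n..real n}\<close>, which exhaust the line monotonically.\<close>
  define F where "F n z = ennreal (g z * indicator {- real n..real n} z)" for n :: nat and z
  have "ennreal (g z) = (SUP n. F n z)" for z
  proof (rule antisym)
    obtain n :: nat where n: "\<bar>z\<bar> \<le> real n" using real_arch_simple by blast
    then have "ennreal (g z) = F n z" by (auto simp: F_def indicator_def)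
    then show "ennreal (g z) \<le> (SUP n. F n z)" using SUP_upper[of n UNIV "\<lambda>n. F n z"] by simp
    show "(SUP n. F n z) \<le> ennreal (g z)"
      by (rule SUP_least) (auto simp: F_def indicator_def g0)
  qed
  then have "(\<integral>\<^sup>+z. ennreal (g z) \<partial>lborel) = (\<integral>\<^sup>+z. (SUP n. F n z) \<partial>lborel)" by (simp only:)
  also have "\<dots> = (SUP n. (\<integral>\<^sup>+z. F n z \<partial>lborel))"
  proof (rule nn_integral_monotone_convergence_SUP)
    show "incseq F"
      unfolding incseq_def le_fun_def
    proof (intro allI impI)
      fix m n :: nat and z :: real assume "m \<le> n"
      then have "indicator {- real m..real m} z \<le> (indicator {- real n..real n} z :: real)"
        by (auto simp: indicator_def)
      then show "F m z \<le> F n z" unfolding F_def by (intro ennreal_leI mult_left_mono g0)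
    qed
    show "F n \<in> borel_measurable lborel" for n unfolding F_def g_def by measurable
  qed
  also have "\<dots> \<le> ennreal (2 * \<eta> * \<Lambda>)"
  proof (rule SUP_least)
    fix n :: nat
    have xle: "x (- real n) \<le> x (real n)"
    proof (rule DERIV_nonneg_imp_nondecreasing[of _ _ x])
      fix z show "\<exists>y. (x has_real_derivative y) (at z) \<and> 0 \<le> y"
        using x[of z] v(2,3)[of z] by (intro exI[of _ "x' z"]) auto
    qed simp
    have "(\<integral>\<^sup>+z. F n z \<partial>lborel) \<le> (\<integral>\<^sup>+z. ennreal ((h (x z + \<eta>) - h (x z - \<eta>)) * x' z * indicator {- real n..real n} z) \<partial>lborel)"
      unfolding F_def g_def
    proof (intro nn_integral_mono ennreal_leI mult_right_mono mult_left_mono v(3))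
      show "0 \<le> h (x z + \<eta>) - h (x z - \<eta>)" for z using monoD[OF h, of "x z - \<eta>" "x z + \<eta>"] \<eta> by simp
    qed simp
    also have "\<dots> = (\<integral>\<^sup>+y. ennreal ((h (y + \<eta>) - h (y - \<eta>)) * indicator {x (- real n)..x (real n)} y) \<partial>lborel)"
    proof (rule nn_integral_substitution[where f="\<lambda>y. h (y + \<eta>) - h (y - \<eta>)" and g=x and g'=x' and a="- real n" and b="real n", symmetric])
      show "set_borel_measurable borel {x (- real n)..x (real n)} (\<lambda>y. h (y + \<eta>) - h (y - \<eta>))"
        unfolding set_borel_measurable_def by measurable
      show "(x has_real_derivative x' z) (at z)" for z by (rule x)
      show "continuous_on {- real n..real n} x'" using x' continuous_on_subset by blast
      show "0 \<le> x' z" for z by (rule order_trans[OF v(2) v(3)])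
    qed simp
    also have "\<dots> \<le> ennreal (2 * \<eta> * \<Lambda>)" by (rule nn_integral_mono_increment_le[OF h ha \<eta> xle])
    finally show "(\<integral>\<^sup>+z. F n z \<partial>lborel) \<le> ennreal (2 * \<eta> * \<Lambda>)" .
  qed
  finally show ?thesis by (simp add: g_def)
qed

text \<open>Right endpoints are used so that \<open>s\<close> itself is always a node: the
  regression conditions on \<open>B s\<close> and needs it among the sampled times.\<close>

lemma riemann_sum_tendsto:
  fixes f :: "real \<Rightarrow> real"
  assumes f: "continuous_on {0..s} f" and s: "0 < s"
  shows "(\<lambda>n. s / real (Suc n) * (\<Sum>i\<in>{1..Suc n}. f (s * real i / real (Suc n)))) \<longlonglongrightarrow> integral {0..s} f"
proof (rule LIMSEQ_I)
  fix e :: real assume e: "0 < e"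
  \<comment> \<open>The local errors add up to at most \<open>e' * s\<close>, that is
    \<open>e / 2\<close>.\<close>
  define e' where "e' = e / (2 * s)"
  have e': "0 < e'" using e s by (simp add: e'_def)
  have "uniformly_continuous_on {0..s} f" by (intro compact_uniformly_continuous f) simp
  then obtain d where d0: "0 < d" "\<forall>x\<in>{0..s}. \<forall>x'\<in>{0..s}. \<bar>x' - x\<bar> < d \<longrightarrow> \<bar>f x' - f x\<bar> < e'"
    using e' unfolding uniformly_continuous_on_def dist_real_def by blast
  have d: "0 < d" "\<And>x y. x \<in> {0..s} \<Longrightarrow> y \<in> {0..s} \<Longrightarrow> \<bar>x - y\<bar> < d \<Longrightarrow> \<bar>f x - f y\<bar> < e'"
    using d0 by blast+
  obtain n0 where n0: "s / d < real n0" using reals_Archimedean2 by blast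
  have "\<bar>s / real (Suc n) * (\<Sum>i\<in>{1..Suc n}. f (s * real i / real (Suc n))) - integral {0..s} f\<bar> < e" if n: "n0 \<le> n" for n
  proof -
    define N where "N = Suc n"
    define t where "t i = s * real i / real N" for i :: nat
    have N: "0 < real N" by (simp add: N_def)
    have "s / d < real N" using n0 n by (simp add: N_def)
    then have mesh: "s / real N < d" using d(1) N by (simp add: field_simps)
    have t_step: "t (Suc k) = t k + s / real N" for k by (simp add: t_def distrib_left add_divide_distrib)
    have t_bd: "0 \<le> t k" "k \<le> N \<Longrightarrow> t k \<le> s" for k
      using s N by (auto simp: t_def field_simps)
    have "\<bar>integral {0..t k} f - s / real N * (\<Sum>i\<in>{1..k}. f (t i))\<bar> \<le> real k * (e' * (s / real N))" if "k \<le> N" for k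
      using that
    proof (induction k)
      case 0
      then show ?case by (simp add: t_def)
    next
      case (Suc k)
      then have kN: "Suc k \<le> N" by simp
      have tt: "0 \<le> t k" "t k \<le> t (Suc k)" "t (Suc k) \<le> s" using t_bd[of k] t_bd[of "Suc k"] kN t_step[of k] s N by auto
      have c: "continuous_on {t k..t (Suc k)} f" by (rule continuous_on_subset[OF f]) (use tt in auto)
      have c0: "continuous_on {0..t (Suc k)} f" by (rule continuous_on_subset[OF f]) (use tt in auto)
      have "integral {0..t k} f + integral {t k..t (Suc k)} f = integral {0..t (Suc k)} f"
        by (rule Henstock_Kurzweil_Integration.integral_combine[OF tt(1,2) integrable_continuous_real[OF c0]])
      moreover have "\<bar>integral {t k..t (Suc k)} f - s / real N * f (t (Suc k))\<bar> \<le> e' * (s / real N)"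
      proof -
        have "integral {t k..t (Suc k)} (\<lambda>x. f x - f (t (Suc k))) = integral {t k..t (Suc k)} f - s / real N * f (t (Suc k))"
          using integrable_continuous_real[OF c] tt t_step[of k] by (subst Henstock_Kurzweil_Integration.integral_diff) auto
        moreover have "norm (integral {t k..t (Suc k)} (\<lambda>x. f x - f (t (Suc k)))) \<le> e' * (t (Suc k) - t k)"
        proof (rule integral_bound[OF tt(2)])
          show "continuous_on {t k..t (Suc k)} (\<lambda>x. f x - f (t (Suc k)))" by (intro continuous_intros c)
          fix x assume x: "x \<in> {t k..t (Suc k)}"
          then have "\<bar>x - t (Suc k)\<bar> < d" using t_step[of k] mesh by auto
          then show "norm (f x - f (t (Suc k))) \<le> e'" using d(2)[of x "t (Suc k)"] x tt by auto
        qed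
        ultimately show ?thesis using t_step[of k] by simp
      qed
      moreover have "\<bar>integral {0..t k} f - s / real N * (\<Sum>i\<in>{1..k}. f (t i))\<bar> \<le> real k * (e' * (s / real N))"
        using Suc by simp
      moreover have "s / real N * (\<Sum>i\<in>{1..Suc k}. f (t i)) = s / real N * (\<Sum>i\<in>{1..k}. f (t i)) + s / real N * f (t (Suc k))"
        by (simp add: distrib_left)
      moreover have "real (Suc k) * (e' * (s / real N)) = real k * (e' * (s / real N)) + e' * (s / real N)"
        by (simp only: of_nat_Suc distrib_right mult_1_left add.commute)
      ultimately show ?case by linarith
    qed
    from this[of N] have "\<bar>integral {0..s} f - s / real N * (\<Sum>i\<in>{1..N}. f (t i))\<bar> \<le> e' * s"
      using N by (simp add: t_def)
    also have "\<dots> < e" using e s by (simp add: e'_def)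
    finally show ?thesis unfolding N_def[symmetric] t_def by (simp add: abs_minus_commute)
  qed
  then show "\<exists>no. \<forall>n\<ge>no. norm (s / real (Suc n) * (\<Sum>i\<in>{1..Suc n}. f (s * real i / real (Suc n))) - integral {0..s} f) < e"
    unfolding real_norm_def by blast
qed

section \<open>Expected increments for the discretised and for the true average\<close>

context prob_space
begin

text \<open>With the residuals frozen, the averaged quantity is an increasing function of the value
  \<open>z\<close> of \<open>B s\<close>, and its derivative is at least the weight
  \<open>k * exp z\<close>. The estimate along a curve, uniform in the residuals, feeds the
  regression bound.\<close>

lemma asian_increment_bound_discrete:
  fixes B :: "real \<Rightarrow> 'a \<Rightarrow> real" and h :: "real \<Rightarrow> real"
  assumes B: "gaussian_process M B" and I: "finite I" "I \<subseteq> {0..}" "s \<in> I"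
    and \<sigma>: "0 < \<sigma>" "covariance M (B s) (B s) = \<sigma>\<^sup>2"
    and cov: "\<And>t. t \<in> I \<Longrightarrow> 0 \<le> covariance M (B t) (B s)"
    and h: "mono h" and ha: "\<And>y. a \<le> h y" "\<And>y. h y \<le> a + \<Lambda>" and \<eta>: "0 < \<eta>"
    and k: "0 \<le> k" and c: "0 \<le> c"
  shows "(\<integral>\<^sup>+\<omega>. ennreal ((h (k * exp (B s \<omega>) + c * (\<Sum>t\<in>I. exp (B t \<omega>)) + \<eta>) - h (k * exp (B s \<omega>) + c * (\<Sum>t\<in>I. exp (B t \<omega>)) - \<eta>)) * (k * exp (B s \<omega>))) \<partial>M)
     \<le> ennreal (2 * \<eta> * \<Lambda> / (\<sigma> * sqrt (2 * pi)))"
proof -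
  have [measurable]: "h \<in> borel_measurable borel" by (rule borel_measurable_mono[OF h])
  define \<rho> where "\<rho> t = covariance M (B t) (B s) / \<sigma>\<^sup>2" for t
  have \<rho>: "0 \<le> \<rho> t" if "t \<in> I" for t using cov[OF that] by (simp add: \<rho>_def)
  define x where "x r z = k * exp z + c * (\<Sum>t\<in>I. exp (\<rho> t * z + r t))" for r :: "real \<Rightarrow> real" and z
  define \<Phi> where "\<Phi> = (\<lambda>(z, r). ennreal ((h (x r z + \<eta>) - h (x r z - \<eta>)) * (k * exp z)))"
  have x_meas: "(\<lambda>(z, r). x r z) \<in> borel_measurable (borel \<Otimes>\<^sub>M PiM I (\<lambda>_. borel))"
    unfolding x_def by measurable
  have meas: "\<Phi> \<in> borel_measurable (borel \<Otimes>\<^sub>M PiM I (\<lambda>_. borel))"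
    unfolding \<Phi>_def using x_meas by measurable
  have bound: "(\<integral>\<^sup>+z. \<Phi> (z, r) \<partial>lborel) \<le> ennreal (2 * \<eta> * \<Lambda>)" for r
    unfolding \<Phi>_def prod.case
  proof (rule nn_integral_increment_along_path_le[OF h ha \<eta>])
    define x' where "x' z = k * exp z + c * (\<Sum>t\<in>I. exp (\<rho> t * z + r t) * \<rho> t)" for z
    show "(x r has_real_derivative x' z) (at z)" for z
      unfolding x_def x'_def by (auto intro!: derivative_eq_intros simp: mult.commute)
    show "continuous_on UNIV x'" unfolding x'_def by (intro continuous_intros)
    show "0 \<le> k * exp z" for z using k by simp
    \<comment> \<open>Nonnegative regression coefficients keep the sum in the derivative from
      competing with the first term.\<close>
    show "k * exp z \<le> x' z" for z
      unfolding x'_def using c \<rho> by (auto intro!: mult_nonneg_nonneg sum_nonneg)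
  qed simp
  \<comment> \<open>At \<open>z = B s \<omega>\<close> the regression parts are added back and the
    original values of \<open>B\<close> reappear.\<close>
  have "x (\<lambda>t\<in>I. B t \<omega> - \<rho> t * B s \<omega>) (B s \<omega>) = k * exp (B s \<omega>) + c * (\<Sum>t\<in>I. exp (B t \<omega>))" for \<omega>
    unfolding x_def by (auto intro!: arg_cong2[where f="(+)"] arg_cong2[where f="(*)"] sum.cong)
  then have "(\<integral>\<^sup>+\<omega>. ennreal ((h (k * exp (B s \<omega>) + c * (\<Sum>t\<in>I. exp (B t \<omega>)) + \<eta>) - h (k * exp (B s \<omega>) + c * (\<Sum>t\<in>I. exp (B t \<omega>)) - \<eta>)) * (k * exp (B s \<omega>))) \<partial>M)
    = (\<integral>\<^sup>+\<omega>. \<Phi> (B s \<omega>, \<lambda>t\<in>I. B t \<omega> - \<rho> t * B s \<omega>) \<partial>M)"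
    by (simp add: \<Phi>_def)
  also have "\<dots> \<le> ennreal (2 * \<eta> * \<Lambda> / (\<sigma> * sqrt (2 * pi)))"
    unfolding \<rho>_def
  proof (rule gaussian_regression_bound[OF B I \<sigma> meas bound])
    have "0 \<le> \<Lambda>" using ha[of 0] by linarith
    then show "0 \<le> 2 * \<eta> * \<Lambda>" using \<eta> by simp
  qed
  finally show ?thesis .
qed

text \<open>Riemann sums and Fatou's lemma. As \<open>h\<close> may jump, its values along the sums
  need not converge; instead the window is doubled, and monotonicity compares the two increments as
  soon as the sum is within \<open>\<eta>\<close> of the limit. The doubling accounts for the
  constant 4 in place of 2.\<close>

lemma asian_increment_bound:
  fixes B :: "real \<Rightarrow> 'a \<Rightarrow> real" and h :: "real \<Rightarrow> real"
  assumes B: "gaussian_process M B" and s: "0 < s" "s \<le> T"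
    and cont: "AE \<omega> in M. continuous_on {0..T} (\<lambda>t. B t \<omega>)"
    and \<sigma>: "0 < \<sigma>" "covariance M (B s) (B s) = \<sigma>\<^sup>2"
    and cov: "\<And>t. 0 \<le> t \<Longrightarrow> t \<le> s \<Longrightarrow> 0 \<le> covariance M (B t) (B s)"
    and h: "mono h" and ha: "\<And>y. a \<le> h y" "\<And>y. h y \<le> a + \<Lambda>" and \<eta>: "0 < \<eta>"
  defines "X \<equiv> \<lambda>\<omega>. (T - s) / T * exp (B s \<omega>) + 1 / T * integral {0..s} (\<lambda>u. exp (B u \<omega>))"
  shows "(\<integral>\<^sup>+\<omega>. ennreal ((h (X \<omega> + \<eta>) - h (X \<omega> - \<eta>)) * ((T - s) / T * exp (B s \<omega>))) \<partial>M)
     \<le> ennreal (4 * \<eta> * \<Lambda> / (\<sigma> * sqrt (2 * pi)))"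
proof -
  have [measurable]: "h \<in> borel_measurable borel" by (rule borel_measurable_mono[OF h])
  have T: "0 < T" using s by linarith
  define k where "k = (T - s) / T"
  have k: "0 \<le> k" using s T by (simp add: k_def)
  have Bm: "B t \<in> borel_measurable M" if "0 \<le> t" for t
    by (rule gaussian_process_measurable[OF B that])
  have Bs: "B s \<in> borel_measurable M" using Bm s by simp
  \<comment> \<open>All nodes are at most \<open>s\<close>, where the covariance with
    \<open>B s\<close> is assumed nonnegative; the node for \<open>i = Suc n\<close> is
    \<open>s\<close>.\<close>
  define I where "I n = (\<lambda>i. s * real i / real (Suc n)) ` {1..Suc n}" for n
  define c where "c n = 1 / T * (s / real (Suc n))" for n
  have c0: "0 \<le> c n" for n using s T by (simp add: c_def)
  have I: "finite (I n)" "I n \<subseteq> {0..}" "s \<in> I n" for n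
  proof -
    show "finite (I n)" "I n \<subseteq> {0..}" using s by (auto simp: I_def)
    show "s \<in> I n" unfolding I_def by (rule image_eqI[of _ _ "Suc n"]) auto
  qed
  have I_le: "t \<le> s" if tI: "t \<in> I n" for t n
  proof -
    obtain i where i: "i \<in> {1..Suc n}" "t = s * real i / real (Suc n)" using tI unfolding I_def by blast
    have "real i / real (Suc n) \<le> 1" using i(1) by (simp add: divide_le_eq)
    then have "s * (real i / real (Suc n)) \<le> s * 1" using s by (intro mult_left_mono) auto
    then show ?thesis using i by simp
  qed
  define Xn where "Xn n \<omega> = k * exp (B s \<omega>) + c n * (\<Sum>t\<in>I n. exp (B t \<omega>))" for n \<omega>
  have Xn_meas[measurable]: "Xn n \<in> borel_measurable M" for n
  proof -
    have "(\<lambda>\<omega>. exp (B t \<omega>)) \<in> borel_measurable M" if "t \<in> I n" for t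
      using Bm[of t] I(2)[of n] that by auto
    then have "(\<lambda>\<omega>. \<Sum>t\<in>I n. exp (B t \<omega>)) \<in> borel_measurable M" by (rule borel_measurable_sum)
    then show ?thesis unfolding Xn_def using Bs by simp
  qed
  have Xn_lim: "AE \<omega> in M. (\<lambda>n. Xn n \<omega>) \<longlonglongrightarrow> X \<omega>"
    using cont
  proof eventually_elim
    fix \<omega> assume c: "continuous_on {0..T} (\<lambda>t. B t \<omega>)"
    have "continuous_on {0..s} (\<lambda>u. exp (B u \<omega>))"
      by (intro continuous_intros continuous_on_subset[OF c]) (use s in auto)
    from riemann_sum_tendsto[OF this s(1)]
    have "(\<lambda>n. k * exp (B s \<omega>) + 1 / T * (s / real (Suc n) * (\<Sum>i\<in>{1..Suc n}. exp (B (s * real i / real (Suc n)) \<omega>)))) \<longlonglongrightarrow> X \<omega>"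
      unfolding X_def k_def by (intro tendsto_intros)
    moreover have "(\<Sum>t\<in>I n. exp (B t \<omega>)) = (\<Sum>i\<in>{1..Suc n}. exp (B (s * real i / real (Suc n)) \<omega>))" for n
      unfolding I_def using s by (subst sum.reindex) (auto simp: inj_on_def)
    ultimately show "(\<lambda>n. Xn n \<omega>) \<longlonglongrightarrow> X \<omega>" by (simp add: Xn_def c_def mult.assoc)
  qed
  define f where "f n \<omega> = ennreal ((h (Xn n \<omega> + 2 * \<eta>) - h (Xn n \<omega> - 2 * \<eta>)) * (k * exp (B s \<omega>)))" for n \<omega>
  have f_meas: "f n \<in> borel_measurable M" for n
    unfolding f_def using Bs by measurable
  have "(\<integral>\<^sup>+\<omega>. ennreal ((h (X \<omega> + \<eta>) - h (X \<omega> - \<eta>)) * ((T - s) / T * exp (B s \<omega>))) \<partial>M)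
     \<le> (\<integral>\<^sup>+\<omega>. liminf (\<lambda>n. f n \<omega>) \<partial>M)"
  proof (rule nn_integral_mono_AE)
    show "AE \<omega> in M. ennreal ((h (X \<omega> + \<eta>) - h (X \<omega> - \<eta>)) * ((T - s) / T * exp (B s \<omega>))) \<le> liminf (\<lambda>n. f n \<omega>)"
      using Xn_lim
    proof eventually_elim
      fix \<omega> assume lim: "(\<lambda>n. Xn n \<omega>) \<longlonglongrightarrow> X \<omega>"
      show "ennreal ((h (X \<omega> + \<eta>) - h (X \<omega> - \<eta>)) * ((T - s) / T * exp (B s \<omega>))) \<le> liminf (\<lambda>n. f n \<omega>)"
      proof (rule Liminf_bounded)
        have "eventually (\<lambda>n. dist (Xn n \<omega>) (X \<omega>) < \<eta>) sequentially" using lim \<eta> by (rule tendstoD)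
        then show "eventually (\<lambda>n. ennreal ((h (X \<omega> + \<eta>) - h (X \<omega> - \<eta>)) * ((T - s) / T * exp (B s \<omega>))) \<le> f n \<omega>) sequentially"
        proof eventually_elim
          case (elim n)
          then have "h (X \<omega> + \<eta>) \<le> h (Xn n \<omega> + 2 * \<eta>)" "h (Xn n \<omega> - 2 * \<eta>) \<le> h (X \<omega> - \<eta>)"
            by (auto simp: dist_real_def abs_less_iff intro!: monoD[OF h])
          then show ?case unfolding f_def k_def[symmetric] using k
            by (intro ennreal_leI mult_right_mono) auto
        qed
      qed
    qed
  qed
  also have "\<dots> \<le> liminf (\<lambda>n. \<integral>\<^sup>+\<omega>. f n \<omega> \<partial>M)" by (rule nn_integral_liminf[OF f_meas])
  also have "\<dots> \<le> ennreal (4 * \<eta> * \<Lambda> / (\<sigma> * sqrt (2 * pi)))"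
  proof (rule Liminf_le)
    have "(\<integral>\<^sup>+\<omega>. f n \<omega> \<partial>M) \<le> ennreal (2 * (2 * \<eta>) * \<Lambda> / (\<sigma> * sqrt (2 * pi)))" for n
      unfolding f_def Xn_def
      by (rule asian_increment_bound_discrete[OF B I \<sigma> _ h ha _ k c0]) (use cov I I_le \<eta> in \<open>auto simp: subset_eq\<close>)
    then show "eventually (\<lambda>n. (\<integral>\<^sup>+\<omega>. f n \<omega> \<partial>M) \<le> ennreal (4 * \<eta> * \<Lambda> / (\<sigma> * sqrt (2 * pi)))) sequentially"
      by simp
  qed simp
  finally show ?thesis .
qed

end

text \<open>Rounding the time down to the grid of mesh \<open>1 / Suc n\<close> gives a process with
  countably many time values, hence jointly measurable; by continuity it converges
  everywhere.\<close>

lemma borel_measurable_continuous_process: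
  fixes Y :: "real \<Rightarrow> 'a \<Rightarrow> real"
  assumes cont: "\<And>\<omega>. \<omega> \<in> space M \<Longrightarrow> continuous_on UNIV (\<lambda>t. Y t \<omega>)"
    and meas: "\<And>t. Y t \<in> borel_measurable M"
  shows "(\<lambda>(t, \<omega>). Y t \<omega>) \<in> borel_measurable (borel \<Otimes>\<^sub>M M)"
proof -
  define g where "g n t = of_int \<lfloor>real (Suc n) * t\<rfloor> / real (Suc n)" for n :: nat and t :: real
  have g: "(\<lambda>n. g n t) \<longlonglongrightarrow> t" for t
  proof (rule tendsto_sandwich)
    have "t - 1 / real (Suc n) \<le> g n t \<and> g n t \<le> t" for n
    proof -
      have "real (Suc n) * t - 1 \<le> of_int \<lfloor>real (Suc n) * t\<rfloor>" "of_int \<lfloor>real (Suc n) * t\<rfloor> \<le> real (Suc n) * t"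
        by linarith+
      from divide_right_mono[OF this(1), of "real (Suc n)"] divide_right_mono[OF this(2), of "real (Suc n)"]
      show ?thesis unfolding g_def by (simp add: diff_divide_distrib)
    qed
    then show "eventually (\<lambda>n. t - 1 / real (Suc n) \<le> g n t) sequentially" "eventually (\<lambda>n. g n t \<le> t) sequentially"
      by (auto intro!: always_eventually)
    show "(\<lambda>n. t - 1 / real (Suc n)) \<longlonglongrightarrow> t"
      using tendsto_diff[OF tendsto_const LIMSEQ_Suc[OF lim_1_over_n], of t] by simp
  qed simp
  show ?thesis
  proof (rule borel_measurable_LIMSEQ_real[where u="\<lambda>n p. case p of (t, \<omega>) \<Rightarrow> Y (g n t) \<omega>"])
    show "(\<lambda>n. case p of (t, \<omega>) \<Rightarrow> Y (g n t) \<omega>) \<longlonglongrightarrow> (case p of (t, \<omega>) \<Rightarrow> Y t \<omega>)" if pS: "p \<in> space (borel \<Otimes>\<^sub>M M)" for p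
    proof -
      obtain t \<omega> where p: "p = (t, \<omega>)" "\<omega> \<in> space M" using pS by (auto simp: space_pair_measure)
      have "isCont (\<lambda>t. Y t \<omega>) t"
        using cont[OF p(2)] by (simp add: continuous_on_eq_continuous_at)
      then show ?thesis using isCont_tendsto_compose[OF _ g[of t]] by (simp add: p)
    qed
    show "(\<lambda>p. case p of (t, \<omega>) \<Rightarrow> Y (g n t) \<omega>) \<in> borel_measurable (borel \<Otimes>\<^sub>M M)" for n
    proof -
      have "(\<lambda>p. (\<lambda>i p. Y (of_int i / real (Suc n)) (snd p)) \<lfloor>real (Suc n) * fst p\<rfloor> p) \<in> borel_measurable (borel \<Otimes>\<^sub>M M)"
      proof (rule measurable_compose_countable[where f="\<lambda>i p. Y (of_int i / real (Suc n)) (snd p)" and g="\<lambda>p. \<lfloor>real (Suc n) * fst p\<rfloor>"])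
        show "(\<lambda>p. Y (of_int i / real (Suc n)) (snd p)) \<in> borel_measurable (borel \<Otimes>\<^sub>M M)" for i :: int
          by (rule measurable_compose[OF measurable_snd meas])
        show "(\<lambda>p. \<lfloor>real (Suc n) * fst p\<rfloor>) \<in> measurable (borel \<Otimes>\<^sub>M M) (count_space UNIV)" by measurable
      qed
      then show ?thesis by (simp add: g_def case_prod_unfold)
    qed
  qed
qed

section \<open>Expected energy by Tonelli, and joint measurability\<close>

lemma covariance_fbm_nonneg:
  fixes H s t :: real
  assumes "0 < H" "0 \<le> t" "t \<le> s"
  shows "0 \<le> (t powr (2 * H) + s powr (2 * H) - \<bar>t - s\<bar> powr (2 * H)) / 2"
proof -
  have "\<bar>t - s\<bar> powr (2 * H) \<le> s powr (2 * H)"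
    using assms by (intro powr_mono2) auto
  also have "\<dots> \<le> t powr (2 * H) + s powr (2 * H)" by simp
  finally show ?thesis by simp
qed

text \<open>It suffices that the expected energy is finite. At lag \<open>r\<close> and time
  \<open>s\<close> the increment estimate gives a multiple of
  \<open>r powr \<gamma> * s powr (-H)\<close>; division by \<open>r powr (2 - \<gamma>)\<close>
  leaves a product of two powers, integrable at 0 since \<open>2 * \<gamma> - 2 > -1\<close> and
  \<open>H < 1\<close>.\<close>

lemma (in prob_space) asian_besov2_energy_finite:
  fixes B :: "real \<Rightarrow> 'a \<Rightarrow> real" and h :: "real \<Rightarrow> real" and T H \<gamma> K a \<Lambda> :: real
  defines "c \<equiv> \<lambda>x. max 0 (min x T)"
  defines "W \<equiv> \<lambda>s \<omega>. (T - c s) / T * exp (B (c s) \<omega>)"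
  defines "Y \<equiv> \<lambda>s \<omega>. W s \<omega> + 1 / T * integral {0..c s} (\<lambda>u. exp (B u \<omega>))"
  assumes B: "gaussian_process M B" and T: "0 < T" and H: "0 < H" "H < 1" and \<gamma>: "1 / 2 < \<gamma>" "\<gamma> < 1" and K: "0 < K"
    and cov: "\<And>s t. 0 \<le> s \<Longrightarrow> 0 \<le> t \<Longrightarrow> covariance M (B t) (B s) = (t powr (2 * H) + s powr (2 * H) - \<bar>t - s\<bar> powr (2 * H)) / 2"
    and cont: "\<And>\<omega>. \<omega> \<in> space M \<Longrightarrow> continuous_on {0..T} (\<lambda>t. B t \<omega>)"
    and h: "mono h" and ha: "\<And>y. a \<le> h y" "\<And>y. h y \<le> a + \<Lambda>"
  shows "AE \<omega> in M. (\<integral>\<^sup>+r\<in>{0..T}. (\<integral>\<^sup>+s\<in>{0..T}. ennreal ((h (Y s \<omega> + K * r powr \<gamma>) - h (Y s \<omega> - K * r powr \<gamma>))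
        * W s \<omega> / r powr ((1 - \<gamma>) + 1)) \<partial>lborel) \<partial>lborel) < \<infinity>"
proof -
  have c: "0 \<le> c x" "c x \<le> T" for x using T by (auto simp: c_def)
  have c_id: "c x = x" if "0 \<le> x" "x \<le> T" for x using that by (auto simp: c_def)
  have c_cont: "continuous_on UNIV c" unfolding c_def by (intro continuous_intros)
  have \<Lambda>0: "0 \<le> \<Lambda>" using ha[of 0] by linarith
  have Bm: "B t \<in> borel_measurable M" if "0 \<le> t" for t
    by (rule gaussian_process_measurable[OF B that])
  have expB_cont: "continuous_on {0..T} (\<lambda>t. exp (B t \<omega>))" if "\<omega> \<in> space M" for \<omega>
    by (intro continuous_intros cont that)
  define A where "A s \<omega> = integral {0..c s} (\<lambda>u. exp (B u \<omega>))" for s \<omega>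
  have comp_c: "continuous_on UNIV (\<lambda>s. f (c s))" if "continuous_on {0..T} f" for f :: "real \<Rightarrow> real"
    by (rule continuous_on_compose2[OF that c_cont]) (use c in auto)
  have A_joint: "(\<lambda>(s, \<omega>). A s \<omega>) \<in> borel_measurable (borel \<Otimes>\<^sub>M M)"
  proof (rule borel_measurable_continuous_process)
    fix \<omega> assume "\<omega> \<in> space M"
    then show "continuous_on UNIV (\<lambda>s. A s \<omega>)"
      unfolding A_def by (intro comp_c indefinite_integral_continuous_1 integrable_continuous_real expB_cont)
  next
    fix s
    show "A s \<in> borel_measurable M"
    proof (cases "c s = 0")
      case True
      then have "A s = (\<lambda>_. 0)" by (simp add: A_def fun_eq_iff)
      then show ?thesis by simp
    next
      case False
      then have s: "0 < c s" "c s \<le> T" using c[of s] by auto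
      \<comment> \<open>The integral of the path is a random variable as the limit of its Riemann
        sums; continuity of every path, not just almost every one, is used here.\<close>
      show ?thesis
      proof (rule borel_measurable_LIMSEQ_real[where u="\<lambda>n \<omega>. c s / real (Suc n) * (\<Sum>i\<in>{1..Suc n}. exp (B (c s * real i / real (Suc n)) \<omega>))"])
        fix \<omega> assume "\<omega> \<in> space M"
        then have "continuous_on {0..c s} (\<lambda>t. exp (B t \<omega>))"
          using expB_cont s by (meson atLeastatMost_subset_iff continuous_on_subset order_refl)
        then show "(\<lambda>n. c s / real (Suc n) * (\<Sum>i\<in>{1..Suc n}. exp (B (c s * real i / real (Suc n)) \<omega>))) \<longlonglongrightarrow> A s \<omega>"
          unfolding A_def using s(1) by (rule riemann_sum_tendsto)
      next
        fix n
        have "(\<lambda>\<omega>. exp (B (c s * real i / real (Suc n)) \<omega>)) \<in> borel_measurable M" for i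
          using Bm[of "c s * real i / real (Suc n)"] s by simp
        then have "(\<lambda>\<omega>. \<Sum>i\<in>{1..Suc n}. exp (B (c s * real i / real (Suc n)) \<omega>)) \<in> borel_measurable M"
          by (rule borel_measurable_sum)
        then show "(\<lambda>\<omega>. c s / real (Suc n) * (\<Sum>i\<in>{1..Suc n}. exp (B (c s * real i / real (Suc n)) \<omega>))) \<in> borel_measurable M"
          by (intro borel_measurable_times) auto
      qed
    qed
  qed
  have B_joint: "(\<lambda>(s, \<omega>). B (c s) \<omega>) \<in> borel_measurable (borel \<Otimes>\<^sub>M M)"
    by (rule borel_measurable_continuous_process) (use comp_c cont Bm c in auto)
  have [measurable]: "c \<in> borel_measurable borel" unfolding c_def by measurable
  have W_joint[measurable]: "case_prod W \<in> borel_measurable (borel \<Otimes>\<^sub>M M)"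
  proof -
    have "(\<lambda>p. (T - c (fst p)) / T * exp ((\<lambda>(s, \<omega>). B (c s) \<omega>) p)) \<in> borel_measurable (borel \<Otimes>\<^sub>M M)"
      using B_joint by measurable
    then show ?thesis by (simp add: W_def case_prod_unfold)
  qed
  have Y_joint[measurable]: "case_prod Y \<in> borel_measurable (borel \<Otimes>\<^sub>M M)"
  proof -
    have "(\<lambda>p. case_prod W p + 1 / T * (\<lambda>(s, \<omega>). A s \<omega>) p) \<in> borel_measurable (borel \<Otimes>\<^sub>M M)"
      using A_joint W_joint by measurable
    then show ?thesis by (simp add: Y_def A_def case_prod_unfold)
  qed
  have [measurable]: "h \<in> borel_measurable borel" by (rule borel_measurable_mono[OF h])
  define b where "b = 1 - \<gamma>"
  define g where "g r s \<omega> = (h (Y s \<omega> + K * r powr \<gamma>) - h (Y s \<omega> - K * r powr \<gamma>)) * W s \<omega>" for r s \<omega>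
  define G where "G r s \<omega> = ennreal (g r s \<omega> / r powr (b + 1)) * (indicator {0..T} s * indicator {0..T} r)" for r s \<omega>
  have G_meas: "(\<lambda>p. G (fst (fst p)) (snd p) (snd (fst p))) \<in> borel_measurable ((borel \<Otimes>\<^sub>M M) \<Otimes>\<^sub>M borel)"
    unfolding G_def g_def by measurable
  have G_meas': "(\<lambda>(s, \<omega>). G r s \<omega>) \<in> borel_measurable (borel \<Otimes>\<^sub>M M)" for r
    unfolding G_def g_def by measurable
  define Q where "Q \<omega> = (\<integral>\<^sup>+r. (\<integral>\<^sup>+s. G r s \<omega> \<partial>lborel) \<partial>lborel)" for \<omega>
  have inner_meas: "(\<lambda>(r, \<omega>). \<integral>\<^sup>+s. G r s \<omega> \<partial>lborel) \<in> borel_measurable (lborel \<Otimes>\<^sub>M M)"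
  proof -
    have "(\<lambda>p. \<integral>\<^sup>+s. (\<lambda>p. G (fst (fst p)) (snd p) (snd (fst p))) (p, s) \<partial>lborel) \<in> borel_measurable (lborel \<Otimes>\<^sub>M M)"
      using G_meas by (intro lborel.borel_measurable_nn_integral_fst) (simp cong: measurable_cong_sets sets_pair_measure_cong)
    then show ?thesis by (simp add: case_prod_unfold)
  qed
  interpret LM: pair_sigma_finite lborel M ..
  have Q_meas: "Q \<in> borel_measurable M"
    unfolding Q_def
    using measurable_pair_swap[OF inner_meas] by (intro lborel.borel_measurable_nn_integral) (simp add: case_prod_unfold)
  define C where "C = 4 * K * \<Lambda> / sqrt (2 * pi)"
  have C0: "0 \<le> C" using K \<Lambda>0 by (simp add: C_def)
  \<comment> \<open>At \<open>s = 0\<close> the variance of \<open>B s\<close> is 0 and the density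
    bound breaks down; the time 0 is later discarded as a null set.\<close>
  have bound: "(\<integral>\<^sup>+\<omega>. G r s \<omega> \<partial>M) \<le> ennreal (C * (indicator {0..T} r * r powr (2 * \<gamma> - 2)) * (indicator {0..T} s * s powr (- H)))"
    if s0: "s \<noteq> 0" for r s
  proof (cases "r \<in> {0<..T} \<and> s \<in> {0..T}")
    case True
    then have r: "0 < r" "r \<le> T" and s: "0 < s" "s \<le> T" using s0 by auto
    have \<eta>: "0 < K * r powr \<gamma>" using K r by simp
    have \<sigma>: "0 < s powr H" using s by simp
    have cov_s: "covariance M (B s) (B s) = (s powr H)\<^sup>2"
      using cov[of s s] s by (simp add: power2_eq_square flip: powr_add)
    have "(\<integral>\<^sup>+\<omega>. ennreal (g r s \<omega>) \<partial>M) \<le> ennreal (4 * (K * r powr \<gamma>) * \<Lambda> / (s powr H * sqrt (2 * pi)))"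
    proof -
      have "(\<integral>\<^sup>+\<omega>. ennreal (g r s \<omega>) \<partial>M) = (\<integral>\<^sup>+\<omega>. ennreal ((h ((T - s) / T * exp (B s \<omega>) + 1 / T * integral {0..s} (\<lambda>u. exp (B u \<omega>)) + K * r powr \<gamma>)
         - h ((T - s) / T * exp (B s \<omega>) + 1 / T * integral {0..s} (\<lambda>u. exp (B u \<omega>)) - K * r powr \<gamma>)) * ((T - s) / T * exp (B s \<omega>))) \<partial>M)"
        using s by (simp add: g_def Y_def W_def c_id)
      also have "\<dots> \<le> ennreal (4 * (K * r powr \<gamma>) * \<Lambda> / (s powr H * sqrt (2 * pi)))"
      proof (rule asian_increment_bound[OF B s _ \<sigma> cov_s _ h ha \<eta>])
        show "AE \<omega> in M. continuous_on {0..T} (\<lambda>t. B t \<omega>)" using cont by (intro AE_I2)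
        show "0 \<le> covariance M (B t) (B s)" if "0 \<le> t" "t \<le> s" for t
          using cov[of s t] covariance_fbm_nonneg[OF H(1) that] that by simp
      qed
      finally show ?thesis .
    qed
    moreover have "(\<integral>\<^sup>+\<omega>. G r s \<omega> \<partial>M) = (\<integral>\<^sup>+\<omega>. ennreal (1 / r powr (b + 1)) * ennreal (g r s \<omega>) \<partial>M)"
      using r s by (intro nn_integral_cong) (simp add: G_def ennreal_mult'[symmetric])
    moreover have "\<dots> = ennreal (1 / r powr (b + 1)) * (\<integral>\<^sup>+\<omega>. ennreal (g r s \<omega>) \<partial>M)"
      unfolding g_def by (rule nn_integral_cmult) measurable
    ultimately have "(\<integral>\<^sup>+\<omega>. G r s \<omega> \<partial>M) \<le> ennreal (1 / r powr (b + 1)) * ennreal (4 * (K * r powr \<gamma>) * \<Lambda> / (s powr H * sqrt (2 * pi)))"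
      by (simp add: mult_left_mono)
    also have "\<dots> = ennreal (1 / r powr (b + 1) * (4 * (K * r powr \<gamma>) * \<Lambda> / (s powr H * sqrt (2 * pi))))"
      using \<Lambda>0 K by (intro ennreal_mult[symmetric]) auto
    also have "1 / r powr (b + 1) * (4 * (K * r powr \<gamma>) * \<Lambda> / (s powr H * sqrt (2 * pi))) = C * (r powr \<gamma> / r powr (b + 1)) * s powr (- H)"
      by (simp add: C_def powr_minus_divide mult_ac)
    also have "r powr \<gamma> / r powr (b + 1) = r powr (2 * \<gamma> - 2)"
      using r by (simp add: powr_diff[symmetric] b_def)
    finally show ?thesis using r s by simp
  next
    case False
    then have "G r s \<omega> = 0" for \<omega> by (auto simp: G_def indicator_def)
    then show ?thesis by simp
  qed
  have "(\<integral>\<^sup>+\<omega>. Q \<omega> \<partial>M) = (\<integral>\<^sup>+r. (\<integral>\<^sup>+\<omega>. (\<integral>\<^sup>+s. G r s \<omega> \<partial>lborel) \<partial>M) \<partial>lborel)"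
    unfolding Q_def by (rule LM.Fubini'[OF inner_meas])
  also have "\<dots> = (\<integral>\<^sup>+r. (\<integral>\<^sup>+s. (\<integral>\<^sup>+\<omega>. G r s \<omega> \<partial>M) \<partial>lborel) \<partial>lborel)"
  proof (rule nn_integral_cong)
    fix r :: real
    have "(\<lambda>(s, \<omega>). G r s \<omega>) \<in> borel_measurable (lborel \<Otimes>\<^sub>M M)"
      using G_meas' by (simp cong: measurable_cong_sets sets_pair_measure_cong)
    then show "(\<integral>\<^sup>+\<omega>. (\<integral>\<^sup>+s. G r s \<omega> \<partial>lborel) \<partial>M) = (\<integral>\<^sup>+s. (\<integral>\<^sup>+\<omega>. G r s \<omega> \<partial>M) \<partial>lborel)"
      by (rule LM.Fubini')
  qed
  also have "\<dots> \<le> (\<integral>\<^sup>+r. (\<integral>\<^sup>+s. ennreal (C * (indicator {0..T} r * r powr (2 * \<gamma> - 2)) * (indicator {0..T} s * s powr (- H))) \<partial>lborel) \<partial>lborel)"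
  proof (rule nn_integral_mono)
    fix r :: real
    have "AE s::real in lborel. s \<noteq> 0" by (rule AE_lborel_singleton)
    then have "AE s in lborel. (\<integral>\<^sup>+\<omega>. G r s \<omega> \<partial>M) \<le> ennreal (C * (indicator {0..T} r * r powr (2 * \<gamma> - 2)) * (indicator {0..T} s * s powr (- H)))"
      by eventually_elim (rule bound)
    then show "(\<integral>\<^sup>+s. (\<integral>\<^sup>+\<omega>. G r s \<omega> \<partial>M) \<partial>lborel) \<le> (\<integral>\<^sup>+s. ennreal (C * (indicator {0..T} r * r powr (2 * \<gamma> - 2)) * (indicator {0..T} s * s powr (- H))) \<partial>lborel)"
      by (rule nn_integral_mono_AE)
  qed
  also have "\<dots> = (\<integral>\<^sup>+r. ennreal (C * (T powr (1 - H) / (1 - H)) * (indicator {0..T} r * r powr (2 * \<gamma> - 2))) \<partial>lborel)"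
  proof (rule nn_integral_cong)
    fix r :: real
    have "has_bochner_integral lborel (\<lambda>s. indicator {0..T} s * (s - 0) powr (- H)) ((T - 0) powr (- H + 1) / (- H + 1))"
      using H T by (intro has_bochner_integral_powr) auto
    then have "has_bochner_integral lborel (\<lambda>s. C * (indicator {0..T} r * r powr (2 * \<gamma> - 2)) * (indicator {0..T} s * s powr (- H)))
      (C * (indicator {0..T} r * r powr (2 * \<gamma> - 2)) * (T powr (1 - H) / (1 - H)))"
      by (intro has_bochner_integral_mult_right) simp
    then have "(\<integral>\<^sup>+s. ennreal (C * (indicator {0..T} r * r powr (2 * \<gamma> - 2)) * (indicator {0..T} s * s powr (- H))) \<partial>lborel)
      = ennreal (C * (indicator {0..T} r * r powr (2 * \<gamma> - 2)) * (T powr (1 - H) / (1 - H)))"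
      by (rule nn_integral_eq_has_bochner) (use C0 in simp)
    then show "(\<integral>\<^sup>+s. ennreal (C * (indicator {0..T} r * r powr (2 * \<gamma> - 2)) * (indicator {0..T} s * s powr (- H))) \<partial>lborel)
      = ennreal (C * (T powr (1 - H) / (1 - H)) * (indicator {0..T} r * r powr (2 * \<gamma> - 2)))"
      by (simp only: mult_ac)
  qed
  also have "\<dots> = ennreal (C * (T powr (1 - H) / (1 - H)) * ((T - 0) powr (2 * \<gamma> - 2 + 1) / (2 * \<gamma> - 2 + 1)))"
  proof (rule nn_integral_eq_has_bochner)
    have "has_bochner_integral lborel (\<lambda>r. indicator {0..T} r * (r - 0) powr (2 * \<gamma> - 2)) ((T - 0) powr (2 * \<gamma> - 2 + 1) / (2 * \<gamma> - 2 + 1))"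
      using \<gamma> T by (intro has_bochner_integral_powr) auto
    then show "has_bochner_integral lborel (\<lambda>r. C * (T powr (1 - H) / (1 - H)) * (indicator {0..T} r * r powr (2 * \<gamma> - 2)))
       (C * (T powr (1 - H) / (1 - H)) * ((T - 0) powr (2 * \<gamma> - 2 + 1) / (2 * \<gamma> - 2 + 1)))"
      by (intro has_bochner_integral_mult_right) simp
    show "0 \<le> C * (T powr (1 - H) / (1 - H)) * (indicator {0..T} r * r powr (2 * \<gamma> - 2))" for r
      using C0 H by simp
  qed
  also have "\<dots> < \<infinity>" by simp
  finally have "(\<integral>\<^sup>+\<omega>. Q \<omega> \<partial>M) \<noteq> \<infinity>" by simp
  then have "AE \<omega> in M. Q \<omega> \<noteq> \<infinity>" by (rule nn_integral_noteq_infinite[OF Q_meas])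
  then show ?thesis
  proof eventually_elim
    fix \<omega> assume Q: "Q \<omega> \<noteq> \<infinity>"
    have "(\<integral>\<^sup>+s. G r s \<omega> \<partial>lborel) = (\<integral>\<^sup>+s\<in>{0..T}. ennreal ((h (Y s \<omega> + K * r powr \<gamma>) - h (Y s \<omega> - K * r powr \<gamma>)) * W s \<omega> / r powr ((1 - \<gamma>) + 1)) \<partial>lborel) * indicator {0..T} r" for r
    proof (cases "r \<in> {0..T}")
      case True
      then show ?thesis by (simp add: G_def g_def b_def)
    next
      case False
      then show ?thesis by (simp add: G_def)
    qed
    then have "Q \<omega> = (\<integral>\<^sup>+r\<in>{0..T}. (\<integral>\<^sup>+s\<in>{0..T}. ennreal ((h (Y s \<omega> + K * r powr \<gamma>) - h (Y s \<omega> - K * r powr \<gamma>))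
        * W s \<omega> / r powr ((1 - \<gamma>) + 1)) \<partial>lborel) \<partial>lborel)"
      by (simp only: Q_def)
    then show "(\<integral>\<^sup>+r\<in>{0..T}. (\<integral>\<^sup>+s\<in>{0..T}. ennreal ((h (Y s \<omega> + K * r powr \<gamma>) - h (Y s \<omega> - K * r powr \<gamma>))
        * W s \<omega> / r powr ((1 - \<gamma>) + 1)) \<partial>lborel) \<partial>lborel) < \<infinity>"
      using Q by (simp add: less_top)
  qed
qed

section \<open>Passing to a version with regular paths, and assembly\<close>

lemma (in prob_space) gaussian_rv_cong_AE:
  assumes X: "gaussian_rv M X" and Y: "Y \<in> borel_measurable M" and eq: "AE \<omega> in M. X \<omega> = Y \<omega>"
  shows "gaussian_rv M Y"
proof -
  have Xm: "X \<in> borel_measurable M" using X by (simp add: gaussian_rv_def)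
  consider m where "AE \<omega> in M. X \<omega> = m" | m \<sigma> where "0 < \<sigma>" "distributed M lborel X (\<lambda>x. ennreal (normal_density m \<sigma> x))"
    using X by (auto simp: gaussian_rv_def)
  then show ?thesis
  proof cases
    case 1
    with eq have "AE \<omega> in M. Y \<omega> = m" by eventually_elim simp
    then show ?thesis using Y by (auto simp: gaussian_rv_def)
  next
    case 2
    have "distr M lborel Y = distr M lborel X"
      by (rule distr_cong_AE) (use eq Xm Y in \<open>auto elim: eventually_mono\<close>)
    then have "distributed M lborel Y (\<lambda>x. ennreal (normal_density m \<sigma> x))"
      using 2(2) Y by (simp add: distributed_def)
    then show ?thesis using Y 2(1) by (auto simp: gaussian_rv_def)
  qed
qed

lemma besov1_imp_Hoelder:
  assumes g: "g \<in> besov1 T a" and T: "0 < T"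
  obtains K where "\<And>s t. 0 \<le> s \<Longrightarrow> s \<le> t \<Longrightarrow> t \<le> T \<Longrightarrow> \<bar>g t - g s\<bar> \<le> K * (t - s) powr a"
proof
  define K where "K = enn2real (besov1_norm T a g)"
  have K: "ennreal K = besov1_norm T a g" using g by (simp add: besov1_def K_def)
  have K0: "0 \<le> K" by (simp add: K_def)
  fix s t assume st: "0 \<le> s" "s \<le> t" "t \<le> T"
  show "\<bar>g t - g s\<bar> \<le> enn2real (besov1_norm T a g) * (t - s) powr a"
    unfolding K_def[symmetric]
  proof (cases "s = t")
    case False
    then have "ennreal (\<bar>g t - g s\<bar> / (t - s) powr a) + (\<integral>\<^sup>+u\<in>{s..t}. ennreal (\<bar>g u - g s\<bar> / (u - s) powr (a + 1)) \<partial>lebesgue) \<le> ennreal K"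
      unfolding K besov1_norm_def using st by (auto intro!: SUP_upper2[of "(s,t)"])
    then have "ennreal (\<bar>g t - g s\<bar> / (t - s) powr a) \<le> ennreal K"
      by (auto intro: order_trans[rotated])
    then have "\<bar>g t - g s\<bar> / (t - s) powr a \<le> K" using K0 by simp
    moreover have "0 < (t - s) powr a" using False st by simp
    ultimately show "\<bar>g t - g s\<bar> \<le> K * (t - s) powr a" by (simp add: divide_le_eq)
  qed simp
qed

theorem corollary2p11:
  fixes M :: "'a measure" and F :: "real \<Rightarrow> 'a measure"
    and B S :: "real \<Rightarrow> 'a \<Rightarrow> real" and H T :: real
    and f f' :: "real \<Rightarrow> real"
  assumes "complete_filtered_prob_space M F"
    and "T > 0"
    and "1 / 2 < H" "H < 1"
    and "fractional_brownian_motion M H B"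
    and S_def: "\<And>t \<omega>. S t \<omega> = exp (B t \<omega>)"
    and "convex_on UNIV f"
    and left_derivative: "\<And>x. (f has_real_derivative f' x) (at_left x)"
  shows "AE \<omega> in M. \<exists>I.
    has_gls_integral T
      (\<lambda>s. f' ((T - s) / T * S s \<omega> + 1 / T * (LINT u:{0..s}|lebesgue. S u \<omega>))
            * ((T - s) / T) * S s \<omega>)
      (\<lambda>s. B s \<omega>) T I \<and>
    f (1 / T * (LINT s:{0..T}|lebesgue. S s \<omega>)) = f (S 0 \<omega>) + I"
proof -
  interpret complete_filtered_prob_space M F by fact
  note T = \<open>T > 0\<close>
  \<comment> \<open>The midpoint of \<open>1 / 2\<close> and \<open>H\<close>: large enough for the
    pathwise calculus, small enough for the Besov regularity of the trajectories.\<close>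
  define \<gamma> where "\<gamma> = 1 / 4 + H / 2"
  have \<gamma>: "1 / 2 < \<gamma>" "\<gamma> < 1" "0 < \<gamma>" "\<gamma> < H"
    using \<open>1 / 2 < H\<close> \<open>H < 1\<close> by (auto simp: \<gamma>_def)
  have gp: "gaussian_process M B"
    and cov: "\<And>s t. 0 \<le> s \<Longrightarrow> 0 \<le> t \<Longrightarrow> covariance M (B t) (B s) = (t powr (2 * H) + s powr (2 * H) - \<bar>t - s\<bar> powr (2 * H)) / 2"
    and reg: "AE \<omega> in M. (\<lambda>t. B t \<omega>) \<in> besov1 T \<gamma>"
    using assms(5) T \<gamma> unfolding fractional_brownian_motion_def by auto
  have mono: "mono f'" by (rule convex_left_derivative_mono[OF assms(7) left_derivative])
  obtain N0 where N0: "N0 \<in> null_sets M" "\<And>\<omega>. \<omega> \<in> space M - N0 \<Longrightarrow> (\<lambda>t. B t \<omega>) \<in> besov1 T \<gamma>"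
    using reg by (auto elim!: AE_E3)
  \<comment> \<open>Paths on the exceptional set are replaced by 0, so that all of them are Hoelder
    and joint measurability is available; finite-dimensional laws are unaffected.\<close>
  define B' where "B' t \<omega> = (if \<omega> \<in> N0 then 0 else B t \<omega>)" for t \<omega>
  have B'_eq: "AE \<omega> in M. \<forall>t. B t \<omega> = B' t \<omega>"
    using AE_not_in[OF N0(1)] by eventually_elim (simp add: B'_def)
  have Bm: "B t \<in> borel_measurable M" if "0 \<le> t" for t
    by (rule gaussian_process_measurable[OF gp that])
  have B'm: "B' t \<in> borel_measurable M" if "0 \<le> t" for t
    unfolding B'_def using Bm[OF that] N0(1) by (intro measurable_If_set) auto
  have gp': "gaussian_process M B'"
    unfolding gaussian_process_def
  proof (intro allI impI)
    fix I :: "real set" and c :: "real \<Rightarrow> real" assume I: "finite I" "I \<subseteq> {0..}"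
    show "gaussian_rv M (\<lambda>\<omega>. \<Sum>t\<in>I. c t * B' t \<omega>)"
    proof (rule gaussian_rv_cong_AE)
      show "gaussian_rv M (\<lambda>\<omega>. \<Sum>t\<in>I. c t * B t \<omega>)" using gp I by (simp add: gaussian_process_def)
      show "(\<lambda>\<omega>. \<Sum>t\<in>I. c t * B' t \<omega>) \<in> borel_measurable M"
        by (intro borel_measurable_sum borel_measurable_times borel_measurable_const B'm) (use I in auto)
      show "AE \<omega> in M. (\<Sum>t\<in>I. c t * B t \<omega>) = (\<Sum>t\<in>I. c t * B' t \<omega>)"
        using B'_eq by eventually_elim simp
    qed
  qed
  have cov': "covariance M (B' t) (B' s) = (t powr (2 * H) + s powr (2 * H) - \<bar>t - s\<bar> powr (2 * H)) / 2"
    if "0 \<le> s" "0 \<le> t" for s t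
  proof -
    note [measurable] = Bm[OF that(1)] Bm[OF that(2)] B'm[OF that(1)] B'm[OF that(2)]
    have "expectation (B' t) = expectation (B t)" "expectation (B' s) = expectation (B s)"
      by (intro integral_cong_AE; use B'_eq in \<open>auto elim: eventually_mono\<close>)+
    then have "covariance M (B' t) (B' s) = covariance M (B t) (B s)"
      unfolding covariance_def by (intro integral_cong_AE) (use B'_eq in \<open>auto elim!: eventually_mono\<close>)
    then show ?thesis using cov that by simp
  qed
  have path: "\<exists>K. hoelder_path T \<gamma> K (\<lambda>t. B' t \<omega>)" if \<omega>: "\<omega> \<in> space M" for \<omega>
  proof (cases "\<omega> \<in> N0")
    case True
    then show ?thesis using T \<gamma> by (intro exI[of _ 0]) (unfold_locales, auto simp: B'_def)
  next
    case False
    then have B': "(\<lambda>t. B' t \<omega>) = (\<lambda>t. B t \<omega>)" by (simp add: B'_def)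
    have "(\<lambda>t. B t \<omega>) \<in> besov1 T \<gamma>" using N0 \<omega> False by auto
    then obtain K where "\<And>s t. 0 \<le> s \<Longrightarrow> s \<le> t \<Longrightarrow> t \<le> T \<Longrightarrow> \<bar>B t \<omega> - B s \<omega>\<bar> \<le> K * (t - s) powr \<gamma>"
      using besov1_imp_Hoelder[OF _ T] by metis
    then show ?thesis unfolding B' using T \<gamma> by (intro exI[of _ K]) (unfold_locales, auto)
  qed
  have cont: "continuous_on {0..T} (\<lambda>t. B' t \<omega>)" if "\<omega> \<in> space M" for \<omega>
    using path[OF that] hoelder_path.continuous_on_B by blast
  define c where "c x = max 0 (min x T)" for x
  define h where "h N x = f' (max (- real N) (min x (real N)))" for N :: nat and x
  define W where "W s \<omega> = (T - c s) / T * exp (B' (c s) \<omega>)" for s \<omega>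
  define Y where "Y s \<omega> = W s \<omega> + 1 / T * integral {0..c s} (\<lambda>u. exp (B' u \<omega>))" for s \<omega>
  \<comment> \<open>The truncation level and the window constant range over natural numbers,
    independently of the path, so that the exceptional sets for all pairs form one null set.\<close>
  have fin: "AE \<omega> in M. (\<integral>\<^sup>+r\<in>{0..T}. (\<integral>\<^sup>+s\<in>{0..T}. ennreal ((h N (Y s \<omega> + real (Suc k) * r powr \<gamma>) - h N (Y s \<omega> - real (Suc k) * r powr \<gamma>))
        * W s \<omega> / r powr ((1 - \<gamma>) + 1)) \<partial>lborel) \<partial>lborel) < \<infinity>" for N k
    unfolding Y_def W_def c_def
  proof (rule asian_besov2_energy_finite[OF gp' T _ \<open>H < 1\<close> \<gamma>(1,2) _ cov' cont])
    show "0 < H" using \<open>1 / 2 < H\<close> by simp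
    show "mono (h N)" unfolding h_def by (intro monoI monoD[OF mono]) auto
    show "f' (- real N) \<le> h N y" for y unfolding h_def by (intro monoD[OF mono]) auto
    have "h N y \<le> f' (real N)" for y unfolding h_def by (intro monoD[OF mono]) auto
    then show "h N y \<le> f' (- real N) + (f' (real N) - f' (- real N))" for y by simp
  qed simp_all
  have "AE \<omega> in M. \<forall>N k. (\<integral>\<^sup>+r\<in>{0..T}. (\<integral>\<^sup>+s\<in>{0..T}. ennreal ((h N (Y s \<omega> + real (Suc k) * r powr \<gamma>) - h N (Y s \<omega> - real (Suc k) * r powr \<gamma>))
        * W s \<omega> / r powr ((1 - \<gamma>) + 1)) \<partial>lborel) \<partial>lborel) < \<infinity>"
    unfolding AE_all_countable using fin by blast
  then show ?thesis
    using AE_space AE_not_in[OF N0(1)]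
  proof eventually_elim
    fix \<omega>
    assume fin: "\<forall>N k. (\<integral>\<^sup>+r\<in>{0..T}. (\<integral>\<^sup>+s\<in>{0..T}. ennreal ((h N (Y s \<omega> + real (Suc k) * r powr \<gamma>) - h N (Y s \<omega> - real (Suc k) * r powr \<gamma>))
        * W s \<omega> / r powr ((1 - \<gamma>) + 1)) \<partial>lborel) \<partial>lborel) < \<infinity>"
      and \<omega>: "\<omega> \<in> space M" "\<omega> \<notin> N0"
    define p where "p = (\<lambda>t. B t \<omega>)"
    have p_eq: "B t \<omega> = p t" for t by (simp add: p_def)
    have B'p: "B' t \<omega> = p t" for t using \<omega> by (simp add: B'_def p_def)
    obtain K where "hoelder_path T \<gamma> K p" using path[OF \<omega>(1)] by (auto simp: B'p)
    then interpret P: hoelder_path T \<gamma> K p .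
    have Y: "Y s \<omega> = P.X (P.clip s)" and W: "W s \<omega> = P.w (P.clip s)" for s
      by (simp_all add: Y_def W_def P.X_def P.w_def P.clip_def c_def B'p)
    \<comment> \<open>Only now, with the path fixed, are the integer bounds selected:
      \<open>Suc k\<close> above its Hoelder constant \<open>P.DX\<close>, and \<open>N\<close>
      above the range of \<open>P.X\<close>.\<close>
    obtain k :: nat where "P.DX \<le> real k" using real_arch_simple by blast
    then have k: "P.DX \<le> real (Suc k)" by simp
    obtain R where R: "\<forall>x\<in>P.X ` {0..T}. norm x \<le> R"
      using compact_imp_bounded[OF compact_continuous_image[OF P.continuous_on_X compact_Icc]] bounded_iff by blast
    obtain N :: nat where "R \<le> real N" using real_arch_simple by blast
    then have N: "\<bar>P.X s\<bar> \<le> real N" if s: "0 \<le> s" "s \<le> T" for s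
    proof -
      have "norm (P.X s) \<le> R" using R s by (intro bspec[OF R] imageI) auto
      then show ?thesis using \<open>R \<le> real N\<close> by simp
    qed
    define \<phi> where "\<phi> = (\<lambda>s. f' ((T - s) / T * S s \<omega> + 1 / T * (LINT u:{0..s}|lebesgue. S u \<omega>)) * ((T - s) / T) * S s \<omega>)"
    have LINT_eq: "(LINT u:{0..s}|lebesgue. S u \<omega>) = integral {0..s} (\<lambda>u. exp (p u))" if "s \<le> T" for s
    proof -
      have "continuous_on {0..s} (\<lambda>u. exp (p u))"
        by (intro continuous_intros continuous_on_subset[OF P.continuous_on_B]) (use that in auto)
      then have "(\<lambda>u. exp (p u)) absolutely_integrable_on {0..s}"
        by (rule absolutely_integrable_continuous_real)
      from set_lebesgue_integral_eq_integral(2)[OF this] show ?thesis by (simp add: S_def p_eq)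
    qed
    have \<phi>: "\<phi> s = f' (P.X s) * P.w s" if "0 \<le> s" "s \<le> T" for s
      using LINT_eq[OF that(2)] by (simp add: \<phi>_def P.X_def P.w_def S_def p_eq)
    have "\<phi> \<in> besov2 T (1 - \<gamma>)"
      by (rule P.besov2_convex_derivative[OF mono k N \<phi>]) (use fin[rule_format, of N k] in \<open>simp_all add: Y W h_def\<close>)
    then have "has_gls_integral T \<phi> p T (f (P.X T) - f (P.X 0))"
      using N0(2)[of \<omega>] \<omega> by (intro P.has_gls_integral_convex[OF assms(7) left_derivative \<phi>]) (auto simp: p_def)
    \<comment> \<open>At \<open>T\<close> the weight vanishes and the full average remains; at 0 the
      weight factor is 1 and the average is empty. The endpoints of the formula thus appear.\<close>
    moreover have "P.X T = 1 / T * (LINT s:{0..T}|lebesgue. S s \<omega>)"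
      using LINT_eq[of T] by (simp add: P.X_def P.w_def)
    moreover have "P.X 0 = S 0 \<omega>"
      using T by (simp add: P.X_def P.w_def S_def p_eq)
    ultimately show "\<exists>I. has_gls_integral T
      (\<lambda>s. f' ((T - s) / T * S s \<omega> + 1 / T * (LINT u:{0..s}|lebesgue. S u \<omega>))
            * ((T - s) / T) * S s \<omega>)
      (\<lambda>s. B s \<omega>) T I \<and>
    f (1 / T * (LINT s:{0..T}|lebesgue. S s \<omega>)) = f (S 0 \<omega>) + I"
      unfolding \<phi>_def[symmetric] p_def[symmetric]
      by (intro exI[of _ "f (P.X T) - f (P.X 0)"]) simp
  qed
qed

end
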